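(* Let $(\eta_t)_{t\ge0}$ be a multi-class stochastic six-vertex process on the line with parameters $0<b_1<b_2<1$ and with the following initial condition: (i) there are some first-class particles (finitely or infinitely many); (ii) there are infinitely many second-class particles, all at positions to the right of $0$ (i.e. $x>0$); (iii) there are infinitely many third-class particles, all at or to the left of $0$ (i.e. $x\le0$); (iv) all other positions are empty, i.e. have class $\infty$. Let $\cdots<Z_t(-1)<Z_t(0)<Z_t(1)<\cdots$ be the ordered positions of the second- and third-class particles at time $t$, where $Z_t(0)$ is chosen such that the number of third-class particles among $(Z_t(k))_{k>0}$ equals the number of second-class particles among $(Z_t(k))_{k\le0}$. For $k\in\mathbb Z$ let $\xi_t(k)=1$ if $Z_t(k)$ contains a second-class particle and $\xi_t(k)=0$ if $Z_t(k)$ contains a third-class particle. Then for any $t$, the law of $\xi_t$ conditioned on both $\mathbf Z=(Z_s(k))_{s\le t,\,k\in\mathbb Z}$ and the space-time history of the first-class particles is stochastically dominated by the blocking measure $\pi$.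
   Context: Multi-class stochastic six-vertex process. Vertices are $(x,t)\in\mathbb Z\times\mathbb Z_{\ge0}$, each with two incoming edges (from the left and from below) and two outgoing edges (right and up). Each edge carries a label (class) in $\mathbb Z\cup\{\pm\infty\}$; label $\infty$ means empty; at each vertex the multiset of outgoing labels equals that of incoming labels. Given incoming labels, the outgoing labels at each vertex are chosen independently as follows: if both incoming labels agree, all four labels agree. If the label from below is $i$ and the label from the left is $j$ with $i<j$, then with probability $b_1$ both go straight ($i$ exits up, $j$ exits right) and with probability $1-b_1$ both turn ($j$ exits up, $i$ exits right). If the label from the left is $i$ and the label from below is $j$ with $i<j$, then with probability $b_2$ both go straight ($i$ exits right, $j$ exits up) and with probability $1-b_2$ both turn ($i$ exits up, $j$ exits right). The initial condition $\eta_0$ gives the labels of the edges below the vertices $(x,0)$, and $\eta_t(x)$ is the label of the edge below $(x+t,t)$. For initial conditions that are not constant far to the left, the process is defined via cut-vertices: realize the vertex choices with i.i.d. uniform $[0,1]$ variables $U_v$ (in the first case go straight iff $U_v<b_1$, in the second iff $U_v<b_2$). At vertices with $U_v\ge b_2$ the label leaving to the right is the one incoming from below regardless of the label on the left, and almost surely on each line there are such vertices arbitrarily far to the left, so the labels on the line are well defined from the labels below it. First-, second- and third-class particles are labels $1,2,3$. The space-time history of the first-class particles is the set of edges carrying label $1$. Let $A=\{\eta:\mathbb Z\to\{0,1\}:\sum_{x\le 0}\eta(x)=\sum_{x\ge1}(1-\eta(x))<\infty\}$. With $q=b_1/b_2\in(0,1)$, let $\hat\pi=\bigotimes_{x\in\mathbb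 Z}\mathrm{Ber}\!\left(\frac{q^{-x}}{1+q^{-x}}\right)$; the blocking measure is $\pi(\cdot)=\hat\pi(\cdot\mid A)$. For $\eta\in A$ the height function $h_\eta:\mathbb Z\to\mathbb Z$ is defined by $\lim_{x\to-\infty}h_\eta(x)=0$ and $h_\eta(x+1)-h_\eta(x)=\eta(x)$. For probability measures $\mu,\nu$ on $A$, $\mu$ stochastically dominates $\nu$ if there is a coupling $(\eta,\xi)$ with $\eta\sim\mu$, $\xi\sim\nu$ such that $h_\xi(x)\le h_\eta(x)$ for all $x$. *)

theory Defs
  imports "HOL-Probability.Probability" "HOL-Library.Extended"
begin

section \<open>Multi-class stochastic six-vertex process\<close>

text \<open>Classes are \<open>\<int> \<union> {\<plusminus>\<infinity>}\<close>; an edge of class \<^const>\<open>Pinf\<close> is empty.\<close>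

type_synonym label = "int extended"

text \<open>
  Outgoing labels (up, right) of a vertex with uniform variable \<open>u\<close>, where \<open>i\<close> comes in from
  below and \<open>j\<close> from the left.  Going straight is \<open>(i, j)\<close> and turning is \<open>(j, i)\<close>.
\<close>

definition vertex_out :: "real \<Rightarrow> real \<Rightarrow> real \<Rightarrow> label \<Rightarrow> label \<Rightarrow> label \<times> label" where
  "vertex_out b1 b2 u i j =
     (if i < j then (if u < b1 then (i, j) else (j, i))
      else if j < i then (if u < b2 then (i, j) else (j, i))
      else (i, j))"

text \<open>
  A row is given by its uniform variables \<open>u\<close> and by the labels \<open>v\<close> of the edges entering it from
  below.  \<open>right_from_cut b1 b2 u v y n\<close> is the label leaving \<open>y + n\<close> to the right when \<open>y\<close> is a
  cut-vertex, i.e. \<open>b2 \<le> u y\<close>, so that \<open>v y\<close> leaves \<open>y\<close> to the right whatever comes from its left.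
\<close>

fun right_from_cut ::
  "real \<Rightarrow> real \<Rightarrow> (int \<Rightarrow> real) \<Rightarrow> (int \<Rightarrow> label) \<Rightarrow> int \<Rightarrow> nat \<Rightarrow> label" where
  "right_from_cut b1 b2 u v y 0 = v y"
| "right_from_cut b1 b2 u v y (Suc n) =
     snd (vertex_out b1 b2 (u (y + int (Suc n))) (v (y + int (Suc n))) (right_from_cut b1 b2 u v y n))"

text \<open>
  The closest cut-vertex weakly to the left of \<open>x\<close> is used.  It exists almost surely when the
  variables are i.i.d. uniform and \<open>b2 < 1\<close>; the value of \<open>LEAST\<close> otherwise is irrelevant.
\<close>

definition row_right ::
  "real \<Rightarrow> real \<Rightarrow> (int \<Rightarrow> real) \<Rightarrow> (int \<Rightarrow> label) \<Rightarrow> int \<Rightarrow> label" where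
  "row_right b1 b2 u v x =
     (let n = (LEAST n. b2 \<le> u (x - int n)) in right_from_cut b1 b2 u v (x - int n) n)"

text \<open>\<open>label_below \<dots> t x\<close> is the label of the edge below the vertex \<open>(x, t)\<close>.\<close>

fun label_below ::
  "real \<Rightarrow> real \<Rightarrow> (int \<times> nat \<Rightarrow> real) \<Rightarrow> (int \<Rightarrow> label) \<Rightarrow> nat \<Rightarrow> int \<Rightarrow> label" where
  "label_below b1 b2 u \<eta>\<^sub>0 0 x = \<eta>\<^sub>0 x"
| "label_below b1 b2 u \<eta>\<^sub>0 (Suc t) x =
     fst (vertex_out b1 b2 (u (x, t)) (label_below b1 b2 u \<eta>\<^sub>0 t x)
       (row_right b1 b2 (\<lambda>y. u (y, t)) (label_below b1 b2 u \<eta>\<^sub>0 t) (x - 1)))"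

text \<open>
  \<open>Vert x t\<close> enters the vertex \<open>(x, t)\<close> from below and \<open>Horiz x t\<close> leaves it to the right.
\<close>

datatype edge = Vert int nat | Horiz int nat

fun s6v_label ::
  "real \<Rightarrow> real \<Rightarrow> (int \<times> nat \<Rightarrow> real) \<Rightarrow> (int \<Rightarrow> label) \<Rightarrow> edge \<Rightarrow> label" where
  "s6v_label b1 b2 u \<eta>\<^sub>0 (Vert x t) = label_below b1 b2 u \<eta>\<^sub>0 t x"
| "s6v_label b1 b2 u \<eta>\<^sub>0 (Horiz x t) =
     row_right b1 b2 (\<lambda>y. u (y, t)) (label_below b1 b2 u \<eta>\<^sub>0 t) x"

definition s6v ::
  "real \<Rightarrow> real \<Rightarrow> (int \<times> nat \<Rightarrow> real) \<Rightarrow> (int \<Rightarrow> label) \<Rightarrow> nat \<Rightarrow> int \<Rightarrow> label" where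
  "s6v b1 b2 u \<eta>\<^sub>0 t x = s6v_label b1 b2 u \<eta>\<^sub>0 (Vert (x + int t) t)"

text \<open>
  As soon as every row has cut-vertices arbitrarily far to the left, the labels follow the vertex
  rule at every vertex.
\<close>

lemma row_right_step:
  assumes "b1 \<le> b2" and cut: "\<And>x. \<exists>y\<le>x. b2 \<le> u y"
  shows "row_right b1 b2 u v x = snd (vertex_out b1 b2 (u x) (v x) (row_right b1 b2 u v (x - 1)))"
proof (cases "b2 \<le> u x")
  case True
  then have "(LEAST n. b2 \<le> u (x - int n)) = 0"
    by (intro Least_equality) auto
  then have "row_right b1 b2 u v x = v x"
    by (simp add: row_right_def)
  with True assms(1) show ?thesis
    by (auto simp: vertex_out_def)
next
  case False
  obtain y where y: "y \<le> x" "b2 \<le> u y"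
    using cut by blast
  define k where "k = (LEAST n. b2 \<le> u (x - 1 - int n))"
  have "(LEAST n. b2 \<le> u (x - int n)) = Suc (LEAST n. b2 \<le> u (x - int (Suc n)))"
    using y False by (intro Least_Suc[of _ "nat (x - y)"]) auto
  also have "(LEAST n. b2 \<le> u (x - int (Suc n))) = k"
    unfolding k_def by (simp add: algebra_simps)
  finally have "(LEAST n. b2 \<le> u (x - int n)) = Suc k" .
  then have "row_right b1 b2 u v x = right_from_cut b1 b2 u v (x - int (Suc k)) (Suc k)"
    by (simp only: row_right_def Let_def)
  moreover have "row_right b1 b2 u v (x - 1) = right_from_cut b1 b2 u v (x - int (Suc k)) k"
    unfolding row_right_def Let_def k_def[symmetric] by (simp add: algebra_simps)
  ultimately show ?thesis
    by simp
qed

lemma s6v_label_vertex_rule: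
  fixes \<eta>\<^sub>0 :: "int \<Rightarrow> label"
  assumes "b1 \<le> b2" and "\<And>x t. \<exists>y\<le>x. b2 \<le> u (y, t)"
  defines "L \<equiv> s6v_label b1 b2 u \<eta>\<^sub>0"
  shows "(L (Vert x (Suc t)), L (Horiz x t)) =
    vertex_out b1 b2 (u (x, t)) (L (Vert x t)) (L (Horiz (x - 1) t))"
  using row_right_step[OF assms(1), of "\<lambda>y. u (y, t)" "label_below b1 b2 u \<eta>\<^sub>0 t" x] assms(2)
  by (simp add: L_def prod_eq_iff)


section \<open>Ordered second- and third-class particles\<close>

definition ordered_positions :: "(int \<Rightarrow> label) \<Rightarrow> (int \<Rightarrow> int) \<Rightarrow> bool" where
  "ordered_positions \<eta> z \<longleftrightarrow>
     strict_mono z \<and> range z = {x. \<eta> x = Fin 2 \<or> \<eta> x = Fin 3} \<and>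
     finite {k. k > 0 \<and> \<eta> (z k) = Fin 3} \<and> finite {k. k \<le> 0 \<and> \<eta> (z k) = Fin 2} \<and>
     card {k. k > 0 \<and> \<eta> (z k) = Fin 3} = card {k. k \<le> 0 \<and> \<eta> (z k) = Fin 2}"


section \<open>Configurations, height function and blocking measure\<close>

text \<open>Configurations in \<open>{0,1}\<^sup>\<int>\<close> are functions \<open>int \<Rightarrow> bool\<close>, \<open>True\<close> being \<open>1\<close>.\<close>

definition config_space :: "(int \<Rightarrow> bool) measure" where
  "config_space = (\<Pi>\<^sub>M x\<in>UNIV. count_space UNIV)"

definition balanced_configs :: "(int \<Rightarrow> bool) set" where
  "balanced_configs = {\<eta>. finite {x. x \<le> 0 \<and> \<eta> x} \<and> finite {x. x \<ge> 1 \<and> \<not> \<eta> x} \<and>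
     card {x. x \<le> 0 \<and> \<eta> x} = card {x. x \<ge> 1 \<and> \<not> \<eta> x}}"

definition height :: "(int \<Rightarrow> bool) \<Rightarrow> int \<Rightarrow> int" where
  "height \<eta> = (THE h. (h \<longlongrightarrow> 0) at_bot \<and> (\<forall>x. h (x + 1) - h x = of_bool (\<eta> x)))"

definition blocking_product :: "real \<Rightarrow> (int \<Rightarrow> bool) measure" where
  "blocking_product q =
     (\<Pi>\<^sub>M x\<in>UNIV. measure_pmf (bernoulli_pmf (q powi (- x) / (1 + q powi (- x)))))"

text \<open>\<^const>\<open>uniform_measure\<close> is the conditioning of a measure on an event.\<close>

definition blocking_measure :: "real \<Rightarrow> (int \<Rightarrow> bool) measure" where
  "blocking_measure q = uniform_measure (blocking_product q) balanced_configs"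

text \<open>Probability measures on \<^const>\<open>balanced_configs\<close> are those on \<^const>\<open>config_space\<close> carried by it.\<close>

definition stoch_dominates :: "(int \<Rightarrow> bool) measure \<Rightarrow> (int \<Rightarrow> bool) measure \<Rightarrow> bool" where
  "stoch_dominates \<mu> \<nu> \<longleftrightarrow>
     (\<exists>\<Gamma>. prob_space \<Gamma> \<and> sets \<Gamma> = sets (config_space \<Otimes>\<^sub>M config_space) \<and>
       distr \<Gamma> config_space fst = \<mu> \<and> distr \<Gamma> config_space snd = \<nu> \<and>
       (AE (\<eta>, \<xi>) in \<Gamma>. \<eta> \<in> balanced_configs \<and> \<xi> \<in> balanced_configs \<and>
          (\<forall>x. height \<xi> x \<le> height \<eta> x)))"


section \<open>Conditional laws\<close>

text \<open>\<open>\<kappa>\<close> is a regular version of the law of the \<open>N\<close>-valued variable \<open>X\<close> under \<open>M\<close> given \<open>G\<close>.\<close>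

definition conditional_law ::
  "'w measure \<Rightarrow> 'w measure \<Rightarrow> 'b measure \<Rightarrow> ('w \<Rightarrow> 'b) \<Rightarrow> ('w \<Rightarrow> 'b measure) \<Rightarrow> bool" where
  "conditional_law M G N X \<kappa> \<longleftrightarrow>
     \<kappa> \<in> measurable G (prob_algebra N) \<and>
     (\<forall>B\<in>sets N. AE \<omega> in M.
        measure (\<kappa> \<omega>) B = real_cond_exp M G (indicator (X -` B \<inter> space M)) \<omega>)"

text \<open>
  The \<open>\<sigma>\<close>-algebra generated by \<open>Z\<^sub>s(k)\<close> for \<open>s \<le> t\<close> and \<open>k \<in> \<int>\<close>, and by the random set of
  all edges (of all times) that carry the label \<open>1\<close>.
\<close>

definition history_algebra ::
  "'w measure \<Rightarrow> (nat \<Rightarrow> int \<Rightarrow> 'w \<Rightarrow> int) \<Rightarrow> (edge \<Rightarrow> 'w \<Rightarrow> label) \<Rightarrow> nat \<Rightarrow> 'w measure" where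
  "history_algebra M Z L t = sigma (space M)
     ({{\<omega> \<in> space M. Z s k \<omega> = z} | s k z. s \<le> t} \<union> {{\<omega> \<in> space M. L e \<omega> = Fin 1} | e. True})"

end

theory Submission
  imports Defs
begin

text \<open>
  Merge the classes \<open>2\<close> and \<open>3\<close>.  The choice made at a vertex where two merged particles meet does not
  affect the merged process, so that fresh uniform variables can be used at these vertices.  Hence,
  given the conditioning, \<open>\<xi>\<close> evolves from the step configuration by sweeps of independent two-site
  updates \<open>(1, 0) \<rightarrow> (0, 1)\<close> with probability \<open>b2\<close> and \<open>(0, 1) \<rightarrow> (1, 0)\<close> with probability \<open>b1\<close>, for
  which the blocking measure is reversible.

  If \<open>b1 + b2 > 1\<close>, such an update does not preserve the order of height functions, and \<open>\<xi>\<close> cannot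
  be compared with a stationary copy step by step.  Instead, let \<open>\<nu>\<close> start from the step configuration
  and evolve with the two swap probabilities exchanged, and draw the bits of a configuration from
  left to right: if \<open>z\<close> zeros of it and \<open>N\<close> zeros of \<open>\<nu>\<close> are still to come, the next bit is \<open>1\<close>
  with probability \<open>q ^ z\<close> at a one of \<open>\<nu>\<close>, and \<open>q ^ z * (1 - q ^ (N - z)) / (1 - q ^ N)\<close> at a zero.
  This kernel intertwines the two dynamics and fixes the step configuration, so that it turns the law
  of \<open>\<nu>\<close> at time \<open>t\<close> into that of \<open>\<xi>\<close>.  Under the blocking measure the next bit is \<open>1\<close> with probability
  \<open>q ^ z\<close>, which is never less; the two chains can thus be coupled such that their heights, which
  increase by \<open>0\<close> or \<open>1\<close>, do not cross.
\<close>

section \<open>Interlacing configurations\<close>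

text \<open>Why \<open>b1 + b2 > 1\<close> is an obstacle: let two configurations have the same
  heights at \<open>k\<close> and \<open>k + 2\<close>, the upper one with bits
  \<open>(1, 0)\<close> at \<open>k\<close> and \<open>k + 1\<close>, the lower one with
  \<open>(0, 1)\<close>. After the update the height at \<open>k + 1\<close> is the larger of its
  two values with probability \<open>1 - b2\<close> for the upper and \<open>b1\<close> for the
  lower configuration, so that no coupling keeps the order. Domination is therefore shown only at
  the final time, from a static description of the law. The bias of \<open>\<nu>\<close> is reversed
  and drives it away from the step configuration. This does no harm: all that is used of
  \<open>\<nu>\<close> at time \<open>t\<close> is that it is balanced. On the infinite line a sweep
  is cut off to the bonds \<open>- n .. n\<close>, where the intertwining is finite algebra; almost
  surely the result is constant for large \<open>n\<close>. Fresh variables at the meetings keep the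
  law of the variables for two reasons: whether a vertex is a meeting does not depend on its own
  variable, and changing the variable there affects no other meeting.\<close>

definition swap_prob :: "real \<Rightarrow> real \<Rightarrow> bool \<Rightarrow> bool \<Rightarrow> real" where
  "swap_prob p r a b = (if a \<and> \<not> b then p else if \<not> a \<and> b then r else 0)"

fun list_swap :: "nat \<Rightarrow> bool list \<Rightarrow> bool list" where
  "list_swap 0 (a # b # l) = b # a # l"
| "list_swap (Suc i) (a # l) = a # list_swap i l"
| "list_swap i l = l"

definition list_update_pmf :: "real \<Rightarrow> real \<Rightarrow> nat \<Rightarrow> bool list \<Rightarrow> bool list pmf" where
  "list_update_pmf p r i l =
     map_pmf (\<lambda>s. if s then list_swap i l else l) (bernoulli_pmf (swap_prob p r (l ! i) (l ! Suc i)))"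

abbreviation zeros :: "bool list \<Rightarrow> nat" where
  "zeros l \<equiv> count_list l False"

text \<open>
  The list \<open>l\<close> drawn from \<open>\<nu>\<close> by \<open>interlace_pmf\<close> has probability
  \<open>q ^ inv l * (\<Prod>k. 1 - q ^ d k)\<close>, where \<open>inv l\<close> counts the ones in front of zeros, \<open>d k\<close> is the
  excess of ones of \<open>\<nu>\<close> over ones of \<open>l\<close> up to position \<open>k\<close>, and the product is over the increases
  of \<open>d\<close>.  In the conditional probability of a one, \<open>z\<close> and \<open>N\<close> are the numbers of zeros that \<open>l\<close> and
  \<open>\<nu>\<close> still have to come.
\<close>

definition one_prob :: "real \<Rightarrow> nat \<Rightarrow> nat \<Rightarrow> bool \<Rightarrow> real" where
  "one_prob q z N n = (if n then q ^ z else q ^ z * (1 - q ^ (N - z)) / (1 - q ^ N))"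

fun interlace_pmf :: "real \<Rightarrow> nat \<Rightarrow> bool list \<Rightarrow> bool list pmf" where
  "interlace_pmf q z [] = return_pmf []"
| "interlace_pmf q z (n # ns) =
     bind_pmf (bernoulli_pmf (one_prob q z (zeros (n # ns)) n))
       (\<lambda>e. map_pmf ((#) e) (interlace_pmf q (if e then z else z - 1) ns))"

text \<open>Since \<open>q ^ z * q ^ (N - z) = q ^ N\<close>, the quotient is
  \<open>(q ^ z - q ^ N) / (1 - q ^ N)\<close>. At a zero of \<open>\<nu>\<close> one has
  \<open>0 < N\<close> because that zero is itself among the \<open>N\<close>.\<close>

lemma one_prob_bounds:
  assumes "0 < q" "q < 1" "z \<le> N" "\<not> n \<Longrightarrow> 0 < N"
  shows "0 \<le> one_prob q z N n" "one_prob q z N n \<le> 1"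
proof -
  have zN: "q ^ N = q ^ z * q ^ (N - z)"
    using assms(3) by (simp flip: power_add)
  have *: "q ^ z \<le> 1" "q ^ (N - z) \<le> 1" "q ^ N \<le> 1" "0 < q ^ z" "0 < q ^ (N - z)"
    using assms by (auto intro: power_le_one)
  then have "q ^ z * q ^ (N - z) \<le> 1"
    by (simp flip: zN)
  have "q ^ N < 1" if "\<not> n"
    using assms that by (simp add: power_less_one_iff)
  then show "0 \<le> one_prob q z N n" "one_prob q z N n \<le> 1"
    using * by (auto simp: one_prob_def field_simps zN)
qed

lemma power_neq_one: "0 < q \<Longrightarrow> q < 1 \<Longrightarrow> 0 < N \<Longrightarrow> q ^ N \<noteq> (1::real)"
  using power_strict_decreasing[of 0 N q] by simp

lemma bernoulli_pmf_0 [simp]: "bernoulli_pmf 0 = return_pmf False"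
proof (rule pmf_eqI)
  show "pmf (bernoulli_pmf 0) i = pmf (return_pmf False) i" for i
    by (cases i) (auto simp: pmf_return)
qed

lemma bernoulli_pmf_1 [simp]: "bernoulli_pmf 1 = return_pmf True"
proof (rule pmf_eqI)
  show "pmf (bernoulli_pmf 1) i = pmf (return_pmf True) i" for i
    by (cases i) (auto simp: pmf_return)
qed

text \<open>At \<open>z = 0\<close> both formulas for the next bit give 1. This settles the case in
  which \<open>z - 1\<close> would be truncated.\<close>

lemma interlace_ones:
  assumes "0 < q" "q < 1"
  shows "interlace_pmf q 0 l = return_pmf (replicate (length l) True)"
proof (induction l)
  case (Cons n l)
  have "one_prob q 0 (zeros (n # l)) n = 1"
    using assms by (auto simp: one_prob_def power_neq_one simp del: power_Suc)
  then show ?case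
    by (simp add: bind_return_pmf Cons bernoulli_pmf_1 del: count_list.simps)
qed simp

text \<open>The factor \<open>1 - q ^ (N - z)\<close> vanishes: with as many zeros to place as
  \<open>\<nu>\<close> has left, a zero of \<open>\<nu>\<close> forces a zero. This keeps
  \<open>z\<close> from exceeding the number of zeros ahead in \<open>\<nu>\<close>.\<close>

lemma one_prob_full: "one_prob q N N False = 0"
  by (simp add: one_prob_def)

text \<open>Together with \<open>interlace_snoc_True\<close> this shows that a window may grow by a
  zero on the left and a one on the right; the extension of the kernel to the line rests on
  it.\<close>

lemma interlace_False:
  "interlace_pmf q (Suc (zeros ns)) (False # ns) = map_pmf ((#) False) (interlace_pmf q (zeros ns) ns)"
  by (simp add: one_prob_full bind_return_pmf)

lemma zeros_replicate: "zeros (replicate a False @ replicate b True) = a"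
  by (induction a) (induction b, auto)

text \<open>The zeros in front are forced because \<open>z = N\<close>, the ones behind because
  \<open>z = 0\<close>.\<close>

lemma interlace_step:
  assumes "0 < q" "q < 1"
  shows "interlace_pmf q a (replicate a False @ replicate b True) = return_pmf (replicate a False @ replicate b True)"
proof (induction a)
  case 0
  then show ?case by (simp add: interlace_ones assms(1,2))
next
  case (Suc a)
  with interlace_False[of q "replicate a False @ replicate b True"] zeros_replicate[of a b] show ?case
    by (simp del: interlace_pmf.simps count_list.simps count_list_append)
qed

text \<open>\<open>one_prob\<close> sees only the zeros ahead, and the last bit is reached with no
  zero left to place.\<close>

lemma interlace_snoc_True:
  assumes "0 < q" "q < 1" "z \<le> zeros ns"
  shows "interlace_pmf q z (ns @ [True]) = map_pmf (\<lambda>l. l @ [True]) (interlace_pmf q z ns)"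
  using assms(3)
proof (induction ns arbitrary: z)
  case Nil
  then show ?case by (simp add: one_prob_def bernoulli_pmf_1 bind_return_pmf)
next
  case (Cons n ns)
  show ?case
  proof (cases "z = 0")
    case True
    show ?thesis
      by (simp only: True interlace_ones assms(1,2) map_return_pmf) (simp add: replicate_append_same)
  next
    case False
    have *: "interlace_pmf q (if e then z else z - 1) (ns @ [True]) =
       map_pmf (\<lambda>l. l @ [True]) (interlace_pmf q (if e then z else z - 1) ns)"
      if "e \<in> set_pmf (bernoulli_pmf (one_prob q z (zeros (n # ns)) n))" for e
    proof (rule Cons.IH, cases "e \<and> \<not> n \<and> z = Suc (zeros ns)")
      case True
      with that show "(if e then z else z - 1) \<le> zeros ns"
        by (simp add: one_prob_full)
    next
      case False
      with Cons.prems \<open>z \<noteq> 0\<close> show "(if e then z else z - 1) \<le> zeros ns"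
        by (auto split: if_splits)
    qed
    have "interlace_pmf q z ((n # ns) @ [True]) =
       bind_pmf (bernoulli_pmf (one_prob q z (zeros (n # ns)) n))
       (\<lambda>e. map_pmf ((#) e) (interlace_pmf q (if e then z else z - 1) (ns @ [True])))"
      by simp
    also have "\<dots> = bind_pmf (bernoulli_pmf (one_prob q z (zeros (n # ns)) n))
       (\<lambda>e. map_pmf ((#) e) (map_pmf (\<lambda>l. l @ [True]) (interlace_pmf q (if e then z else z - 1) ns)))"
      by (intro bind_pmf_cong refl) (simp only: *)
    finally show ?thesis
      by (simp add: map_bind_pmf pmf.map_comp o_def)
  qed
qed

lemma length_interlace: "l \<in> set_pmf (interlace_pmf q z ns) \<Longrightarrow> length l = length ns"
  by (induction ns arbitrary: l z) auto

lemma zeros_interlace: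
  assumes "0 < q" "q < 1" "z \<le> zeros ns" "l \<in> set_pmf (interlace_pmf q z ns)" shows "zeros l = z"
  using assms(3,4)
proof (induction ns arbitrary: l z)
  case (Cons n ns)
  show ?case
  proof (cases "z = 0")
    case True
    with Cons.prems have "l = replicate (Suc (length ns)) True"
      by (simp only: interlace_ones assms(1,2)) simp
    then show ?thesis using True by (simp only:) (induction ns, auto)
  next
    case False
    from Cons.prems(2) obtain e l' where e: "e \<in> set_pmf (bernoulli_pmf (one_prob q z (zeros (n # ns)) n))"
       "l = e # l'" "l' \<in> set_pmf (interlace_pmf q (if e then z else z - 1) ns)"
      by (auto simp only: interlace_pmf.simps set_bind_pmf set_map_pmf)
    have "(if e then z else z - 1) \<le> zeros ns"
    proof (cases "e \<and> \<not> n \<and> z = Suc (zeros ns)")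
      case True
      with e(1) show ?thesis
        by (simp add: one_prob_full)
    next
      case False
      with Cons.prems \<open>z \<noteq> 0\<close> show ?thesis
        by (auto split: if_splits)
    qed
    from Cons.IH[OF this e(3)] e(2) False show ?thesis
      by auto
  qed
qed auto

section \<open>Intertwining on two sites\<close>

lemma sum_UNIV_bool: "(\<Sum>x\<in>UNIV. f x) = f True + f False" for f :: "bool \<Rightarrow> real"
  by (simp add: UNIV_bool)

definition pair_update :: "real \<Rightarrow> real \<Rightarrow> bool \<times> bool \<Rightarrow> (bool \<times> bool) pmf" where
  "pair_update p r = (\<lambda>(a, b). map_pmf (\<lambda>s. if s then (b, a) else (a, b)) (bernoulli_pmf (swap_prob p r a b)))"

text \<open>Here \<open>z\<close> and \<open>N\<close> count the zeros from the first of the two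
  sites on, both sites included.\<close>

definition pair_interlace :: "real \<Rightarrow> nat \<Rightarrow> nat \<Rightarrow> bool \<times> bool \<Rightarrow> (bool \<times> bool) pmf" where
  "pair_interlace q z N = (\<lambda>(m, n). bind_pmf (bernoulli_pmf (one_prob q z N m))
     (\<lambda>d. map_pmf (Pair d) (bernoulli_pmf
       (one_prob q (if d then z else z - 1) (if m then N else N - 1) n))))"

lemma pmf_pair_update:
  assumes "0 \<le> p" "p \<le> 1" "0 \<le> r" "r \<le> 1"
  shows "pmf (pair_update p r (a, b)) (c, d) =
    (if c = a \<and> d = b then 1 - swap_prob p r a b else if c = b \<and> d = a then swap_prob p r a b else 0)"
proof -
  have "swap_prob p r a b \<in> {0..1}"
    using assms by (auto simp: swap_prob_def)
  then show ?thesis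
    unfolding pair_update_def map_pmf_def pmf_bind case_prod_conv
    by (subst integral_measure_pmf[of UNIV]; cases a; cases b; cases c; cases d)
       (simp_all add: sum_UNIV_bool swap_prob_def)
qed

lemma pmf_pair_interlace:
  "pmf (pair_interlace q z N (m, n)) (d, e) =
    pmf (bernoulli_pmf (one_prob q z N m)) d *
    pmf (bernoulli_pmf (one_prob q (if d then z else z - 1) (if m then N else N - 1) n)) e"
proof -
  have "pmf (map_pmf (Pair d') B) (d, e) = (if d' = d then pmf B e else 0)" for d' and B :: "bool pmf"
    by (auto simp: pmf_map_inj' inj_on_def pmf_eq_0_set_pmf)
  then show ?thesis
    unfolding pair_interlace_def pmf_bind case_prod_conv
    by (subst integral_measure_pmf[of UNIV]) (auto simp: UNIV_bool)
qed

lemma sum_UNIV_pair: "(\<Sum>x\<in>UNIV. f x) = f (True,True) + f (True,False) + f (False,True) + f (False,False)"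
  for f :: "bool \<times> bool \<Rightarrow> real"
proof -
  have *: "UNIV = {(True,True), (True,False), (False,True), (False,False)}" by auto
  show ?thesis unfolding * by (simp add: add.assoc)
qed

text \<open>For fixed \<open>m\<close> and \<open>n\<close> both sides are laws on four points, and
  their equality is an identity of rational functions in \<open>b\<close>, \<open>q\<close> and
  powers of \<open>q\<close>. With \<open>0 < z\<close> the subtraction \<open>z - 1\<close> is a
  true one. The case \<open>z = N\<close> is separate because a one over a zero is then impossible,
  and \<open>N - 1 - z\<close> would be truncated.\<close>

lemma pair_intertwining:
  assumes "0 < q" "q < 1" "0 \<le> b" "b \<le> 1" "0 < z" "z \<le> N" "of_bool (\<not> m) + of_bool (\<not> n) \<le> N"
  shows "bind_pmf (pair_interlace q z N (m, n)) (pair_update b (q * b)) =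
    bind_pmf (pair_update (q * b) b (m, n)) (pair_interlace q z N)"
proof (rule pmf_eqI, clarify)
  fix c d
  have qb: "0 \<le> q * b" "q * b \<le> 1"
    using assms by (auto intro: mult_le_one)
  have L: "pmf (bind_pmf (pair_interlace q z N (m, n)) (pair_update b (q * b))) (c, d) =
    (\<Sum>x\<in>UNIV. pmf (pair_update b (q * b) x) (c, d) * pmf (pair_interlace q z N (m, n)) x)"
    unfolding pmf_bind by (subst integral_measure_pmf[of UNIV]) (auto simp: mult.commute)
  have R: "pmf (bind_pmf (pair_update (q * b) b (m, n)) (pair_interlace q z N)) (c, d) =
    (\<Sum>x\<in>UNIV. pmf (pair_interlace q z N x) (c, d) * pmf (pair_update (q * b) b (m, n)) x)"
    unfolding pmf_bind by (subst integral_measure_pmf[of UNIV]) (auto simp: mult.commute)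
  show "pmf (bind_pmf (pair_interlace q z N (m, n)) (pair_update b (q * b))) (c, d) =
    pmf (bind_pmf (pair_update (q * b) b (m, n)) (pair_interlace q z N)) (c, d)"
  proof (cases "z = N")
    case True
    obtain z' where z': "z = Suc z'" using assms by (cases z) auto
    define y where "y = q ^ z'"
    have ne: "1 - q * y \<noteq> 0" "0 < z' \<Longrightarrow> 1 - y \<noteq> 0"
      using power_neq_one[OF assms(1,2), of "Suc z'"] power_neq_one[OF assms(1,2), of z'] by (auto simp: y_def)
    have r: "0 \<le> q * y" "q * y \<le> 1" "0 \<le> y" "y \<le> 1"
      using assms power_le_one[of q "Suc z'"] power_le_one[of q z'] by (auto simp: y_def)
    \<comment> \<open>\<open>p\<close> is the probability of a one over a zero of
      \<open>\<nu>\<close> when one zero fewer is to be placed than \<open>\<nu>\<close> has. All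
      other values are monomials or 0.\<close>
    define p where "p = y * (1 - q) / (1 - q * y)"
    have v: "one_prob q z z True = q * y" "one_prob q z z False = 0" "one_prob q (z - Suc 0) z True = y"
        "one_prob q (z - Suc 0) z False = p" "one_prob q (z - Suc 0) (z - Suc 0) True = y"
        "one_prob q (z - Suc 0) (z - Suc 0) False = 0"
      by (simp_all add: one_prob_def z' p_def y_def)
    have p: "p * (1 - q * y) = y * (1 - q)"
      using ne by (simp add: p_def)
    have o: "0 \<le> p" "p \<le> 1"
      using one_prob_bounds[OF assms(1,2), of "z - Suc 0" z False] v z' by auto
    show ?thesis
      unfolding L R sum_UNIV_pair pmf_pair_interlace pmf_pair_update[OF assms(3,4) qb] pmf_pair_update[OF qb assms(3,4)]
      by (cases m; cases n; cases c; cases d; simp add: v o r swap_prob_def True[symmetric])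
         (algebra | (insert p, algebra))+
  next
    case False
    obtain z' where z': "z = Suc z'" using assms by (cases z) auto
    obtain k where k: "N = z' + 2 + k" using assms False z' by (metis Suc_lessI add_2_eq_Suc' le_eq_less_or_eq less_iff_Suc_add add_Suc_right add_Suc)
    \<comment> \<open>With \<open>N = z' + 2 + k\<close> every power of \<open>q\<close> that occurs
      is a monomial in \<open>q\<close>, \<open>y\<close> and \<open>w\<close>, so that everything
      becomes polynomial after clearing two denominators.\<close>
    define y w where "y = q ^ z'" and "w = q ^ k"
    have ne: "1 - q * (q * (y * w)) \<noteq> 0" "1 - q * (y * w) \<noteq> 0"
      using power_neq_one[OF assms(1,2), of "z' + 2 + k"] power_neq_one[OF assms(1,2), of "z' + 1 + k"]
      by (simp_all add: y_def w_def power_add algebra_simps power2_eq_square)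
    have e: "q ^ N = q * (q * (y * w))" "q ^ (N - Suc 0) = q * (y * w)" "q ^ (N - Suc z') = q * w"
      "q ^ (N - z') = q * q * w" "q ^ (N - Suc 0 - z') = q * w" "q ^ (N - Suc 0 - Suc z') = w" "q ^ (N - Suc (Suc z')) = w"
      by (simp_all add: k y_def w_def power_add algebra_simps power2_eq_square)
    define p1 p2 p3 p4 where "p1 = one_prob q (Suc z') N False" and "p2 = one_prob q z' N False"
      and "p3 = one_prob q z' (N - Suc 0) False" and "p4 = one_prob q (Suc z') (N - Suc 0) False"
    note p_defs = p1_def[symmetric] p2_def[symmetric] p3_def[symmetric] p4_def[symmetric]
    have v: "one_prob q (Suc z') N True = q * y" "one_prob q z' N True = y"
      "one_prob q z' (N - Suc 0) True = y" "one_prob q (Suc z') (N - Suc 0) True = q * y"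
      by (simp_all add: one_prob_def y_def)
    have p: "p1 * (1 - q * (q * (y * w))) = q * y * (1 - q * w)"
      "p2 * (1 - q * (q * (y * w))) = y * (1 - q * q * w)"
      "p3 * (1 - q * (y * w)) = y * (1 - q * w)"
      "p4 * (1 - q * (y * w)) = q * y * (1 - w)"
      using ne by (simp_all add: p1_def p2_def p3_def p4_def one_prob_def e) (simp_all add: y_def algebra_simps)
    have r: "0 \<le> one_prob q z N i" "one_prob q z N i \<le> 1"
       "0 \<le> one_prob q z' N i" "one_prob q z' N i \<le> 1"
       "0 \<le> one_prob q z' (N - 1) i" "one_prob q z' (N - 1) i \<le> 1"
       "0 \<le> one_prob q z (N - 1) i" "one_prob q z (N - 1) i \<le> 1" for i
      using assms k z' by (intro one_prob_bounds; simp)+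
    \<comment> \<open>Detailed balance over \<open>(0, 0)\<close>: the drawn pair is
      \<open>(1, 0)\<close> with \<open>q\<close> times the probability of \<open>(0, 1)\<close>.
      The difference is multiplied by both denominators to make it polynomial.\<close>
    have "(p1 * (1 - p4) - q * ((1 - p1) * p3)) * ((1 - q * (q * (y * w))) * (1 - q * (y * w))) = 0"
      using p(1,3,4) by algebra
    then have pp: "p1 * (1 - p4) = q * ((1 - p1) * p3)"
      using ne by simp
    \<comment> \<open>A drawn pair \<open>(0, 0)\<close> is equally likely over
      \<open>(1, 0)\<close> and over \<open>(0, 1)\<close>.\<close>
    have "((1 - q * y) * (1 - p2) - (1 - p1) * (1 - y)) * (1 - q * (q * (y * w))) = 0"
      using p(1,2) by algebra
    then have p12: "(1 - q * y) * (1 - p2) = (1 - p1) * (1 - y)"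
      using ne by simp
    have bnd: "0 \<le> q * y" "q * y \<le> 1" "0 \<le> y" "y \<le> 1" "0 \<le> p1" "p1 \<le> 1" "0 \<le> p2" "p2 \<le> 1"
      "0 \<le> p3" "p3 \<le> 1" "0 \<le> p4" "p4 \<le> 1"
      using r[of True] r[of False] by (simp_all add: z' v p_defs)
    show ?thesis
      unfolding L R sum_UNIV_pair pmf_pair_interlace pmf_pair_update[OF assms(3,4) qb] pmf_pair_update[OF qb assms(3,4)]
      by (cases m; cases n; cases c; cases d; simp add: z' swap_prob_def bnd v p_defs)
         (algebra | (insert pp, algebra) | (insert p12, algebra))+
  qed
qed

section \<open>Intertwining for one bond of a list\<close>

lemma zeros_list_swap [simp]: "zeros (list_swap i l) = zeros l"
  by (induction i l rule: list_swap.induct) auto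

lemma length_list_swap [simp]: "length (list_swap i l) = length l"
  by (induction i l rule: list_swap.induct) auto

lemma list_update_pmf_0:
  "list_update_pmf p r 0 (a # b # l) = map_pmf (\<lambda>(c, d). c # d # l) (pair_update p r (a, b))"
  unfolding list_update_pmf_def pair_update_def case_prod_conv pmf.map_comp
  by (intro map_pmf_cong) auto

lemma list_update_pmf_Suc:
  "list_update_pmf p r (Suc i) (a # l) = map_pmf ((#) a) (list_update_pmf p r i l)"
  unfolding list_update_pmf_def pmf.map_comp
  by (intro map_pmf_cong) auto

text \<open>Behind the first two sites the kernel depends only on how many zeros each list has used
  up, which a swap of the two sites does not change.\<close>

lemma interlace_pmf_Cons2:
  "interlace_pmf q z (m # n # l) =
     bind_pmf (pair_interlace q z (zeros (m # n # l)) (m, n))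
       (\<lambda>(d, e). map_pmf (\<lambda>l'. d # e # l') (interlace_pmf q (z - of_bool (\<not> d) - of_bool (\<not> e)) l))"
proof -
  have *: "(if e then if d then z else z - 1 else (if d then z else z - 1) - 1) = z - of_bool (\<not> d) - of_bool (\<not> e)" for d e
    by simp
  show ?thesis
    unfolding pair_interlace_def interlace_pmf.simps case_prod_conv map_bind_pmf bind_assoc_pmf bind_map_pmf pmf.map_comp * o_def
    by (intro bind_pmf_cong refl) (auto intro!: bind_pmf_cong)
qed

lemma interlace_state_le:
  assumes "z \<le> zeros (n # ns)" "e \<in> set_pmf (bernoulli_pmf (one_prob q z (zeros (n # ns)) n))" "0 < z"
  shows "(if e then z else z - 1) \<le> zeros ns"
proof (cases "e \<and> \<not> n \<and> z = Suc (zeros ns)")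
  case True
  with assms show ?thesis
    by (simp add: one_prob_full)
next
  case False
  with assms show ?thesis
    by (auto split: if_splits)
qed

text \<open>The bits in front of the bond have the same law on both sides, since they see only the
  number of zeros ahead, which a swap in the tail preserves. What remains is
  \<open>pair_intertwining\<close> at the bond. With \<open>z = 0\<close> the drawn list is
  deterministic and never moves.\<close>

lemma list_intertwining:
  assumes q: "0 < q" "q < 1" and b: "0 \<le> b" "b \<le> 1" and "z \<le> zeros ns" "Suc i < length ns"
  shows "bind_pmf (interlace_pmf q z ns) (list_update_pmf b (q * b) i) =
    bind_pmf (list_update_pmf (q * b) b i ns) (interlace_pmf q z)"
proof (cases "z = 0")
  case True
  have "set_pmf (list_update_pmf (q * b) b i ns) \<subseteq> {l. length l = length ns}"
    by (auto simp: list_update_pmf_def)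
  then have "bind_pmf (list_update_pmf (q * b) b i ns) (interlace_pmf q 0) =
    bind_pmf (list_update_pmf (q * b) b i ns) (\<lambda>_. return_pmf (replicate (length ns) True))"
    by (intro bind_pmf_cong) (auto simp: interlace_ones q)
  moreover have "list_update_pmf b (q * b) i (replicate (length ns) True) = return_pmf (replicate (length ns) True)"
    using assms(6) by (simp add: list_update_pmf_def swap_prob_def)
  ultimately show ?thesis
    by (simp add: True interlace_ones q bind_return_pmf)
next
  case False
  then have "0 < z" by simp
  then show ?thesis using assms(5,6)
  proof (induction i arbitrary: ns z)
    case 0
    then obtain m n l where ns: "ns = m # n # l"
      by (metis Suc_length_conv Suc_less_eq gr0_conv_Suc length_Cons less_Suc_eq_0_disj list.exhaust list.size(3) not_less_zero)
    define N where "N = zeros ns"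
    \<comment> \<open>\<open>K\<close> draws everything behind the pair. The order of
      \<open>d\<close> and \<open>e\<close> enters it only as a prefix, so that it commutes with the
      update of the pair.\<close>
    define K where "K = (\<lambda>(d, e). map_pmf (\<lambda>l'. d # e # l') (interlace_pmf q (z - of_bool (\<not> d) - of_bool (\<not> e)) l))"
    have 1: "interlace_pmf q z (m # n # l) = bind_pmf (pair_interlace q z (zeros (m # n # l)) (m, n)) K" for m n
      by (simp only: interlace_pmf_Cons2 K_def)
    have K: "bind_pmf (K (d, e)) (list_update_pmf b (q * b) 0) = bind_pmf (pair_update b (q * b) (d, e)) K" for d e
    proof -
      have "bind_pmf (K (d, e)) (list_update_pmf b (q * b) 0) =
         bind_pmf (interlace_pmf q (z - of_bool (\<not> d) - of_bool (\<not> e)) l)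
         (\<lambda>l'. map_pmf (\<lambda>(c, d). c # d # l') (pair_update b (q * b) (d, e)))"
        by (simp add: K_def bind_map_pmf list_update_pmf_0)
      also have "\<dots> = bind_pmf (pair_update b (q * b) (d, e)) (\<lambda>(c, c').
         map_pmf (\<lambda>l'. c # c' # l') (interlace_pmf q (z - of_bool (\<not> d) - of_bool (\<not> e)) l))"
        unfolding map_pmf_def by (subst bind_commute_pmf) (simp add: case_prod_beta')
      also have "\<dots> = bind_pmf (pair_update b (q * b) (d, e)) K"
        by (intro bind_pmf_cong refl) (auto simp: K_def pair_update_def diff_right_commute simp del: of_bool_not_iff)
      finally show ?thesis .
    qed
    have "bind_pmf (interlace_pmf q z ns) (list_update_pmf b (q * b) 0) =
       bind_pmf (pair_interlace q z N (m, n)) (\<lambda>x. bind_pmf (K x) (list_update_pmf b (q * b) 0))"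
      unfolding ns 1 bind_assoc_pmf N_def ..
    also have "\<dots> = bind_pmf (bind_pmf (pair_interlace q z N (m, n)) (pair_update b (q * b))) K"
      unfolding bind_assoc_pmf by (intro bind_pmf_cong refl) (auto simp: K)
    also have "bind_pmf (pair_interlace q z N (m, n)) (pair_update b (q * b)) =
       bind_pmf (pair_update (q * b) b (m, n)) (pair_interlace q z N)"
      using 0 q b by (intro pair_intertwining) (auto simp: N_def ns)
    also have "bind_pmf (bind_pmf (pair_update (q * b) b (m, n)) (pair_interlace q z N)) K =
      bind_pmf (pair_update (q * b) b (m, n)) (\<lambda>(m, n). interlace_pmf q z (m # n # l))"
      unfolding bind_assoc_pmf
      by (intro bind_pmf_cong refl) (auto simp only: 1 split_beta, auto simp: pair_update_def N_def ns)
    also have "\<dots> = bind_pmf (list_update_pmf (q * b) b 0 ns) (interlace_pmf q z)"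
      by (simp add: ns list_update_pmf_0 bind_map_pmf case_prod_beta' del: interlace_pmf.simps)
    finally show ?case .
  next
    case (Suc i)
    then obtain n l where ns: "ns = n # l"
      by (cases ns) auto
    define B where "B = bernoulli_pmf (one_prob q z (zeros ns) n)"
    have IH: "bind_pmf (interlace_pmf q (if e then z else z - 1) l) (list_update_pmf b (q * b) i) =
       bind_pmf (list_update_pmf (q * b) b i l) (interlace_pmf q (if e then z else z - 1))"
      if "e \<in> set_pmf B" for e
    proof (cases "(if e then z else z - 1) = 0")
      case True
      have "set_pmf (list_update_pmf (q * b) b i l) \<subseteq> {l'. length l' = length l}"
        by (auto simp: list_update_pmf_def)
      then have "bind_pmf (list_update_pmf (q * b) b i l) (interlace_pmf q 0) =
        bind_pmf (list_update_pmf (q * b) b i l) (\<lambda>_. return_pmf (replicate (length l) True))"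
        by (intro bind_pmf_cong) (auto simp: interlace_ones q)
      moreover have "list_update_pmf b (q * b) i (replicate (length l) True) = return_pmf (replicate (length l) True)"
        using Suc.prems by (simp add: list_update_pmf_def swap_prob_def ns)
      ultimately show ?thesis
        by (simp only: True) (simp add: interlace_ones q bind_return_pmf)
    next
      case False
      show ?thesis
        using False Suc.prems that interlace_state_le[of z n l e q]
        by (intro Suc.IH) (auto simp: ns B_def)
    qed
    have "bind_pmf (interlace_pmf q z ns) (list_update_pmf b (q * b) (Suc i)) =
      bind_pmf B (\<lambda>e. map_pmf ((#) e) (bind_pmf (interlace_pmf q (if e then z else z - 1) l) (list_update_pmf b (q * b) i)))"
      by (simp only: ns interlace_pmf.simps bind_assoc_pmf bind_map_pmf list_update_pmf_Suc map_bind_pmf B_def)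
    also have "\<dots> = bind_pmf B (\<lambda>e. bind_pmf (list_update_pmf (q * b) b i l)
        (\<lambda>l'. map_pmf ((#) e) (interlace_pmf q (if e then z else z - 1) l')))"
      by (intro bind_pmf_cong refl) (simp only: IH map_bind_pmf)
    also have "\<dots> = bind_pmf (list_update_pmf (q * b) b i l) (\<lambda>l'. bind_pmf B
        (\<lambda>e. map_pmf ((#) e) (interlace_pmf q (if e then z else z - 1) l')))"
      by (subst bind_commute_pmf) simp
    also have "\<dots> = bind_pmf (list_update_pmf (q * b) b i l) (\<lambda>l'. interlace_pmf q z (n # l'))"
      by (intro bind_pmf_cong refl) (auto simp: B_def list_update_pmf_def ns)
    also have "\<dots> = bind_pmf (list_update_pmf (q * b) b (Suc i) ns) (interlace_pmf q z)"
      by (simp only: ns list_update_pmf_Suc bind_map_pmf)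
    finally show ?case .
  qed
qed

section \<open>Balanced configurations and the blocking measure\<close>

definition zeros_from :: "(int \<Rightarrow> bool) \<Rightarrow> int \<Rightarrow> nat" where
  "zeros_from \<eta> x = card {y. x \<le> y \<and> \<not> \<eta> y}"

definition ones_below :: "(int \<Rightarrow> bool) \<Rightarrow> int \<Rightarrow> nat" where
  "ones_below \<eta> x = card {y. y < x \<and> \<eta> y}"

text \<open>The balance condition centred at \<open>x\<close> instead of 1. When \<open>x\<close>
  grows by 1, so does the difference of the two counts, whatever bit stands there.\<close>

definition balanced_at :: "(int \<Rightarrow> bool) \<Rightarrow> int \<Rightarrow> bool" where
  "balanced_at \<eta> x \<longleftrightarrow> finite {y. x \<le> y \<and> \<not> \<eta> y} \<and> finite {y. y < x \<and> \<eta> y} \<and>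
     int (ones_below \<eta> x) = int (zeros_from \<eta> x) + x - 1"

lemma zeros_insert: "{y. x \<le> y \<and> \<not> \<eta> y} = (if \<eta> x then {} else {x}) \<union> {y. x + 1 \<le> y \<and> \<not> \<eta> y}" for x :: int
  by (auto simp: order.order_iff_strict)

lemma ones_insert: "{y. y < x + 1 \<and> \<eta> y} = (if \<eta> x then {x} else {}) \<union> {y. y < x \<and> \<eta> y}" for x :: int
  by (auto simp: order.order_iff_strict)

lemma zeros_from_step:
  assumes "finite {y. x \<le> y \<and> \<not> \<eta> y}"
  shows "zeros_from \<eta> x = zeros_from \<eta> (x + 1) + of_bool (\<not> \<eta> x)"
  using assms unfolding zeros_from_def zeros_insert[of x] by (auto split: if_splits)

lemma ones_below_step:
  assumes "finite {y. y < x \<and> \<eta> y}"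
  shows "ones_below \<eta> (x + 1) = ones_below \<eta> x + of_bool (\<eta> x)"
  using assms unfolding ones_below_def ones_insert by (auto split: if_splits)

lemma balanced_at_step: "balanced_at \<eta> (x + 1) \<longleftrightarrow> balanced_at \<eta> x"
proof -
  have 1: "finite {y. x \<le> y \<and> \<not> \<eta> y} \<longleftrightarrow> finite {y. x + 1 \<le> y \<and> \<not> \<eta> y}"
    unfolding zeros_insert[of x] by simp
  have 2: "finite {y. y < x + 1 \<and> \<eta> y} \<longleftrightarrow> finite {y. y < x \<and> \<eta> y}"
    unfolding ones_insert by simp
  show ?thesis
    unfolding balanced_at_def 1 2
    using zeros_from_step[of x \<eta>] ones_below_step[of x \<eta>] 1
    by (cases "\<eta> x") auto
qed

lemma balanced_at_const: "balanced_at \<eta> x \<longleftrightarrow> balanced_at \<eta> y"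
proof -
  have "balanced_at \<eta> x \<longleftrightarrow> balanced_at \<eta> 1" for x
  proof (induction x rule: int_induct[of _ 1])
    case (step1 i) then show ?case by (simp add: balanced_at_step)
  next
    case (step2 i) then show ?case using balanced_at_step[of \<eta> "i - 1"] by simp
  qed simp
  then show ?thesis by metis
qed

lemma balanced_iff: "\<eta> \<in> balanced_configs \<longleftrightarrow> balanced_at \<eta> x"
proof -
  have "\<eta> \<in> balanced_configs \<longleftrightarrow> balanced_at \<eta> 1"
  proof -
    have "{y. y < 1 \<and> \<eta> y} = {y. y \<le> 0 \<and> \<eta> y}" by auto
    then show ?thesis
      by (auto simp: balanced_configs_def balanced_at_def ones_below_def zeros_from_def)
  qed
  then show ?thesis using balanced_at_const by blast
qed

lemma finite_zeros: "\<eta> \<in> balanced_configs \<Longrightarrow> finite {y. x \<le> y \<and> \<not> \<eta> y}"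
  and finite_ones: "\<eta> \<in> balanced_configs \<Longrightarrow> finite {y. y < x \<and> \<eta> y}"
  by (simp_all add: balanced_iff[of _ x] balanced_at_def)

text \<open>The height is the number of ones below \<open>x\<close>; balance at \<open>x\<close>
  trades it for the number of zeros ahead, which is the state of the chains that draw bits from left
  to right.\<close>

lemma height_eq:
  assumes "\<eta> \<in> balanced_configs"
  shows "height \<eta> x = int (zeros_from \<eta> x) + x - 1"
proof -
  let ?h = "\<lambda>x. int (ones_below \<eta> x)"
  have step: "?h (x + 1) - ?h x = of_bool (\<eta> x)" for x
    using ones_below_step[OF finite_ones[OF assms]] by simp
  have ev: "eventually (\<lambda>x. ?h x = 0) at_bot"
  proof -
    obtain m where m: "\<And>y. y < 0 \<Longrightarrow> \<eta> y \<Longrightarrow> m \<le> y"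
      using bdd_below_finite[OF finite_ones[OF assms, of 0]] by (auto simp: bdd_below_def)
    have "?h x = 0" if "x \<le> min m 0" for x
    proof -
      have "{y. y < x \<and> \<eta> y} = {}" using m that by (auto simp: not_less) (meson order.strict_trans2 not_le order.trans order.asym)
      then show ?thesis unfolding ones_below_def by (metis card.empty of_nat_0)
    qed
    then show ?thesis unfolding eventually_at_bot_linorder by blast
  qed
  have "height \<eta> = ?h"
    unfolding height_def
  proof (rule the_equality)
    show "(?h \<longlongrightarrow> 0) at_bot \<and> (\<forall>x. ?h (x + 1) - ?h x = of_bool (\<eta> x))"
      using step ev by (auto intro: tendsto_eventually)
  next
    fix h :: "int \<Rightarrow> int" assume h: "(h \<longlongrightarrow> 0) at_bot \<and> (\<forall>x. h (x + 1) - h x = of_bool (\<eta> x))"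
    \<comment> \<open>The integers are discrete, so that the limit 0 is attained near minus
      infinity.\<close>
    then have "eventually (\<lambda>x. h x \<in> {0}) at_bot"
      by (intro topological_tendstoD[where l=0]) (auto intro: discrete_topology_class.open_discrete)
    with ev have "eventually (\<lambda>x. h x = ?h x) at_bot" by eventually_elim auto
    then obtain x0 where x0: "h x0 = ?h x0" unfolding eventually_at_bot_linorder by blast
    show "h = ?h"
    proof
      fix x show "h x = ?h x"
      proof (induction x rule: int_induct[of _ x0])
        case (step1 i) then show ?case using h step[of i] by (metis add_diff_cancel_left' diff_add_cancel diff_eq_eq)
      next
        case (step2 i)
        have "h i - h (i - 1) = ?h i - ?h (i - 1)"
          using h step[of "i - 1"] by (metis diff_add_cancel)
        then show ?case using step2 by simp
      qed (rule x0)
    qed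
  qed
  then show ?thesis using assms by (simp add: balanced_iff[of _ x] balanced_at_def)
qed

section \<open>Finite windows and insertion of a one\<close>

definition window :: "(int \<Rightarrow> bool) \<Rightarrow> int \<Rightarrow> nat \<Rightarrow> bool list" where
  "window \<eta> x L = map (\<lambda>k. \<eta> (x + int k)) [0..<L]"

lemma window_Suc: "window \<eta> x (Suc L) = window \<eta> x L @ [\<eta> (x + int L)]"
  by (simp add: window_def)

lemma length_window [simp]: "length (window \<eta> x L) = L"
  by (simp add: window_def)

lemma zeros_from_window:
  assumes "\<eta> \<in> balanced_configs"
  shows "zeros_from \<eta> x = zeros (window \<eta> x L) + zeros_from \<eta> (x + int L)"
proof (induction L)
  case (Suc L)
  have "zeros_from \<eta> (x + int L) = zeros_from \<eta> (x + int (Suc L)) + of_bool (\<not> \<eta> (x + int L))"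
    using zeros_from_step[OF finite_zeros[OF assms], of "x + int L"] by (simp add: algebra_simps)
  with Suc show ?case by (simp add: window_Suc)
qed (simp add: window_def)

text \<open>Pushes every zero from \<open>j\<close> on by one place, at the price of a factor
  \<open>q\<close> each under the blocking product. The numbers of ones below \<open>j\<close> and
  of zeros from \<open>j\<close> on stay the same, and so does balance.\<close>

definition insert_one :: "int \<Rightarrow> (int \<Rightarrow> bool) \<Rightarrow> int \<Rightarrow> bool" where
  "insert_one j \<eta> x = (if x < j then \<eta> x else if x = j then True else \<eta> (x - 1))"

lemma insert_one_sets:
  "{y. j \<le> y \<and> \<not> insert_one j \<eta> y} = (\<lambda>y. y + 1) ` {y. j \<le> y \<and> \<not> \<eta> y}"
  "{y. y < j \<and> insert_one j \<eta> y} = {y. y < j \<and> \<eta> y}"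
proof -
  have "y \<in> (\<lambda>y. y + 1) ` {y. j \<le> y \<and> \<not> \<eta> y}" if "j \<le> y" "\<not> insert_one j \<eta> y" for y
    using that by (intro image_eqI[of _ _ "y - 1"]) (auto simp: insert_one_def split: if_splits)
  then show "{y. j \<le> y \<and> \<not> insert_one j \<eta> y} = (\<lambda>y. y + 1) ` {y. j \<le> y \<and> \<not> \<eta> y}"
    by (auto simp: insert_one_def)
qed (auto simp: insert_one_def)

lemma zeros_from_insert_one: "zeros_from (insert_one j \<eta>) j = zeros_from \<eta> j"
  unfolding zeros_from_def insert_one_sets by (intro card_image) auto

lemma insert_one_balanced: "insert_one j \<eta> \<in> balanced_configs \<longleftrightarrow> \<eta> \<in> balanced_configs"
proof -
  have "finite ((\<lambda>y::int. y + 1) ` A) = finite A" for A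
    by (rule finite_image_iff) auto
  then show ?thesis
    unfolding balanced_iff[of _ j] balanced_at_def zeros_from_insert_one insert_one_sets ones_below_def by simp
qed

text \<open>The property of the blocking measure that makes it a Markov chain in space.\<close>

definition insertion_law :: "real \<Rightarrow> (int \<Rightarrow> bool) pmf \<Rightarrow> bool" where
  "insertion_law q P \<longleftrightarrow> set_pmf P \<subseteq> balanced_configs \<and>
     (\<forall>\<eta>\<in>balanced_configs. \<forall>j. pmf P (insert_one j \<eta>) = q ^ zeros_from \<eta> j * pmf P \<eta>)"

text \<open>Insertion maps the balanced part of \<open>S\<close> bijectively onto those of its
  members that have a one at \<open>j\<close>, and multiplies each weight by \<open>q ^ z\<close>.
  In other words, given \<open>S\<close> the bit at \<open>j\<close> is a one with probability
  \<open>q ^ z\<close>.\<close>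

lemma insertion_law_measure:
  assumes "insertion_law q P" and S: "\<And>\<eta>. \<eta> \<in> S \<Longrightarrow> zeros_from \<eta> j = z"
    and S': "\<And>\<eta>. insert_one j \<eta> \<in> S \<longleftrightarrow> \<eta> \<in> S"
  shows "measure_pmf.prob P {\<eta>\<in>S. \<eta> j} = q ^ z * measure_pmf.prob P S"
proof -
  let ?B = balanced_configs
  have supp: "measure_pmf.prob P A = measure_pmf.prob P (A \<inter> ?B)" for A
    using assms(1) by (intro measure_pmf.finite_measure_eq_AE) (auto simp: insertion_law_def AE_measure_pmf_iff)
  \<comment> \<open>The inverse of the insertion deletes the site \<open>j\<close>.\<close>
  have bij: "bij_betw (insert_one j) (S \<inter> ?B) ({\<eta>\<in>S. \<eta> j} \<inter> ?B)"
  proof (rule bij_betw_byWitness[where f' = "\<lambda>\<eta> x. if x < j then \<eta> x else \<eta> (x + 1)"])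
    let ?d = "\<lambda>\<eta> x. if x < j then \<eta> x else \<eta> (x + 1)"
    have d: "insert_one j (?d \<eta>) = \<eta>" if "\<eta> j" for \<eta>
      using that by (auto simp: insert_one_def fun_eq_iff)
    show "\<forall>\<eta>\<in>S \<inter> ?B. ?d (insert_one j \<eta>) = \<eta>"
      by (auto simp: insert_one_def fun_eq_iff)
    show "\<forall>\<eta>\<in>{\<eta>\<in>S. \<eta> j} \<inter> ?B. insert_one j (?d \<eta>) = \<eta>"
      using d by auto
    show "insert_one j ` (S \<inter> ?B) \<subseteq> {\<eta>\<in>S. \<eta> j} \<inter> ?B"
      by (auto simp: S' insert_one_balanced) (simp add: insert_one_def)
    show "?d ` ({\<eta>\<in>S. \<eta> j} \<inter> ?B) \<subseteq> S \<inter> ?B"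
    proof clarify
      fix \<eta> assume \<eta>: "\<eta> \<in> S" "\<eta> j" "\<eta> \<in> ?B"
      then show "?d \<eta> \<in> S \<inter> ?B"
        using d[of \<eta>] S'[of "?d \<eta>"] insert_one_balanced[of j "?d \<eta>"] by (simp only:) simp
    qed
  qed
  have "measure_pmf.prob P {\<eta>\<in>S. \<eta> j} = infsetsum (pmf P) ({\<eta>\<in>S. \<eta> j} \<inter> ?B)"
    by (subst supp) (rule measure_pmf_conv_infsetsum)
  also have "\<dots> = infsetsum (\<lambda>\<eta>. pmf P (insert_one j \<eta>)) (S \<inter> ?B)"
    by (rule infsetsum_reindex_bij_betw[OF bij, symmetric])
  also have "\<dots> = infsetsum (\<lambda>\<eta>. q ^ z * pmf P \<eta>) (S \<inter> ?B)"
    using assms(1) by (intro infsetsum_cong) (auto simp: insertion_law_def S)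
  also have "\<dots> = q ^ z * infsetsum (pmf P) (S \<inter> ?B)"
    by (rule infsetsum_cmult_right) (rule pmf_abs_summable)
  also have "infsetsum (pmf P) (S \<inter> ?B) = measure_pmf.prob P S"
    by (subst supp[of S]) (rule measure_pmf_conv_infsetsum[symmetric])
  finally show ?thesis .
qed

section \<open>The blocking measure as a chain of bits\<close>

fun bits_pmf :: "real \<Rightarrow> nat \<Rightarrow> nat \<Rightarrow> bool list pmf" where
  "bits_pmf q z 0 = return_pmf []"
| "bits_pmf q z (Suc L) = bind_pmf (bernoulli_pmf (q ^ z))
     (\<lambda>r. map_pmf ((#) r) (bits_pmf q (if r then z else z - 1) L))"

fun bits_prob :: "real \<Rightarrow> nat \<Rightarrow> bool list \<Rightarrow> real" where
  "bits_prob q z [] = 1"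
| "bits_prob q z (r # rs) = (if r then q ^ z else 1 - q ^ z) * bits_prob q (if r then z else z - 1) rs"

lemma pmf_bits:
  assumes "0 < q" "q < 1"
  shows "pmf (bits_pmf q z (length rs)) rs = bits_prob q z rs"
proof (induction rs arbitrary: z)
  case (Cons r rs)
  have *: "pmf (map_pmf ((#) s) X) (r # rs) = (if s = r then pmf X rs else 0)" for s X
    by (auto simp: pmf_map_inj' inj_on_def pmf_eq_0_set_pmf)
  show ?case
    using assms by (simp add: pmf_bind * Cons integral_measure_pmf[of UNIV] sum_UNIV_bool power_le_one)
qed simp

lemma bits_prob_snoc: "bits_prob q z (rs @ [r]) =
  (if r then q ^ (z - zeros rs) else 1 - q ^ (z - zeros rs)) * bits_prob q z rs"
  by (induction rs arbitrary: z) (auto)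

text \<open>The list is built up at its right end. That the earlier bits and the total number of
  zeros have given values is an event invariant under insertion at the next site, so that
  \<open>insertion_law_measure\<close> gives the law of the next bit.\<close>

lemma window_law:
  assumes q: "0 < q" "q < 1" and P: "insertion_law q P"
  shows "map_pmf (\<lambda>\<rho>. (zeros_from \<rho> x, window \<rho> x L)) P =
    bind_pmf (map_pmf (\<lambda>\<rho>. zeros_from \<rho> x) P) (\<lambda>z. map_pmf (Pair z) (bits_pmf q z L))"
proof (rule pmf_eqI)
  let ?m = "\<lambda>z rs. measure_pmf.prob P {\<rho>. zeros_from \<rho> x = z \<and> window \<rho> x (length rs) = rs}"
  let ?B = balanced_configs
  have m: "?m z rs = bits_prob q z rs * ?m z []" for z rs
  proof (induction rs rule: rev_induct)
    case (snoc r rs)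
    let ?j = "x + int (length rs)"
    \<comment> \<open>Balance is made part of the event because \<open>zeros_from\<close> has the
      default value 0 when there are infinitely many zeros.\<close>
    let ?S = "{\<rho>\<in>?B. zeros_from \<rho> x = z \<and> window \<rho> x (length rs) = rs}"
    have supp: "measure_pmf.prob P A = measure_pmf.prob P {\<rho>\<in>?B. \<rho> \<in> A}" for A
      using P by (intro measure_pmf.finite_measure_eq_AE) (auto simp: insertion_law_def AE_measure_pmf_iff)
    have zj: "zeros_from \<rho> ?j = z - zeros rs" if "\<rho> \<in> ?S" for \<rho>
      using that zeros_from_window[of \<rho> x "length rs"] by auto
    have w: "window (insert_one ?j \<rho>) x (length rs) = window \<rho> x (length rs)" for \<rho>
      by (auto simp: window_def insert_one_def)
    have inv: "insert_one ?j \<rho> \<in> ?S \<longleftrightarrow> \<rho> \<in> ?S" for \<rho>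
      using zeros_from_window[of \<rho> x "length rs"] zeros_from_window[of "insert_one ?j \<rho>" x "length rs"]
      by (auto simp: insert_one_balanced w zeros_from_insert_one)
    have T: "?m z (rs @ [True]) = q ^ (z - zeros rs) * ?m z rs"
    proof -
      have "?m z (rs @ [True]) = measure_pmf.prob P {\<rho>\<in>?S. \<rho> ?j}"
        by (subst supp) (simp add: window_Suc conj_ac)
      also have "\<dots> = q ^ (z - zeros rs) * measure_pmf.prob P ?S"
        using zj inv by (intro insertion_law_measure[OF P])
      also have "measure_pmf.prob P ?S = ?m z rs"
        by (subst supp[of "{\<rho>. zeros_from \<rho> x = z \<and> window \<rho> x (length rs) = rs}"]) simp
      finally show ?thesis .
    qed
    have "?m z rs = ?m z (rs @ [True]) + ?m z (rs @ [False])"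
      by (subst measure_pmf.finite_measure_Union[symmetric])
        (auto simp: window_Suc intro!: arg_cong[where f="measure_pmf.prob P"])
    with T have "?m z (rs @ [r]) = (if r then q ^ (z - zeros rs) else 1 - q ^ (z - zeros rs)) * ?m z rs"
      by (cases r) (auto simp: algebra_simps)
    with snoc show ?case by (simp add: bits_prob_snoc)
  qed (simp add: window_def)
  fix zrs :: "nat \<times> bool list"
  obtain z rs where zrs: "zrs = (z, rs)" by (cases zrs)
  have 1: "pmf (map_pmf (\<lambda>\<rho>. (zeros_from \<rho> x, window \<rho> x L)) P) (z, rs) = (if length rs = L then ?m z rs else 0)"
  proof (cases "length rs = L")
    case False
    then have "(\<lambda>\<rho>. (zeros_from \<rho> x, window \<rho> x L)) -` {(z, rs)} = {}" by auto
    with False show ?thesis by (simp only: pmf_map) simp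
  qed (auto simp: pmf_map vimage_def)
  have 2: "pmf (map_pmf (Pair z') X) (z, rs) = (if z' = z then pmf X rs else 0)" for z' X
    by (auto simp: pmf_map_inj' inj_on_def pmf_eq_0_set_pmf)
  have l: "length l = L" if "l \<in> set_pmf (bits_pmf q z L)" for l z
    using that by (induction L arbitrary: l z) auto
  have "pmf (bind_pmf (map_pmf (\<lambda>\<rho>. zeros_from \<rho> x) P) (\<lambda>z. map_pmf (Pair z) (bits_pmf q z L))) (z, rs) =
     (\<integral>z'. (if z' = z then pmf (bits_pmf q z L) rs else 0) \<partial>map_pmf (\<lambda>\<rho>. zeros_from \<rho> x) P)"
    unfolding pmf_bind 2 by (intro Bochner_Integration.integral_cong) auto
  also have "\<dots> = pmf (bits_pmf q z L) rs * pmf (map_pmf (\<lambda>\<rho>. zeros_from \<rho> x) P) z"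
    by (subst integral_measure_pmf[of "{z}"]) (auto split: if_splits)
  also have "\<dots> = (if length rs = L then ?m z rs else 0)"
    using l[of rs z] by (subst m) (auto simp: pmf_bits[OF q] pmf_map vimage_def pmf_eq_0_set_pmf window_def)
  finally show "pmf (map_pmf (\<lambda>\<rho>. (zeros_from \<rho> x, window \<rho> x L)) P) zrs =
    pmf (bind_pmf (map_pmf (\<lambda>\<rho>. zeros_from \<rho> x) P) (\<lambda>z. map_pmf (Pair z) (bits_pmf q z L))) zrs"
    unfolding zrs 1 ..
qed

section \<open>Monotone coupling of the interlacing kernel with the blocking chain\<close>

text \<open>
  Order is preserved because, as long as both lists have the same number \<open>zl = zr\<close> of zeros ahead,
  a one of the first requires a one of the second.
\<close>

fun couple_pmf :: "real \<Rightarrow> nat \<Rightarrow> nat \<Rightarrow> bool list \<Rightarrow> bool list \<Rightarrow> bool list pmf" where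
  "couple_pmf q zl zr (n # ns) (r # rs) = bind_pmf
     (bernoulli_pmf (if zl < zr then one_prob q zl (zeros (n # ns)) n
        else if r then one_prob q zl (zeros (n # ns)) n / q ^ zl else 0))
     (\<lambda>e. map_pmf ((#) e) (couple_pmf q (if e then zl else zl - 1) (if r then zr else zr - 1) ns rs))"
| "couple_pmf q zl zr _ _ = return_pmf []"

text \<open>\<open>(q ^ z - q ^ N) / (1 - q ^ N) \<le> q ^ z\<close> holds because
  \<open>q ^ z \<le> 1\<close>. This comparison of the two chains is the source of the
  domination.\<close>

lemma one_prob_le:
  assumes "0 < q" "q < 1" "z \<le> N" "\<not> n \<Longrightarrow> 0 < N"
  shows "one_prob q z N n \<le> q ^ z"
proof -
  have "q ^ N \<le> q ^ (N - z)" "q ^ N < 1" if "\<not> n"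
    using assms that by (auto intro: power_decreasing simp: power_less_one_iff)
  then show ?thesis
    using assms by (auto simp: one_prob_def field_simps)
qed

text \<open>Thinning: a one of probability \<open>a\<close> is kept with probability
  \<open>p / a\<close>. If \<open>a = 0\<close>, then \<open>p = 0\<close> too, in agreement with
  division by zero.\<close>

lemma bernoulli_mixture:
  assumes "0 \<le> a" "a \<le> 1" "0 \<le> p" "p \<le> a"
  shows "bind_pmf (bernoulli_pmf a) (\<lambda>r. bernoulli_pmf (if r then p / a else 0)) = bernoulli_pmf p"
proof (rule pmf_eqI)
  fix e
  have "p / a \<in> {0..1}" using assms by (auto simp: divide_le_eq)
  then show "pmf (bind_pmf (bernoulli_pmf a) (\<lambda>r. bernoulli_pmf (if r then p / a else 0))) e = pmf (bernoulli_pmf p) e"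
    using assms unfolding pmf_bind
    by (subst integral_measure_pmf[of UNIV]; cases e) (auto simp: sum_UNIV_bool right_diff_distrib)
qed

text \<open>Averaging over the bit \<open>r\<close> of the blocking chain returns the law of the bit
  \<open>e\<close>: trivially if \<open>zl < zr\<close>, by thinning if \<open>zl = zr\<close>. The
  order of the two states and the bound of \<open>interlace_state_le\<close> are carried
  along.\<close>

lemma couple_marginal:
  assumes q: "0 < q" "q < 1" and "zl \<le> zr" "zl \<le> zeros ns"
  shows "bind_pmf (bits_pmf q zr (length ns)) (couple_pmf q zl zr ns) = interlace_pmf q zl ns"
  using assms(3,4)
proof (induction ns arbitrary: zl zr)
  case Nil
  then show ?case by (simp add: bind_return_pmf)
next
  case (Cons n ns)
  let ?p = "one_prob q zl (zeros (n # ns)) n"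
  let ?c = "\<lambda>r. if zl < zr then ?p else if r then ?p / q ^ zl else 0"
  let ?I = "\<lambda>e. map_pmf ((#) e) (interlace_pmf q (if e then zl else zl - 1) ns)"
  have p: "0 \<le> ?p" "?p \<le> 1" "?p \<le> q ^ zl"
    using one_prob_bounds[OF q] one_prob_le[OF q] Cons.prems by auto
  have IH: "bind_pmf (bits_pmf q (if r then zr else zr - 1) (length ns))
      (couple_pmf q (if e then zl else zl - 1) (if r then zr else zr - 1) ns) =
      interlace_pmf q (if e then zl else zl - 1) ns"
    if r: "r \<in> set_pmf (bernoulli_pmf (q ^ zr))" and e: "e \<in> set_pmf (bernoulli_pmf (?c r))" for r e
  proof (rule Cons.IH)
    have "?c r = 0" if "\<not> r" "zl = zr" using that by simp
    then have "\<not> e" if "\<not> r" "zl = zr" using e that by (cases e) auto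
    then show "(if e then zl else zl - 1) \<le> (if r then zr else zr - 1)"
      using Cons.prems by (cases "zl = zr") auto
    have "e \<in> set_pmf (bernoulli_pmf ?p)"
    proof -
      have "?p \<noteq> 0" if e
        using e that by (auto split: if_splits)
      moreover have "?p \<noteq> 1" if "\<not> e"
      proof
        \<comment> \<open>Then \<open>zl = 0\<close>, and a zero \<open>e\<close> would require a
          zero \<open>r\<close> at \<open>zr = 0\<close>, which has probability 0.\<close>
        assume "?p = 1"
        with p(3) power_le_one[of q zl] q have "q ^ zl = 1" by linarith
        with power_neq_one[OF q, of zl] have "zl = 0" by auto
        show False
          using e that \<open>?p = 1\<close> \<open>zl = 0\<close> r Cons.prems by (cases r; cases "zr = 0") auto
      qed
      ultimately show ?thesis
        using p by (cases e) (auto simp: set_pmf_bernoulli set_pmf_iff)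
    qed
    from interlace_state_le[OF Cons.prems(2) this]
    show "(if e then zl else zl - 1) \<le> zeros ns"
      by (cases "zl = 0") auto
  qed
  have "bind_pmf (bits_pmf q zr (length (n # ns))) (couple_pmf q zl zr (n # ns)) =
    bind_pmf (bernoulli_pmf (q ^ zr)) (\<lambda>r. bind_pmf (bits_pmf q (if r then zr else zr - 1) (length ns))
      (\<lambda>rs. bind_pmf (bernoulli_pmf (?c r)) (\<lambda>e. map_pmf ((#) e)
         (couple_pmf q (if e then zl else zl - 1) (if r then zr else zr - 1) ns rs))))"
    by (simp add: bind_assoc_pmf bind_map_pmf)
  also have "\<dots> = bind_pmf (bernoulli_pmf (q ^ zr)) (\<lambda>r. bind_pmf (bernoulli_pmf (?c r)) (\<lambda>e.
      map_pmf ((#) e) (bind_pmf (bits_pmf q (if r then zr else zr - 1) (length ns))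
         (couple_pmf q (if e then zl else zl - 1) (if r then zr else zr - 1) ns))))"
    by (subst bind_commute_pmf) (simp add: map_bind_pmf)
  also have "\<dots> = bind_pmf (bernoulli_pmf (q ^ zr)) (\<lambda>r. bind_pmf (bernoulli_pmf (?c r)) ?I)"
    by (intro bind_pmf_cong refl) (simp only: IH)
  also have "\<dots> = bind_pmf (bind_pmf (bernoulli_pmf (q ^ zr)) (\<lambda>r. bernoulli_pmf (?c r))) ?I"
    by (simp add: bind_assoc_pmf)
  also have "bind_pmf (bernoulli_pmf (q ^ zr)) (\<lambda>r. bernoulli_pmf (?c r)) = bernoulli_pmf ?p"
  proof (cases "zl < zr")
    case True then show ?thesis by simp
  next
    case False
    then have "zr = zl" using Cons.prems by simp
    then show ?thesis
      using bernoulli_mixture[of "q ^ zl" ?p] p q by (simp add: power_le_one)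
  qed
  finally show ?case by simp
qed

text \<open>The zeros still to come remain ordered,
  \<open>zl - zeros (take i l) \<le> zr - zeros (take i rs)\<close>, here written without
  subtraction. A strict inequality cannot be reversed in one step, and at equality a one of the
  first list comes with a one of the second.\<close>

lemma couple_order:
  assumes "l \<in> set_pmf (couple_pmf q zl zr ns rs)" "length rs = length ns" "zeros rs \<le> zr" "zl \<le> zr"
  shows "zl + zeros (take i rs) \<le> zr + zeros (take i l)"
  using assms
proof (induction q zl zr ns rs arbitrary: l i rule: couple_pmf.induct)
  case (1 q zl zr n ns r rs)
  from 1(2) obtain e l' where e: "l = e # l'" "e \<in> set_pmf (bernoulli_pmf (if zl < zr then one_prob q zl (zeros (n # ns)) n
        else if r then one_prob q zl (zeros (n # ns)) n / q ^ zl else 0))"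
    "l' \<in> set_pmf (couple_pmf q (if e then zl else zl - 1) (if r then zr else zr - 1) ns rs)"
    by (auto simp only: couple_pmf.simps set_bind_pmf set_map_pmf)
  have *: "\<not> e" if "\<not> r" "zl = zr"
    using e(2) that by (cases e) auto
  have le: "(if e then zl else zl - 1) \<le> (if r then zr else zr - 1)"
    using * 1(5) by (cases "zl = zr") auto
  show ?case
  proof (cases i)
    case 0 then show ?thesis using 1(5) by simp
  next
    case (Suc k)
    have "(if e then zl else zl - 1) + zeros (take k rs) \<le> (if r then zr else zr - 1) + zeros (take k l')"
      using 1(3,4) e(3) le by (intro 1(1)[OF e(2)]) (auto split: if_splits)
    then show ?thesis
      using 1(4) Suc e(1) by (auto split: if_splits)
  qed
qed auto

section \<open>From lists to configurations and their heights\<close>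

definition from_window :: "nat \<Rightarrow> bool list \<Rightarrow> int \<Rightarrow> bool" where
  "from_window n l k = (if k < - int n then False else if k > int n + 1 then True else l ! nat (k + int n))"

lemma window_from_window:
  assumes "length l = 2 * n + 2"
  shows "window (from_window n l) (- int n) (2 * n + 2) = l"
  using assms by (intro nth_equalityI) (auto simp: window_def from_window_def simp del: upt_Suc)

lemma zeros_from_from_window:
  assumes "length l = 2 * n + 2"
  shows "zeros_from (from_window n l) (- int n) = zeros l" and "finite {y. - int n \<le> y \<and> \<not> from_window n l y}"
proof -
  have *: "{y. - int n \<le> y \<and> \<not> from_window n l y} = (\<lambda>k. int k - int n) ` {k. k < length l \<and> \<not> l ! k}"
  proof safe
    fix y assume "- int n \<le> y" "\<not> from_window n l y"
    then show "y \<in> (\<lambda>k. int k - int n) ` {k. k < length l \<and> \<not> l ! k}"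
      using assms by (intro image_eqI[of _ _ "nat (y + int n)"]) (auto simp: from_window_def split: if_splits)
  qed (use assms in \<open>auto simp: from_window_def\<close>)
  then show "finite {y. - int n \<le> y \<and> \<not> from_window n l y}" by simp
  show "zeros_from (from_window n l) (- int n) = zeros l"
    unfolding zeros_from_def * by (subst card_image) (auto simp: inj_on_def count_list_eq_length_filter length_filter_conv_card)
qed

lemma from_window_balanced:
  assumes "length l = 2 * n + 2"
  shows "from_window n l \<in> balanced_configs \<longleftrightarrow> zeros l = n + 1"
proof -
  have "{y. y < - int n \<and> from_window n l y} = {}"
    by (auto simp: from_window_def)
  then show ?thesis
    using zeros_from_from_window[OF assms]
    by (auto simp: balanced_iff[of _ "- int n"] balanced_at_def ones_below_def simp del: Collect_empty_eq)
qed

text \<open>Only the window needs a comparison: left of it the first configuration has height 0,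
  right of it it has no zeros ahead.\<close>

lemma from_window_height_le:
  assumes l: "length l = 2 * n + 2" "zeros l = n + 1" and \<rho>: "\<rho> \<in> balanced_configs"
    and le: "\<And>i. n + 1 + zeros (take i (window \<rho> (- int n) (2 * n + 2))) \<le> zeros_from \<rho> (- int n) + zeros (take i l)"
  shows "height (from_window n l) x \<le> height \<rho> x"
proof -
  let ?e = "from_window n l"
  have e: "?e \<in> balanced_configs" using from_window_balanced l by simp
  have "zeros_from ?e x \<le> zeros_from \<rho> x"
  proof (cases "x < - int n")
    case True
    have "ones_below ?e x = 0"
      using True by (auto simp: ones_below_def from_window_def intro!: card_eq_0_iff[THEN iffD2] disjI1)
    then show ?thesis
      using e \<rho> by (auto simp: balanced_iff[of _ x] balanced_at_def)
  next
    case False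
    show ?thesis
    proof (cases "x > int n + 2")
      case True
      then have "zeros_from ?e x = 0"
        by (auto simp: zeros_from_def from_window_def intro!: card_eq_0_iff[THEN iffD2] disjI1)
      then show ?thesis by simp
    next
      case F: False
      define i where "i = nat (x + int n)"
      have i: "x = - int n + int i" "i \<le> 2 * n + 2" using False F by (auto simp: i_def)
      have w: "window \<eta> (- int n) i = take i (window \<eta> (- int n) (2 * n + 2))" for \<eta>
        using i by (simp add: window_def take_map del: upt_Suc)
      have "zeros_from ?e (- int n) = zeros (take i l) + zeros_from ?e x"
        using zeros_from_window[OF e, of "- int n" i] i w[of ?e] window_from_window[OF l(1)] by simp
      moreover have "zeros_from \<rho> (- int n) = zeros (take i (window \<rho> (- int n) (2 * n + 2))) + zeros_from \<rho> x"
        using zeros_from_window[OF \<rho>, of "- int n" i] i w[of \<rho>] by simp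
      ultimately show ?thesis
        using le[of i] zeros_from_from_window(1)[OF l(1)] l(2) by simp
    qed
  qed
  then show ?thesis by (simp add: height_eq e \<rho>)
qed

definition dominated_coupling :: "(int \<Rightarrow> bool) pmf \<Rightarrow> (int \<Rightarrow> bool) pmf \<Rightarrow> ((int \<Rightarrow> bool) \<times> (int \<Rightarrow> bool)) pmf \<Rightarrow> bool" where
  "dominated_coupling P R g \<longleftrightarrow> map_pmf fst g = P \<and> map_pmf snd g = R \<and>
     (\<forall>(\<eta>, \<xi>)\<in>set_pmf g. \<eta> \<in> balanced_configs \<and> \<xi> \<in> balanced_configs \<and> (\<forall>x. height \<xi> x \<le> height \<eta> x))"

text \<open>Draw \<open>\<rho>\<close> from \<open>P\<close> and run the coupling along its window.
  By \<open>window_law\<close> the bits of \<open>\<rho>\<close> form the blocking chain, so that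
  \<open>couple_marginal\<close> identifies the second marginal.\<close>

lemma interlace_dominated:
  assumes q: "0 < q" "q < 1" and P: "insertion_law q P" and ns: "length ns = 2 * n + 2" "zeros ns = n + 1"
  shows "\<exists>g. dominated_coupling P (map_pmf (from_window n) (interlace_pmf q (n + 1) ns)) g"
proof -
  let ?z = "\<lambda>\<rho>. zeros_from \<rho> (- int n)" and ?w = "\<lambda>\<rho>. window \<rho> (- int n) (2 * n + 2)"
  define g where "g = bind_pmf P (\<lambda>\<rho>. map_pmf (\<lambda>l. (\<rho>, from_window n l)) (couple_pmf q (n + 1) (?z \<rho>) ns (?w \<rho>)))"
  \<comment> \<open>Balance at \<open>- n\<close> reads
    \<open>zeros_from = ones_below + n + 1\<close>; hence the coupling starts with ordered
    states.\<close>
  have bal: "\<rho> \<in> balanced_configs" "n + 1 \<le> ?z \<rho>" if "\<rho> \<in> set_pmf P" for \<rho>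
  proof -
    show "\<rho> \<in> balanced_configs"
      using P that by (auto simp: insertion_law_def)
    then show "n + 1 \<le> ?z \<rho>"
      by (auto simp: balanced_iff[of _ "- int n"] balanced_at_def)
  qed
  have "map_pmf fst g = P"
    by (simp add: g_def map_bind_pmf pmf.map_comp o_def bind_return_pmf')
  moreover have marg: "bind_pmf P (\<lambda>\<rho>. couple_pmf q (n + 1) (?z \<rho>) ns (?w \<rho>)) = interlace_pmf q (n + 1) ns"
  proof -
    have "bind_pmf P (\<lambda>\<rho>. couple_pmf q (n + 1) (?z \<rho>) ns (?w \<rho>)) =
      bind_pmf (map_pmf (\<lambda>\<rho>. (?z \<rho>, ?w \<rho>)) P) (\<lambda>(z, rs). couple_pmf q (n + 1) z ns rs)"
      by (simp add: bind_map_pmf)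
    also have "\<dots> = bind_pmf P (\<lambda>\<rho>. bind_pmf (bits_pmf q (?z \<rho>) (length ns)) (couple_pmf q (n + 1) (?z \<rho>) ns))"
      by (simp add: window_law[OF q P] bind_map_pmf bind_assoc_pmf ns)
    also have "\<dots> = bind_pmf P (\<lambda>\<rho>. interlace_pmf q (n + 1) ns)"
      using bal ns by (intro bind_pmf_cong refl couple_marginal q) auto
    finally show ?thesis by simp
  qed
  have "map_pmf snd g = map_pmf (from_window n) (interlace_pmf q (n + 1) ns)"
    by (simp only: g_def marg[symmetric] map_bind_pmf pmf.map_comp o_def snd_conv)
  moreover have "\<eta> \<in> balanced_configs \<and> \<xi> \<in> balanced_configs \<and> (\<forall>x. height \<xi> x \<le> height \<eta> x)"
    if mem: "(\<eta>, \<xi>) \<in> set_pmf g" for \<eta> \<xi>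
  proof -
    obtain l where l: "\<eta> \<in> set_pmf P" "l \<in> set_pmf (couple_pmf q (n + 1) (?z \<eta>) ns (?w \<eta>))" "\<xi> = from_window n l"
      using mem unfolding g_def by auto
    have "l \<in> set_pmf (interlace_pmf q (n + 1) ns)"
      using l(1,2) unfolding marg[symmetric] by auto
    then have l': "length l = 2 * n + 2" "zeros l = n + 1"
      using length_interlace[of l] zeros_interlace[OF q, of "n + 1" ns l] ns by auto
    have "zeros (?w \<eta>) \<le> ?z \<eta>"
      using zeros_from_window[OF bal(1)[OF l(1)], of "- int n" "2 * n + 2"] by simp
    then show ?thesis
      using l l' bal[OF l(1)] couple_order[OF l(2)] ns
      by (auto simp: from_window_balanced intro!: from_window_height_le)
  qed
  ultimately show ?thesis
    unfolding dominated_coupling_def by auto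
qed

text \<open>The dominating law is the same for all \<open>x\<close>, so that mixing the couplings
  keeps the first marginal.\<close>

lemma dominated_coupling_bind:
  assumes "\<And>x. x \<in> set_pmf V \<Longrightarrow> \<exists>g. dominated_coupling P (R x) g"
  shows "\<exists>g. dominated_coupling P (bind_pmf V R) g"
proof -
  obtain g where g: "\<And>x. x \<in> set_pmf V \<Longrightarrow> dominated_coupling P (R x) (g x)"
    using assms by metis
  have "map_pmf fst (bind_pmf V g) = bind_pmf V (\<lambda>_. P)"
    using g unfolding map_bind_pmf by (intro bind_pmf_cong) (auto simp: dominated_coupling_def)
  moreover have "map_pmf snd (bind_pmf V g) = bind_pmf V R"
    using g unfolding map_bind_pmf by (intro bind_pmf_cong) (auto simp: dominated_coupling_def)
  ultimately have "dominated_coupling P (bind_pmf V R) (bind_pmf V g)"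
    using g by (fastforce simp: dominated_coupling_def)
  then show ?thesis ..
qed

section \<open>Laws carried by countably many configurations\<close>

lemma space_config_space [simp]: "space config_space = UNIV"
  by (simp add: config_space_def space_PiM PiE_UNIV_domain)

lemma singleton_in_config_space [measurable, simp]: "{\<eta>} \<in> sets config_space"
proof -
  have "Pi\<^sub>E UNIV (\<lambda>i. {\<eta> i}) \<in> sets config_space"
    unfolding config_space_def by (intro sets_PiM_I_countable) auto
  also have "Pi\<^sub>E UNIV (\<lambda>i. {\<eta> i}) = {\<eta>}"
    by (auto simp: PiE_UNIV_domain)
  finally show ?thesis .
qed

lemma countable_in_config_space: "countable S \<Longrightarrow> S \<in> sets config_space"
  by (rule sets.countable) auto

text \<open>The product \<sigma>-algebra is not discrete, but it contains all countable sets; a law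
  carried by such a set is therefore the image of a discrete one and determined by its point
  masses.\<close>

lemma pmf_of_countable_config:
  assumes "prob_space \<mu>" and sets: "sets \<mu> = sets config_space" and S: "countable S" "AE \<eta> in \<mu>. \<eta> \<in> S"
  obtains P where "set_pmf P \<subseteq> S" "\<mu> = distr (measure_pmf P) config_space id" "\<And>\<eta>. pmf P \<eta> = measure \<mu> {\<eta>}"
proof -
  interpret prob_space \<mu> by fact
  have sing: "{\<eta>} \<in> sets \<mu>" for \<eta> by (simp add: sets)
  have S_sets: "S \<in> sets \<mu>" using S(1) by (simp add: sets countable_in_config_space)
  have z: "measure \<mu> {\<eta>} = 0" if "\<eta> \<notin> S" for \<eta>
  proof -
    have "AE x in \<mu>. x \<notin> {\<eta>}" using S(2) by eventually_elim (use that in auto)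
    then show ?thesis using sing by (simp add: AE_iff_measurable[OF _ refl] measure_eq_0_null_sets null_setsI prob_eq_0)
  qed
  have sum: "emeasure \<mu> (B \<inter> S) = (\<integral>\<^sup>+x. ennreal (measure \<mu> {x}) * indicator B x \<partial>count_space UNIV)" for B
  proof -
    have "emeasure \<mu> (B \<inter> S) = (\<integral>\<^sup>+x. emeasure \<mu> {x} \<partial>count_space (B \<inter> S))"
      using S(1) sing by (intro emeasure_countable_singleton) auto
    also have "\<dots> = (\<integral>\<^sup>+x. emeasure \<mu> {x} * indicator (B \<inter> S) x \<partial>count_space UNIV)"
      by (simp add: nn_integral_count_space_indicator)
    also have "\<dots> = (\<integral>\<^sup>+x. ennreal (measure \<mu> {x}) * indicator B x \<partial>count_space UNIV)"
      using z by (intro nn_integral_cong) (auto simp: emeasure_eq_measure indicator_def)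
    finally show ?thesis .
  qed
  have one: "emeasure \<mu> (UNIV \<inter> S) = 1"
    using S(2) S_sets by (simp add: emeasure_eq_1_AE)
  define P where "P = embed_pmf (\<lambda>\<eta>. measure \<mu> {\<eta>})"
  have P: "pmf P \<eta> = measure \<mu> {\<eta>}" for \<eta>
    unfolding P_def using sum[of UNIV] one by (intro pmf_embed_pmf) auto
  show thesis
  proof (rule that[of P])
    show "set_pmf P \<subseteq> S" using z P by (metis set_pmf_iff subsetI)
    show "pmf P \<eta> = measure \<mu> {\<eta>}" for \<eta> by (rule P)
    show "\<mu> = distr (measure_pmf P) config_space id"
    proof (rule measure_eqI)
      fix B assume B: "B \<in> sets \<mu>"
      have "emeasure \<mu> B = emeasure \<mu> (B \<inter> S)"
        using S(2) B S_sets by (intro emeasure_eq_AE) auto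
      also have "\<dots> = emeasure (measure_pmf P) B"
        by (simp add: sum nn_integral_pmf[symmetric] P nn_integral_count_space_indicator)
      also have "\<dots> = emeasure (distr (measure_pmf P) config_space id) B"
        using B by (subst emeasure_distr) (auto simp: sets)
      finally show "emeasure \<mu> B = emeasure (distr (measure_pmf P) config_space id) B" .
    qed (simp add: sets)
  qed
qed

lemma countable_balanced: "countable balanced_configs"
proof -
  let ?f = "\<lambda>\<eta>::int \<Rightarrow> bool. ({x. x \<le> 0 \<and> \<eta> x}, {x. x \<ge> 1 \<and> \<not> \<eta> x})"
  have "inj ?f"
  proof (rule injI, rule ext)
    fix \<eta> \<xi> :: "int \<Rightarrow> bool" and x assume "?f \<eta> = ?f \<xi>"
    then have "x \<in> fst (?f \<eta>) \<longleftrightarrow> x \<in> fst (?f \<xi>)" "x \<in> snd (?f \<eta>) \<longleftrightarrow> x \<in> snd (?f \<xi>)" by simp_all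
    then show "\<eta> x = \<xi> x" by (cases "x \<le> 0") auto
  qed
  moreover have "?f ` balanced_configs \<subseteq> Collect finite \<times> Collect finite"
    by (auto simp: balanced_configs_def)
  moreover have "countable (Collect finite \<times> Collect finite :: (int set \<times> int set) set)"
    by (intro countable_SIGMA countable_Collect_finite)
  ultimately show ?thesis
    by (meson countable_image_inj_on countable_subset inj_on_subset top_greatest)
qed

lemma stoch_dominates_pmf:
  assumes "dominated_coupling P R g"
  shows "stoch_dominates (distr (measure_pmf P) config_space id) (distr (measure_pmf R) config_space id)"
proof -
  let ?G = "distr (measure_pmf g) (config_space \<Otimes>\<^sub>M config_space) id"
  have id: "id \<in> measurable (measure_pmf g) (config_space \<Otimes>\<^sub>M config_space)"
    by (simp add: space_pair_measure)
  have B: "AE \<eta>\<xi> in ?G. \<eta>\<xi> \<in> balanced_configs \<times> balanced_configs"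
    using assms countable_in_config_space[OF countable_balanced]
    by (subst AE_distr_iff[OF id]) (auto simp: dominated_coupling_def AE_measure_pmf_iff)
  define S where "S = set_pmf g"
  have S: "S \<in> sets (config_space \<Otimes>\<^sub>M config_space)"
  proof (rule sets.countable)
    show "{x} \<in> sets (config_space \<Otimes>\<^sub>M config_space)" for x
    proof -
      have "{x} = {fst x} \<times> {snd x}" by auto
      then show ?thesis by (simp only:) (intro pair_measureI singleton_in_config_space)
    qed
  qed (simp add: S_def)
  have "AE x in ?G. x \<in> S"
    using S by (subst AE_distr_iff[OF id]) (auto simp: S_def AE_measure_pmf_iff)
  then have "AE (\<eta>, \<xi>) in ?G. \<eta> \<in> balanced_configs \<and> \<xi> \<in> balanced_configs \<and> (\<forall>x. height \<xi> x \<le> height \<eta> x)"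
    by eventually_elim (use assms in \<open>auto simp: dominated_coupling_def S_def\<close>)
  moreover have "distr ?G config_space fst = distr (measure_pmf P) config_space id"
    using assms by (subst distr_distr[OF _ id]) (auto simp: dominated_coupling_def map_pmf_rep_eq distr_distr)
  moreover have "distr ?G config_space snd = distr (measure_pmf R) config_space id"
    using assms by (subst distr_distr[OF _ id]) (auto simp: dominated_coupling_def map_pmf_rep_eq distr_distr)
  moreover have "prob_space ?G"
    using id by (intro measure_pmf.prob_space_distr)
  ultimately show ?thesis
    unfolding stoch_dominates_def by (intro exI[of _ ?G]) auto
qed

section \<open>Weights of the blocking product\<close>

definition site_weight :: "real \<Rightarrow> int \<Rightarrow> bool \<Rightarrow> real" where
  "site_weight q x b = (if b then 1 else q powi x)"

text \<open>Numerator and denominator are multiplied by \<open>q powi x\<close>. Ones then have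
  weight 1, and moving a zero one place to the right costs a factor \<open>q\<close>.\<close>

lemma pmf_blocking_site:
  assumes "0 < q"
  shows "pmf (bernoulli_pmf (q powi (- x) / (1 + q powi (- x)))) b = site_weight q x b / (1 + q powi x)"
proof -
  have *: "0 < q powi x" "0 < q powi (- x)" "q powi (- x) = inverse (q powi x)"
    using assms by (simp_all add: power_int_minus)
  then have "1 + q powi x \<noteq> 0" by linarith
  then have "q powi (- x) / (1 + q powi (- x)) = 1 / (1 + q powi x)"
    using *(1) assms unfolding *(3) by (simp add: field_simps)
  then show ?thesis
    using * \<open>1 + q powi x \<noteq> 0\<close> by (cases b) (auto simp: site_weight_def field_simps)
qed

definition cylinder_prob :: "real \<Rightarrow> nat \<Rightarrow> (int \<Rightarrow> bool) \<Rightarrow> real" where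
  "cylinder_prob q m \<eta> = (\<Prod>x\<in>{- int m..int m}. site_weight q x (\<eta> x) / (1 + q powi x))"

lemma sets_blocking_product: "sets (blocking_product q) = sets config_space"
  unfolding blocking_product_def config_space_def by (intro sets_PiM_cong) auto

lemma prob_space_blocking_product: "prob_space (blocking_product q)"
  unfolding blocking_product_def by (intro prob_space_PiM measure_pmf.prob_space_axioms)

text \<open>A point is the intersection of decreasing cylinders over the sites
  \<open>- m .. m\<close>.\<close>

lemma blocking_product_singleton:
  assumes "0 < q"
  shows "(\<lambda>m. cylinder_prob q m \<eta>) \<longlonglongrightarrow> measure (blocking_product q) {\<eta>}"
proof -
  interpret prob_space "blocking_product q" by (rule prob_space_blocking_product)
  interpret P: product_prob_space "\<lambda>x. measure_pmf (bernoulli_pmf (q powi (- x) / (1 + q powi (- x))))" UNIV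
    by unfold_locales
  define C where "C = (\<lambda>m. {\<xi>. \<forall>x\<in>{- int m..int m}. \<xi> x = \<eta> x})"
  have C: "C m \<in> events \<and> prob (C m) = cylinder_prob q m \<eta>" for m
  proof -
    let ?M = "\<lambda>x. measure_pmf (bernoulli_pmf (q powi (- x) / (1 + q powi (- x))))"
    have eq: "C m = prod_emb UNIV ?M {- int m..int m} (Pi\<^sub>E {- int m..int m} (\<lambda>x. {\<eta> x}))"
      by (subst prod_emb_PiE) (auto simp: C_def PiE_UNIV_domain Pi_iff split: if_splits)
    have nn: "0 \<le> cylinder_prob q m \<eta>"
      unfolding cylinder_prob_def by (intro prod_nonneg) (simp add: pmf_blocking_site[OF assms, symmetric])
    have "emeasure (blocking_product q) (C m) = (\<Prod>x\<in>{- int m..int m}. emeasure (?M x) {\<eta> x})"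
      unfolding eq blocking_product_def by (intro P.emeasure_PiM_emb) auto
    also have "\<dots> = ennreal (cylinder_prob q m \<eta>)"
      unfolding cylinder_prob_def
      by (subst prod_ennreal[symmetric]) (auto simp: emeasure_pmf_single pmf_blocking_site[OF assms, symmetric])
    finally have "prob (C m) = cylinder_prob q m \<eta>"
      using nn by (simp only: measure_def enn2real_ennreal)
    moreover have "C m \<in> events"
      unfolding eq blocking_product_def by (intro sets_PiM_I) auto
    ultimately show ?thesis by simp
  qed
  have "(\<lambda>m. prob (C m)) \<longlonglongrightarrow> prob (\<Inter>m. C m)"
    using C by (intro finite_Lim_measure_decseq) (auto simp: decseq_def C_def)
  moreover have "(\<Inter>m. C m) = {\<eta>}"
  proof -
    have "\<xi> x = \<eta> x" if "\<forall>m. \<xi> \<in> C m" for \<xi> x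
      using that[rule_format, of "nat \<bar>x\<bar>"] unfolding C_def mem_Collect_eq by (elim ballE[of _ _ x]) auto
    then have "\<xi> = \<eta>" if "\<forall>m. \<xi> \<in> C m" for \<xi>
      using that by (intro ext) blast
    moreover have "\<eta> \<in> C m" for m by (simp add: C_def)
    ultimately show ?thesis by blast
  qed
  ultimately show ?thesis using C by simp
qed

text \<open>The factors from \<open>j\<close> on are shifted by one place, which yields
  \<open>q\<close> for each zero among them. For large \<open>m\<close> all these zeros lie inside
  the cylinder.\<close>

lemma cylinder_prob_insert_one:
  assumes q: "0 < q" and \<eta>: "\<eta> \<in> balanced_configs"
  shows "eventually (\<lambda>m. cylinder_prob q m (insert_one j \<eta>) = q ^ zeros_from \<eta> j * cylinder_prob q m \<eta>) sequentially"
proof -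
  obtain k where k: "\<And>y. j \<le> y \<Longrightarrow> \<not> \<eta> y \<Longrightarrow> y \<le> k"
    using bdd_above_finite[OF finite_zeros[OF \<eta>, of j]] by (auto simp: bdd_above_def)
  have "cylinder_prob q m (insert_one j \<eta>) = q ^ zeros_from \<eta> j * cylinder_prob q m \<eta>"
    if m: "nat \<bar>j\<bar> + nat \<bar>k\<bar> + 1 \<le> m" for m
  proof -
    let ?w = "site_weight q" and ?i = "insert_one j \<eta>"
    have split: "{- int m..int m} = {- int m..<j} \<union> ({j} \<union> {j + 1..int m})" "{- int m..int m} = {- int m..<j} \<union> ({j..<int m} \<union> {int m})"
      using m by auto
    have "(\<Prod>x\<in>{- int m..int m}. ?w x (?i x)) = (\<Prod>x\<in>{- int m..<j}. ?w x (?i x)) * (?w j (?i j) * (\<Prod>x\<in>{j + 1..int m}. ?w x (?i x)))"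
      unfolding split(1) by (subst prod.union_disjoint; (subst prod.union_disjoint)?) auto
    also have "(\<Prod>x\<in>{- int m..<j}. ?w x (?i x)) = (\<Prod>x\<in>{- int m..<j}. ?w x (\<eta> x))"
      by (intro prod.cong) (auto simp: insert_one_def)
    also have "?w j (?i j) = 1" by (simp add: site_weight_def insert_one_def)
    also have "(\<Prod>x\<in>{j + 1..int m}. ?w x (?i x)) = (\<Prod>x\<in>{j..<int m}. ?w (x + 1) (\<eta> x))"
      by (rule prod.reindex_bij_witness[where i="\<lambda>x. x + 1" and j="\<lambda>x. x - 1"]) (auto simp: insert_one_def)
    also have "\<dots> = (\<Prod>x\<in>{j..<int m}. ?w x (\<eta> x) * (if \<eta> x then 1 else q))"
      using q by (intro prod.cong) (auto simp: site_weight_def power_int_add)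
    also have "\<dots> = (\<Prod>x\<in>{j..<int m}. ?w x (\<eta> x)) * (\<Prod>x\<in>{j..<int m}. if \<eta> x then 1 else q)"
      by (rule prod.distrib)
    also have "(\<Prod>x\<in>{j..<int m}. if \<eta> x then 1 else q) = (\<Prod>x\<in>{y. j \<le> y \<and> \<not> \<eta> y}. q)"
      using k m by (intro prod.mono_neutral_cong_right) (auto, force)
    also have "\<dots> = q ^ zeros_from \<eta> j" by (simp add: zeros_from_def)
    also have "(\<Prod>x\<in>{- int m..<j}. ?w x (\<eta> x)) * (1 * ((\<Prod>x\<in>{j..<int m}. ?w x (\<eta> x)) * q ^ zeros_from \<eta> j)) =
        q ^ zeros_from \<eta> j * (\<Prod>x\<in>{- int m..int m}. ?w x (\<eta> x))"
    proof -
      \<comment> \<open>The shift pushes the bit at \<open>m\<close> out of the cylinder; this is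
        free because it is a one.\<close>
      have "j \<le> int m" "k < int m" using m by auto
      then have "\<eta> (int m)" using k[of "int m"] by auto
      then have "?w (int m) (\<eta> (int m)) = 1" by (simp add: site_weight_def)
      moreover have "(\<Prod>x\<in>{- int m..int m}. ?w x (\<eta> x)) = (\<Prod>x\<in>{- int m..<j}. ?w x (\<eta> x)) * ((\<Prod>x\<in>{j..<int m}. ?w x (\<eta> x)) * ?w (int m) (\<eta> (int m)))"
        using m unfolding split(2) by (subst prod.union_disjoint; (subst prod.union_disjoint)?) auto
      ultimately show ?thesis by simp
    qed
    finally show ?thesis
      unfolding cylinder_prob_def prod_dividef by simp
  qed
  then show ?thesis unfolding eventually_sequentially by blast
qed

definition step_config :: "int \<Rightarrow> bool" where
  "step_config x \<longleftrightarrow> 0 < x"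

lemma step_config_balanced: "step_config \<in> balanced_configs"
proof -
  have *: "{x. x \<le> 0 \<and> step_config x} = {}" "{x. x \<ge> 1 \<and> \<not> step_config x} = {}"
    by (auto simp: step_config_def)
  show ?thesis unfolding balanced_configs_def mem_Collect_eq * by simp
qed

text \<open>Conditioning on balance requires an event of positive probability, and one balanced
  configuration is enough. Its factor at \<open>x\<close> is \<open>1 / (1 + q ^ |x|)\<close>, which
  is at least \<open>exp (- (q ^ |x|))\<close>.\<close>

lemma blocking_product_step_pos:
  assumes q: "0 < q" "q < 1"
  shows "0 < measure (blocking_product q) {step_config}"
proof -
  \<comment> \<open>A bound uniform in \<open>m\<close>: the sites \<open>x \<le> 0\<close> and
    \<open>x > 0\<close> give two geometric sums of at most \<open>1 / (1 - q)\<close> each.\<close>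
  have "exp (- (2 / (1 - q))) \<le> cylinder_prob q m step_config" for m
  proof -
    have s: "exp (- (q ^ nat \<bar>x\<bar>)) \<le> site_weight q x (step_config x) / (1 + q powi x)" for x
    proof -
      have "site_weight q x (step_config x) / (1 + q powi x) = 1 / (1 + q ^ nat \<bar>x\<bar>)"
      proof (cases "0 < x")
        case True
        then show ?thesis by (simp add: site_weight_def step_config_def power_int_def)
      next
        case False
        then have "q powi x = inverse (q ^ nat \<bar>x\<bar>)" by (auto simp: power_int_def power_inverse)
        moreover have "0 < q ^ nat \<bar>x\<bar>" using q by simp
        ultimately show ?thesis using False q
          by (simp add: site_weight_def step_config_def del: power_int_eq_0_iff zero_less_power) (simp add: field_simps add_pos_pos)
      qed
      moreover have "1 + q ^ nat \<bar>x\<bar> \<le> exp (q ^ nat \<bar>x\<bar>)" by (rule exp_ge_add_one_self)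
      moreover have "0 < 1 + q ^ nat \<bar>x\<bar>" using q by (simp add: add_pos_pos)
      ultimately show ?thesis by (simp add: exp_minus inverse_eq_divide frac_le)
    qed
    have geo: "(\<Sum>x\<in>A. q ^ nat \<bar>x\<bar>) \<le> 1 / (1 - q)" if "finite A" "inj_on (\<lambda>x. nat \<bar>x\<bar>) A" for A :: "int set"
    proof -
      have "(\<Sum>x\<in>A. q ^ nat \<bar>x\<bar>) = (\<Sum>k\<in>(\<lambda>x. nat \<bar>x\<bar>) ` A. q ^ k)"
        using that by (simp add: sum.reindex)
      also have "\<dots> \<le> (\<Sum>k. q ^ k)"
        using that q by (intro sum_le_suminf summable_geometric) auto
      also have "\<dots> = 1 / (1 - q)" using q by (simp add: suminf_geometric)
      finally show ?thesis .
    qed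
    have "(\<Sum>x\<in>{- int m..int m}. q ^ nat \<bar>x\<bar>) = (\<Sum>x\<in>{- int m..0}. q ^ nat \<bar>x\<bar>) + (\<Sum>x\<in>{1..int m}. q ^ nat \<bar>x\<bar>)"
      by (subst sum.union_disjoint[symmetric]) (auto intro!: sum.cong)
    also have "\<dots> \<le> 1 / (1 - q) + 1 / (1 - q)"
      by (intro add_mono geo) (auto simp: inj_on_def)
    finally have "exp (- (2 / (1 - q))) \<le> exp (\<Sum>x\<in>{- int m..int m}. - (q ^ nat \<bar>x\<bar>))"
      by (simp add: sum_negf)
    also have "\<dots> = (\<Prod>x\<in>{- int m..int m}. exp (- (q ^ nat \<bar>x\<bar>)))"
      by (simp add: exp_sum)
    also have "\<dots> \<le> cylinder_prob q m step_config"
      unfolding cylinder_prob_def using s by (intro prod_mono) auto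
    finally show ?thesis .
  qed
  then have "exp (- (2 / (1 - q))) \<le> measure (blocking_product q) {step_config}"
    by (intro LIMSEQ_le_const[OF blocking_product_singleton]) (use q in auto)
  then show ?thesis by (rule order.strict_trans2[rotated]) simp
qed

text \<open>The insertion identity passes from cylinders to point masses in the limit, and
  conditioning only divides both sides by the probability of balance, which insertion
  preserves.\<close>

lemma blocking_measure_pmf:
  assumes q: "0 < q" "q < 1"
  obtains P where "insertion_law q P" "blocking_measure q = distr (measure_pmf P) config_space id"
proof -
  interpret prob_space "blocking_product q" by (rule prob_space_blocking_product)
  let ?A = balanced_configs
  have A: "?A \<in> events"
    by (simp add: sets_blocking_product countable_in_config_space countable_balanced)
  have sing: "{\<eta>} \<in> events" for \<eta> by (simp add: sets_blocking_product)
  have "prob {step_config} \<le> prob ?A"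
    using A step_config_balanced by (intro finite_measure_mono) auto
  with blocking_product_step_pos[OF q] have pos: "0 < prob ?A" by linarith
  then have e: "emeasure (blocking_product q) ?A \<noteq> 0" "emeasure (blocking_product q) ?A \<noteq> \<infinity>"
    by (auto simp: emeasure_eq_measure)
  have ps: "prob_space (blocking_measure q)"
    unfolding blocking_measure_def using e by (rule prob_space_uniform_measure)
  have "AE \<eta> in blocking_measure q. \<eta> \<in> ?A"
    unfolding blocking_measure_def by (rule AE_uniform_measureI[OF A]) simp
  from pmf_of_countable_config[OF ps _ countable_balanced this]
  obtain P where P: "set_pmf P \<subseteq> ?A" "blocking_measure q = distr (measure_pmf P) config_space id"
    "\<And>\<eta>. pmf P \<eta> = measure (blocking_measure q) {\<eta>}"
    by (auto simp: blocking_measure_def sets_blocking_product)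
  have pmfP: "pmf P \<eta> = prob {\<eta>} / prob ?A" if "\<eta> \<in> ?A" for \<eta>
  proof -
    have "?A \<inter> {\<eta>} = {\<eta>}" using that by auto
    then show ?thesis
      unfolding P(3) blocking_measure_def using A sing e by (subst measure_uniform_measure) auto
  qed
  have "pmf P (insert_one j \<eta>) = q ^ zeros_from \<eta> j * pmf P \<eta>" if \<eta>: "\<eta> \<in> ?A" for \<eta> j
  proof -
    have "(\<lambda>m. q ^ zeros_from \<eta> j * cylinder_prob q m \<eta>) \<longlonglongrightarrow> prob {insert_one j \<eta>}"
      using blocking_product_singleton[OF q(1)]
      by (rule Lim_transform_eventually) (rule cylinder_prob_insert_one[OF q(1) \<eta>])
    moreover have "(\<lambda>m. q ^ zeros_from \<eta> j * cylinder_prob q m \<eta>) \<longlonglongrightarrow> q ^ zeros_from \<eta> j * prob {\<eta>}"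
      by (intro tendsto_intros blocking_product_singleton q)
    ultimately have "prob {insert_one j \<eta>} = q ^ zeros_from \<eta> j * prob {\<eta>}"
      by (rule LIMSEQ_unique)
    then show ?thesis using \<eta> by (simp add: pmfP insert_one_balanced)
  qed
  then have "insertion_law q P"
    using P(1) by (simp add: insertion_law_def)
  with P(2) show thesis using that by blast
qed

section \<open>Two-class dynamics on the line of particles\<close>

definition swap_sites :: "int \<Rightarrow> (int \<Rightarrow> bool) \<Rightarrow> int \<Rightarrow> bool" where
  "swap_sites k \<eta> = \<eta>(k := \<eta> (k + 1), k + 1 := \<eta> k)"

definition site_update :: "real \<Rightarrow> real \<Rightarrow> real \<Rightarrow> int \<Rightarrow> (int \<Rightarrow> bool) \<Rightarrow> int \<Rightarrow> bool" where
  "site_update p r u k \<eta> = (if u < swap_prob p r (\<eta> k) (\<eta> (k + 1)) then swap_sites k \<eta> else \<eta>)"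

text \<open>The bonds are updated from left to right, as in a row of vertices, where each vertex
  hands a label on to its right.\<close>

definition sweep :: "real \<Rightarrow> real \<Rightarrow> (int \<Rightarrow> real) \<Rightarrow> nat \<Rightarrow> (int \<Rightarrow> bool) \<Rightarrow> int \<Rightarrow> bool" where
  "sweep p r w n = fold (\<lambda>k. site_update p r (w k) k) [- int n..int n]"

primrec sweeps :: "real \<Rightarrow> real \<Rightarrow> (nat \<Rightarrow> int \<Rightarrow> real) \<Rightarrow> nat \<Rightarrow> nat \<Rightarrow> int \<Rightarrow> bool" where
  "sweeps p r w n 0 = step_config"
| "sweeps p r w n (Suc s) = sweep p r (w s) n (sweeps p r w n s)"

text \<open>A sweep over all bonds has no first one to start from. It is replaced by the limit of
  the truncated dynamics, which are eventually constant in \<open>n\<close> if every row has cuts on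
  the right.\<close>

definition evolve :: "real \<Rightarrow> real \<Rightarrow> (nat \<Rightarrow> int \<Rightarrow> real) \<Rightarrow> nat \<Rightarrow> int \<Rightarrow> bool" where
  "evolve p r w t k \<longleftrightarrow> eventually (\<lambda>n. sweeps p r w n t k) sequentially"

text \<open>The window \<open>- n .. n + 1\<close> contains both ends of all bonds
  \<open>- n .. n\<close>, and \<open>n + 1\<close> zeros among its \<open>2 * n + 2\<close> sites
  is what balance requires.\<close>

definition windowed :: "nat \<Rightarrow> (int \<Rightarrow> bool) set" where
  "windowed n = from_window n ` {l. length l = 2 * n + 2 \<and> zeros l = n + 1}"

lemma nth_list_swap: "Suc i < length l \<Longrightarrow> j < length l \<Longrightarrow>
    list_swap i l ! j = (if j = i then l ! Suc i else if j = Suc i then l ! i else l ! j)"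
  by (induction i l arbitrary: j rule: list_swap.induct) (auto simp: nth_Cons split: nat.splits)

lemma swap_from_window:
  assumes "length l = 2 * n + 2" "- int n \<le> k" "k \<le> int n"
  shows "swap_sites k (from_window n l) = from_window n (list_swap (nat (k + int n)) l)"
proof
  fix x
  have "from_window n (list_swap (nat (k + int n)) l) x =
     (if x < - int n then False else if x > int n + 1 then True else
      if x = k then l ! nat (k + 1 + int n) else if x = k + 1 then l ! nat (k + int n) else l ! nat (x + int n))"
  proof -
    have "nat (x + int n) = nat (k + int n) \<longleftrightarrow> x = k" "nat (x + int n) = Suc (nat (k + int n)) \<longleftrightarrow> x = k + 1"
      "Suc (nat (k + int n)) = nat (k + 1 + int n)" if "- int n \<le> x"
      using that assms(2) by auto
    then show ?thesis
      using assms by (auto simp: from_window_def nth_list_swap)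
  qed
  then show "swap_sites k (from_window n l) x = from_window n (list_swap (nat (k + int n)) l) x"
    using assms(2,3) by (auto simp: swap_sites_def from_window_def)
qed

lemma site_update_windowed:
  assumes "\<eta> \<in> windowed n" "- int n \<le> k" "k \<le> int n"
  shows "site_update p r u k \<eta> \<in> windowed n" "swap_sites k \<eta> \<in> windowed n"
  using assms by (auto simp: site_update_def windowed_def swap_from_window)

lemma step_config_from_window:
  "step_config = from_window n (replicate (n + 1) False @ replicate (n + 1) True)"
proof
  fix x
  have "nat (x + int n) < n + 1 \<longleftrightarrow> x \<le> 0" if "- int n \<le> x" using that by auto
  moreover have "nat (x + int n) < 2 * n + 2 \<longleftrightarrow> x \<le> int n + 1" if "- int n \<le> x" using that by auto
  ultimately show "step_config x = from_window n (replicate (n + 1) False @ replicate (n + 1) True) x"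
    by (auto simp: step_config_def from_window_def nth_append simp del: replicate.simps replicate_Suc)
qed

lemma step_config_windowed: "step_config \<in> windowed n"
  unfolding windowed_def
  by (rule image_eqI[where f="from_window n", OF step_config_from_window[of n]])
     (simp add: zeros_replicate del: replicate_Suc count_list_append)

lemma windowed_balanced: "\<eta> \<in> windowed n \<Longrightarrow> \<eta> \<in> balanced_configs"
  by (auto simp: windowed_def from_window_balanced)

lemma from_window_window:
  "from_window m (window \<eta> (- int m) (2 * m + 2)) x = (if x < - int m then False else if x > int m + 1 then True else \<eta> x)"
proof -
  have "window \<eta> (- int m) (2 * m + 2) ! nat (x + int m) = \<eta> x" if "- int m \<le> x" "x \<le> int m + 1"
  proof -
    have "nat (x + int m) < 2 * m + 2" using that by auto
    then have "window \<eta> (- int m) (2 * m + 2) ! nat (x + int m) = \<eta> (- int m + int (nat (x + int m)))"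
      unfolding window_def by (simp del: upt_Suc)
    then show ?thesis using that by simp
  qed
  then show ?thesis by (auto simp: from_window_def)
qed

lemma windowed_outside:
  assumes "\<eta> \<in> windowed n" shows "x < - int n \<Longrightarrow> \<not> \<eta> x" "x > int n + 1 \<Longrightarrow> \<eta> x"
  using assms by (auto simp: windowed_def from_window_def)

lemma windowed_mono:
  assumes "\<eta> \<in> windowed n" "n \<le> m" shows "\<eta> \<in> windowed m"
proof -
  have "\<eta> = from_window m (window \<eta> (- int m) (2 * m + 2))"
    using windowed_outside[OF assms(1)] assms(2) unfolding fun_eq_iff from_window_window by simp
  moreover have "zeros (window \<eta> (- int m) (2 * m + 2)) = m + 1"
    using calculation windowed_balanced[OF assms(1)] from_window_balanced by (metis length_window)
  ultimately show ?thesis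
    unfolding windowed_def by (intro image_eqI[of _ _ "window \<eta> (- int m) (2 * m + 2)"]) auto
qed

lemma balanced_windowed:
  assumes "\<eta> \<in> balanced_configs"
  obtains n where "\<eta> \<in> windowed n"
proof -
  obtain a where a: "\<And>x. x \<ge> 0 \<Longrightarrow> \<not> \<eta> x \<Longrightarrow> x \<le> a"
    using bdd_above_finite[OF finite_zeros[OF assms, of 0]] by (auto simp: bdd_above_def)
  obtain b where b: "\<And>x. x < 0 \<Longrightarrow> \<eta> x \<Longrightarrow> b \<le> x"
    using bdd_below_finite[OF finite_ones[OF assms, of 0]] by (auto simp: bdd_below_def)
  define m where "m = nat \<bar>a\<bar> + nat \<bar>b\<bar>"
  have "\<eta> = from_window m (window \<eta> (- int m) (2 * m + 2))"
  proof
    fix x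
    have "\<not> \<eta> x" if "x < - int m" using b[of x] that by (auto simp: m_def)
    moreover have "\<eta> x" if "x > int m + 1"
    proof -
      have "0 \<le> x" "a < x" using that by (auto simp: m_def)
      then show ?thesis using a[of x] by auto
    qed
    ultimately show "\<eta> x = from_window m (window \<eta> (- int m) (2 * m + 2)) x"
      unfolding from_window_window by simp
  qed
  moreover from this have "zeros (window \<eta> (- int m) (2 * m + 2)) = m + 1"
    using assms from_window_balanced by (metis length_window)
  ultimately have "\<eta> \<in> windowed m"
    unfolding windowed_def by (intro image_eqI[of _ _ "window \<eta> (- int m) (2 * m + 2)"]) auto
  then show thesis by (rule that)
qed

lemma fold_site_update_windowed:
  assumes "set ks \<subseteq> {- int n..int n}" "\<eta> \<in> windowed n"
  shows "fold (\<lambda>k. site_update p r (w k) k) ks \<eta> \<in> windowed n"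
  using assms by (induction ks arbitrary: \<eta>) (auto simp: site_update_windowed)

lemma sweeps_windowed: "sweeps p r w n t \<in> windowed n"
  by (induction t) (auto simp: step_config_windowed sweep_def fold_site_update_windowed)

lemma fold_site_update_trivial:
  assumes "\<And>k. k \<in> set ks \<Longrightarrow> \<eta> k = \<eta> (k + 1)"
  shows "fold (\<lambda>k. site_update p r (w k) k) ks \<eta> = \<eta>"
proof -
  have "site_update p r (w k) k \<eta> = \<eta>" if "k \<in> set ks" for k
  proof -
    have "\<eta>(k := \<eta> (k + 1), k + 1 := \<eta> k) = \<eta>"
      using assms[OF that] by (simp add: fun_eq_iff)
    then show ?thesis by (simp add: site_update_def swap_sites_def)
  qed
  then show ?thesis by (induction ks) auto
qed

lemma fold_site_update_outside:
  "(\<And>k. k \<in> set ks \<Longrightarrow> k + 1 < x) \<Longrightarrow> fold (\<lambda>k. site_update p r (w k) k) ks \<eta> x = \<eta> x"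
proof (induction ks arbitrary: \<eta>)
  case (Cons k ks)
  have "k + 1 < x" using Cons.prems by simp
  then have "site_update p r (w k) k \<eta> x = \<eta> x" by (simp add: site_update_def swap_sites_def)
  then show ?case using Cons by simp
qed simp

text \<open>A bond whose variable reaches both swap probabilities swaps nothing, so that a sweep
  carries no disturbance past it.\<close>

definition right_cuts :: "real \<Rightarrow> real \<Rightarrow> (int \<Rightarrow> real) \<Rightarrow> bool" where
  "right_cuts p r w \<longleftrightarrow> (\<forall>x. \<exists>k\<ge>x. 0 \<le> w k \<and> p \<le> w k \<and> r \<le> w k)"

lemma sweep_eventually:
  assumes "right_cuts p r w" "\<eta> \<in> windowed m"
  shows "\<exists>N. \<forall>n\<ge>N. sweep p r w n \<eta> = sweep p r w N \<eta>"
proof -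
  have \<eta>: "\<not> \<eta> x" if "x < - int m" for x using assms(2) that by (auto simp: windowed_def from_window_def)
  have \<eta>': "\<eta> x" if "x > int m + 1" for x using assms(2) that by (auto simp: windowed_def from_window_def)
  obtain c where c: "c \<ge> int m + 2" "0 \<le> w c" "p \<le> w c" "r \<le> w c"
    using assms(1) unfolding right_cuts_def by blast
  let ?f = "\<lambda>ks. fold (\<lambda>k. site_update p r (w k) k) ks"
  \<comment> \<open>Bonds left of \<open>- m - 1\<close> join two zeros, the bond \<open>c\<close>
    is a cut, and bonds right of \<open>c\<close> still join two ones; all the change happens in
    between.\<close>
  define \<zeta> where "\<zeta> = ?f [- int m - 1..c - 1] \<eta>"
  have \<zeta>: "\<zeta> x" if "x > c" for x
    unfolding \<zeta>_def using that c \<eta>' by (subst fold_site_update_outside) auto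
  have "sweep p r w n \<eta> = \<zeta>" if n: "nat c + m + 1 \<le> n" for n
  proof -
    have "[- int n..int n] = [- int n..- 2 - int m] @ [- int m - 1..c - 1] @ [c..int n]"
      using upto_split1[of "- int n" "- int m - 1" "int n"] upto_split1[of "- int m - 1" c "int n"] n c by simp
    then have "sweep p r w n \<eta> = ?f [c..int n] (?f [- int m - 1..c - 1] (?f [- int n..- 2 - int m] \<eta>))"
      by (simp add: sweep_def)
    also have "?f [- int n..- 2 - int m] \<eta> = \<eta>"
      by (rule fold_site_update_trivial) (auto simp: \<eta>)
    also have "?f [c..int n] (?f [- int m - 1..c - 1] \<eta>) = ?f [c + 1..int n] (site_update p r (w c) c \<zeta>)"
      using n c by (subst upto_rec1) (auto simp: \<zeta>_def)
    also have "site_update p r (w c) c \<zeta> = \<zeta>"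
      using c by (auto simp: site_update_def swap_prob_def)
    also have "?f [c + 1..int n] \<zeta> = \<zeta>"
      by (rule fold_site_update_trivial) (auto simp: \<zeta>)
    finally show ?thesis .
  qed
  then show ?thesis by (metis order_refl)
qed

lemma sweeps_eventually:
  assumes "\<And>s. s < t \<Longrightarrow> right_cuts p r (w s)"
  shows "\<exists>N. \<forall>n\<ge>N. sweeps p r w n t = sweeps p r w N t"
  using assms
proof (induction t)
  case (Suc t)
  then obtain N where N: "\<And>n. N \<le> n \<Longrightarrow> sweeps p r w n t = sweeps p r w N t"
    by (metis less_Suc_eq)
  obtain N' where N': "\<And>n. N' \<le> n \<Longrightarrow> sweep p r (w t) n (sweeps p r w N t) = sweep p r (w t) N' (sweeps p r w N t)"
    using sweep_eventually[OF Suc.prems sweeps_windowed] by blast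
  have "sweeps p r w n (Suc t) = sweeps p r w (max N N') (Suc t)" if "max N N' \<le> n" for n
    using that N[of n] N[of "max N N'"] N'[of n] N'[of "max N N'"] by simp
  then show ?case by blast
qed simp

lemma evolve_eventually:
  assumes "\<And>s. s < t \<Longrightarrow> right_cuts p r (w s)"
  shows "eventually (\<lambda>n. sweeps p r w n t = evolve p r w t) sequentially"
proof -
  obtain N where N: "\<And>n. N \<le> n \<Longrightarrow> sweeps p r w n t = sweeps p r w N t"
  proof -
    have "\<exists>N. \<forall>n\<ge>N. sweeps p r w n t = sweeps p r w N t"
      by (rule sweeps_eventually) (rule assms)
    then show thesis using that by blast
  qed
  have "evolve p r w t k = sweeps p r w N t k" for k
  proof -
    have "eventually (\<lambda>n. sweeps p r w n t k = sweeps p r w N t k) sequentially"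
      unfolding eventually_sequentially by (intro exI[of _ N] allI impI) (drule N, simp only:)
    then have "evolve p r w t k \<longleftrightarrow> eventually (\<lambda>n::nat. sweeps p r w N t k) sequentially"
      unfolding evolve_def by (rule eventually_cong) simp
    then show ?thesis by simp
  qed
  then have "evolve p r w t = sweeps p r w N t" by (intro ext)
  then show ?thesis unfolding eventually_sequentially by (intro exI[of _ N] allI impI) (drule N, simp only:)
qed

lemma evolve_balanced:
  assumes "\<And>s. s < t \<Longrightarrow> right_cuts p r (w s)"
  shows "evolve p r w t \<in> balanced_configs"
proof -
  have "eventually (\<lambda>n. sweeps p r w n t = evolve p r w t) sequentially"
    by (rule evolve_eventually) (rule assms)
  then obtain n where "sweeps p r w n t = evolve p r w t"
    unfolding eventually_sequentially by blast
  then show ?thesis using windowed_balanced[OF sweeps_windowed] by metis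
qed

text \<open>One fold over distinct indices for all times: the independence of all updates then
  enters in a single induction.\<close>

definition sweep_sites :: "nat \<Rightarrow> nat \<Rightarrow> (nat \<times> int) list" where
  "sweep_sites n t = concat (map (\<lambda>s. map (Pair s) [- int n..int n]) [0..<t])"

lemma sweeps_fold: "sweeps p r w n t = fold (\<lambda>(s, k). site_update p r (w s k) k) (sweep_sites n t) step_config"
  by (induction t) (simp_all add: sweep_sites_def sweep_def fold_map o_def)

lemma set_sweep_sites: "set (sweep_sites n t) = {..<t} \<times> {- int n..int n}"
  by (auto simp: sweep_sites_def)

lemma distinct_sweep_sites: "distinct (sweep_sites n t)"
  by (induction t) (auto simp: sweep_sites_def distinct_map inj_on_def)

lemma measurable_config_space_iff:
  "f \<in> measurable M config_space \<longleftrightarrow> (\<forall>k. Measurable.pred M (\<lambda>x. f x k))"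
proof
  assume f: "f \<in> measurable M config_space"
  show "\<forall>k. Measurable.pred M (\<lambda>x. f x k)"
    using f unfolding config_space_def by (auto intro: measurable_component_singleton[THEN measurable_compose[rotated]])
next
  assume "\<forall>k. Measurable.pred M (\<lambda>x. f x k)"
  then show "f \<in> measurable M config_space"
    unfolding config_space_def by (intro measurable_PiM_single') (auto simp: space_PiM PiE_UNIV_domain)
qed

lemma measurable_site_update:
  assumes u[measurable]: "u \<in> borel_measurable M" and \<eta>: "\<eta> \<in> measurable M config_space"
  shows "(\<lambda>x. site_update p r (u x) k (\<eta> x)) \<in> measurable M config_space"
proof -
  have [measurable]: "Measurable.pred M (\<lambda>x. \<eta> x i)" for i
    using \<eta> by (auto simp: measurable_config_space_iff)
  show ?thesis
    unfolding measurable_config_space_iff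
  proof
    fix i
    have "(\<lambda>x. site_update p r (u x) k (\<eta> x) i) = (\<lambda>x.
       if u x < (if \<eta> x k \<and> \<not> \<eta> x (k + 1) then p else if \<not> \<eta> x k \<and> \<eta> x (k + 1) then r else 0)
       then (if i = k + 1 then \<eta> x k else if i = k then \<eta> x (k + 1) else \<eta> x i) else \<eta> x i)"
      by (auto simp: site_update_def swap_prob_def swap_sites_def fun_eq_iff)
    also have "Measurable.pred M \<dots>" by measurable
    finally show "Measurable.pred M (\<lambda>x. site_update p r (u x) k (\<eta> x) i)" .
  qed
qed

lemma measurable_sweeps:
  assumes "\<And>s k. s < t \<Longrightarrow> (\<lambda>x. w x s k) \<in> borel_measurable M"
  shows "(\<lambda>x. sweeps p r (w x) n t) \<in> measurable M config_space"
proof -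
  have "(\<lambda>x. fold (\<lambda>(s, k). site_update p r (w x s k) k) vs (\<eta> x)) \<in> measurable M config_space"
    if "\<eta> \<in> measurable M config_space" "set vs \<subseteq> {..<t} \<times> UNIV" for vs \<eta>
    using that
  proof (induction vs arbitrary: \<eta>)
    case (Cons v vs)
    obtain s k where v: "v = (s, k)" by (cases v)
    have "(\<lambda>x. site_update p r (w x s k) k (\<eta> x)) \<in> measurable M config_space"
      using Cons.prems by (intro measurable_site_update assms) (auto simp: v)
    from Cons.IH[OF this] Cons.prems show ?case by (simp add: v)
  qed simp
  from this[of "\<lambda>_. step_config" "sweep_sites n t"] show ?thesis
    unfolding sweeps_fold by (simp add: set_sweep_sites Times_subset_cancel2 Sigma_mono)
qed

lemma measurable_evolve:
  assumes "\<And>s k. s < t \<Longrightarrow> (\<lambda>x. w x s k) \<in> borel_measurable M"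
  shows "(\<lambda>x. evolve p r (w x) t) \<in> measurable M config_space"
proof -
  have [measurable]: "Measurable.pred M (\<lambda>x. sweeps p r (w x) n t k)" for n k
    using measurable_sweeps[OF assms] by (simp add: measurable_config_space_iff)
  show ?thesis
    unfolding measurable_config_space_iff evolve_def eventually_sequentially by measurable
qed

section \<open>Independent uniform variables\<close>

abbreviation uniforms :: "('i \<Rightarrow> real) measure" where
  "uniforms \<equiv> \<Pi>\<^sub>M i\<in>UNIV. uniform_measure lborel {0..1}"

lemma prob_space_unit: "prob_space (uniform_measure lborel {0..1::real})"
  by (rule prob_space_uniform_measure) auto

lemma prob_space_uniforms: "prob_space uniforms"
  by (intro prob_space_PiM prob_space_unit)

lemma measurable_uniforms_component [measurable]: "(\<lambda>u. u i) \<in> borel_measurable uniforms"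
proof -
  have "(\<lambda>u. u i) \<in> measurable uniforms (uniform_measure lborel {0..1})"
    by (rule measurable_component_singleton) simp
  then show ?thesis by (simp cong: measurable_cong_sets)
qed

lemma space_uniforms [simp]: "space uniforms = UNIV"
  by (simp add: space_PiM PiE_UNIV_domain)

lemma emeasure_unit_less:
  assumes "0 \<le> a" "a \<le> 1"
  shows "emeasure (uniform_measure lborel {0..1::real}) {x. x < a} = ennreal a"
proof -
  have "{0..1} \<inter> {x. x < a} = {0..<a}" using assms by auto
  then show ?thesis
    using assms by (subst emeasure_uniform_measure) (simp_all add: divide_ennreal flip: ennreal_1)
qed

lemma nn_integral_unit_less:
  assumes "0 \<le> a" "a \<le> 1"
  shows "(\<integral>\<^sup>+x. (if x < a then c else d) \<partial>uniform_measure lborel {0..1::real}) = ennreal a * c + ennreal (1 - a) * d"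
proof -
  interpret prob_space "uniform_measure lborel {0..1::real}" by (rule prob_space_unit)
  let ?U = "uniform_measure lborel {0..1::real}"
  have [measurable]: "{x. x < a} \<in> sets ?U" by simp
  have "prob {x. x < a} = a"
    using emeasure_unit_less[OF assms] assms by (simp add: measure_def)
  then have *: "emeasure ?U (space ?U - {x. x < a}) = ennreal (1 - a)"
    by (subst emeasure_eq_measure, subst prob_compl) auto
  have "(\<integral>\<^sup>+x. (if x < a then c else d) \<partial>?U) = (\<integral>\<^sup>+x. c * indicator {x. x < a} x + d * indicator (space ?U - {x. x < a}) x \<partial>?U)"
    by (intro nn_integral_cong) (auto simp: indicator_def)
  also have "\<dots> = c * emeasure ?U {x. x < a} + d * emeasure ?U (space ?U - {x. x < a})"
    by (subst nn_integral_add) (auto simp: nn_integral_cmult)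
  finally show ?thesis by (simp only: * emeasure_unit_less[OF assms] mult.commute)
qed

text \<open>A fresh value in one coordinate keeps the product law. This allows that coordinate to be
  integrated out first.\<close>

lemma uniforms_resample:
  assumes [measurable]: "F \<in> borel_measurable uniforms"
  shows "(\<integral>\<^sup>+u. F u \<partial>uniforms) = (\<integral>\<^sup>+u. (\<integral>\<^sup>+x. F (u(i := x)) \<partial>uniform_measure lborel {0..1}) \<partial>uniforms)"
proof -
  let ?U = "uniform_measure lborel {0..1::real}"
  interpret U: prob_space ?U by (rule prob_space_unit)
  interpret P: prob_space "uniforms :: ('a \<Rightarrow> real) measure" by (rule prob_space_uniforms)
  interpret UP: pair_prob_space ?U "uniforms :: ('a \<Rightarrow> real) measure" ..
  have m: "(\<lambda>(x, u). u(i := x)) \<in> measurable (?U \<Otimes>\<^sub>M uniforms) uniforms"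
    unfolding split_beta' by (rule measurable_fun_upd[where J=UNIV]) auto
  have "(\<integral>\<^sup>+u. F u \<partial>uniforms) = (\<integral>\<^sup>+u. F u \<partial>distr (?U \<Otimes>\<^sub>M uniforms) uniforms (\<lambda>(x, u). u(i := x)))"
    using distr_pair_PiM_eq_PiM[of UNIV "\<lambda>_. ?U" i] prob_space_unit by simp
  also have "\<dots> = (\<integral>\<^sup>+xu. F ((snd xu)(i := fst xu)) \<partial>(?U \<Otimes>\<^sub>M uniforms))"
    using m by (subst nn_integral_distr) (auto simp: split_beta)
  also have "\<dots> = (\<integral>\<^sup>+u. (\<integral>\<^sup>+x. F (u(i := x)) \<partial>?U) \<partial>uniforms)"
    using m by (subst UP.nn_integral_snd[symmetric]) (auto simp: split_beta' intro!: measurable_compose[OF _ assms])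
  finally show ?thesis .
qed

text \<open>Any \<open>n\<close> of the coordinates are all below \<open>a\<close> with probability
  \<open>a ^ n\<close>, which tends to 0.\<close>

lemma AE_uniforms_ge:
  fixes I :: "'i::countable set"
  assumes "infinite I" "b < 1"
  shows "AE u in uniforms. \<exists>i\<in>I. b \<le> u i"
proof -
  interpret P: prob_space "uniforms :: ('i \<Rightarrow> real) measure" by (rule prob_space_uniforms)
  define a where "a = max b 0"
  have a: "0 \<le> a" "a < 1" "b \<le> a" using assms by (auto simp: a_def)
  define E where "E = {u::'i \<Rightarrow> real. \<forall>i\<in>I. u i < a}"
  have E[measurable]: "E \<in> P.events"
  proof -
    have "{u \<in> space uniforms. \<forall>i\<in>I. u i < a} \<in> P.events"
      by (intro sets.sets_Collect_countable_Ball countableI_type) measurable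
    then show ?thesis by (simp add: E_def)
  qed
  have "P.prob E \<le> a ^ n" for n
  proof -
    obtain J where J: "finite J" "card J = n" "J \<subseteq> I"
      using infinite_arbitrarily_large[OF assms(1)] by metis
    have "E \<subseteq> prod_emb UNIV (\<lambda>_. uniform_measure lborel {0..1::real}) J (Pi\<^sub>E J (\<lambda>_. {x. x < a}))"
      using J by (subst prod_emb_PiE) (auto simp: E_def PiE_UNIV_domain Pi_iff)
    then have "P.prob E \<le> P.prob (prod_emb UNIV (\<lambda>_. uniform_measure lborel {0..1::real}) J (Pi\<^sub>E J (\<lambda>_. {x. x < a})))"
      using J by (intro P.finite_measure_mono) (auto intro!: sets_PiM_I)
    also have "emeasure uniforms (prod_emb UNIV (\<lambda>_. uniform_measure lborel {0..1::real}) J (Pi\<^sub>E J (\<lambda>_. {x. x < a}))) = ennreal (a ^ n)"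
      using J a by (subst emeasure_PiM_emb) (auto simp: prob_space_unit emeasure_unit_less prod_constant ennreal_power simp del: emeasure_uniform_measure)
    then have "P.prob (prod_emb UNIV (\<lambda>_. uniform_measure lborel {0..1::real}) J (Pi\<^sub>E J (\<lambda>_. {x. x < a}))) = a ^ n"
      using a by (simp add: measure_def)
    finally show ?thesis .
  qed
  moreover have "(\<lambda>n. a ^ n) \<longlonglongrightarrow> 0"
    using a by (intro LIMSEQ_power_zero) auto
  ultimately have "P.prob E \<le> 0"
    by (intro LIMSEQ_le_const[of "\<lambda>n. a ^ n" 0]) auto
  then have "P.prob E = 0" using measure_nonneg[of uniforms E] by linarith
  then have "AE u in uniforms. u \<notin> E"
    using E by (simp add: P.prob_eq_0)
  then show ?thesis
    by eventually_elim (use a in \<open>force simp: E_def not_less\<close>)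
qed

section \<open>The law of the truncated dynamics\<close>

definition update_pmf :: "real \<Rightarrow> real \<Rightarrow> (nat \<times> int) set \<Rightarrow> nat \<times> int \<Rightarrow> (int \<Rightarrow> bool) \<Rightarrow> (int \<Rightarrow> bool) pmf" where
  "update_pmf p r A v \<eta> = (if v \<in> A then map_pmf (\<lambda>b. if b then swap_sites (snd v) \<eta> else \<eta>)
     (bernoulli_pmf (swap_prob p r (\<eta> (snd v)) (\<eta> (snd v + 1)))) else return_pmf \<eta>)"

primrec updates_pmf :: "real \<Rightarrow> real \<Rightarrow> (nat \<times> int) set \<Rightarrow> (nat \<times> int) list \<Rightarrow> (int \<Rightarrow> bool) \<Rightarrow> (int \<Rightarrow> bool) pmf" where
  "updates_pmf p r A [] \<eta> = return_pmf \<eta>"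
| "updates_pmf p r A (v # vs) \<eta> = bind_pmf (update_pmf p r A v \<eta>) (updates_pmf p r A vs)"

text \<open>Outside of \<open>A\<close> the value \<open>1\<close> is above all swap probabilities, so that nothing is swapped.\<close>

definition masked :: "(nat \<times> int) set \<Rightarrow> (nat \<times> int \<Rightarrow> real) \<Rightarrow> nat \<Rightarrow> int \<Rightarrow> real" where
  "masked A u s k = (if (s, k) \<in> A then u (s, k) else 1)"

lemma measurable_masked [measurable]: "(\<lambda>u. masked A u s k) \<in> borel_measurable uniforms"
  by (cases "(s, k) \<in> A") (simp_all add: masked_def)

text \<open>The head of the list uses a variable that the rest, by distinctness, never reads.
  Integrating it out first produces the Bernoulli choice of \<open>update_pmf\<close>.\<close>

lemma fold_masked_law:
  fixes g :: "(int \<Rightarrow> bool) \<Rightarrow> ennreal" and A :: "(nat \<times> int) set"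
  assumes pr: "0 \<le> p" "p \<le> 1" "0 \<le> r" "r \<le> 1" and "distinct vs"
  defines "f \<equiv> \<lambda>u vs \<eta>. fold (\<lambda>(s, k). site_update p r (masked A u s k) k) vs \<eta>"
  shows "(\<lambda>u. g (f u vs \<eta>)) \<in> borel_measurable uniforms \<and>
    (\<integral>\<^sup>+u. g (f u vs \<eta>) \<partial>uniforms) = (\<integral>\<^sup>+\<xi>. g \<xi> \<partial>measure_pmf (updates_pmf p r A vs \<eta>))"
  using assms(5)
proof (induction vs arbitrary: \<eta>)
  case Nil
  interpret P: prob_space "uniforms :: (nat \<times> int \<Rightarrow> real) measure" by (rule prob_space_uniforms)
  show ?case by (simp add: f_def P.emeasure_space_1[simplified] nn_integral_return)
next
  case (Cons v vs)
  interpret P: prob_space "uniforms :: (nat \<times> int \<Rightarrow> real) measure" by (rule prob_space_uniforms)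
  obtain s k where v: "v = (s, k)" by (cases v)
  let ?a = "swap_prob p r (\<eta> k) (\<eta> (k + 1))"
  have a: "0 \<le> ?a" "?a \<le> 1" using pr by (auto simp: swap_prob_def)
  note IH = Cons.IH[THEN conjunct1] Cons.IH[THEN conjunct2]
  have d: "distinct vs" "v \<notin> set vs" using Cons.prems by auto
  have f: "f u (v # vs) \<eta> = f u vs (site_update p r (masked A u s k) k \<eta>)" for u
    by (simp add: f_def v)
  show ?case
  proof (cases "v \<in> A")
    case False
    then have "site_update p r (masked A u s k) k \<eta> = \<eta>" for u
      using a by (simp add: masked_def v site_update_def)
    then show ?thesis
      using IH[OF d(1)] False by (simp add: f update_pmf_def bind_return_pmf)
  next
    case True
    have upd: "site_update p r (masked A u s k) k \<eta> = (if u v < ?a then swap_sites k \<eta> else \<eta>)" for u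
      using True by (simp add: masked_def v site_update_def)
    have [measurable]: "(\<lambda>u. g (f u vs \<xi>)) \<in> borel_measurable uniforms" for \<xi>
      by (rule IH[OF d(1)])
    have g: "g (f u (v # vs) \<eta>) = (if u v < ?a then g (f u vs (swap_sites k \<eta>)) else g (f u vs \<eta>))" for u
      unfolding f upd by simp
    have m: "(\<lambda>u. g (f u (v # vs) \<eta>)) \<in> borel_measurable uniforms"
      unfolding g by measurable
    have f': "f (u(v := x)) vs \<xi> = f u vs \<xi>" for u x \<xi>
      unfolding f_def using d(2)
    proof (induction vs arbitrary: \<xi>)
      case (Cons v' vs)
      then show ?case by (cases v') (auto simp: masked_def)
    qed simp
    have "(\<integral>\<^sup>+u. g (f u (v # vs) \<eta>) \<partial>uniforms) =
       (\<integral>\<^sup>+u. (\<integral>\<^sup>+x. (if x < ?a then g (f u vs (swap_sites k \<eta>)) else g (f u vs \<eta>)) \<partial>uniform_measure lborel {0..1}) \<partial>uniforms)"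
      by (subst uniforms_resample[OF m, of v]) (simp only: g fun_upd_same f')
    also have "\<dots> = (\<integral>\<^sup>+u. ennreal ?a * g (f u vs (swap_sites k \<eta>)) + ennreal (1 - ?a) * g (f u vs \<eta>) \<partial>uniforms)"
      by (simp only: nn_integral_unit_less[OF a])
    also have "\<dots> = ennreal ?a * (\<integral>\<^sup>+\<xi>. g \<xi> \<partial>measure_pmf (updates_pmf p r A vs (swap_sites k \<eta>))) +
        ennreal (1 - ?a) * (\<integral>\<^sup>+\<xi>. g \<xi> \<partial>measure_pmf (updates_pmf p r A vs \<eta>))"
      by (subst nn_integral_add) (auto simp: nn_integral_cmult IH[OF d(1)])
    also have "\<dots> = (\<integral>\<^sup>+b. (\<integral>\<^sup>+\<xi>. g \<xi> \<partial>measure_pmf (updates_pmf p r A vs (if b then swap_sites k \<eta> else \<eta>))) \<partial>measure_pmf (bernoulli_pmf ?a))"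
      using a by (simp add: mult.commute)
    also have "\<dots> = (\<integral>\<^sup>+\<xi>. g \<xi> \<partial>measure_pmf (updates_pmf p r A (v # vs) \<eta>))"
      using True by (simp add: update_pmf_def v bind_map_pmf nn_integral_bind_pmf nn_integral_map_pmf cong: if_cong)
    finally show ?thesis using m by simp
  qed
qed

section \<open>Intertwining of the two dynamics on configurations\<close>

definition interlace_config :: "real \<Rightarrow> nat \<Rightarrow> (int \<Rightarrow> bool) \<Rightarrow> (int \<Rightarrow> bool) pmf" where
  "interlace_config q n \<nu> = map_pmf (from_window n) (interlace_pmf q (n + 1) (window \<nu> (- int n) (2 * n + 2)))"

lemma update_pmf_from_window:
  assumes "length l = 2 * n + 2" "- int n \<le> k" "k \<le> int n" "(s, k) \<in> A"
  shows "update_pmf p r A (s, k) (from_window n l) = map_pmf (from_window n) (list_update_pmf p r (nat (k + int n)) l)"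
proof -
  have "from_window n l k = l ! nat (k + int n)" "from_window n l (k + 1) = l ! Suc (nat (k + int n))"
  proof -
    have "nat (k + 1 + int n) = Suc (nat (k + int n))" using assms by simp
    then show "from_window n l k = l ! nat (k + int n)" "from_window n l (k + 1) = l ! Suc (nat (k + int n))"
      using assms by (auto simp: from_window_def)
  qed
  then show ?thesis
    using assms by (simp add: update_pmf_def list_update_pmf_def pmf.map_comp o_def swap_from_window if_distrib cong: if_cong)
qed

text \<open>A bond outside \<open>A\<close> moves neither configuration; any other is a bond of the
  window list.\<close>

lemma config_intertwining:
  assumes q: "0 < q" "q < 1" and b: "0 \<le> b" "b \<le> 1" and \<nu>: "\<nu> \<in> windowed n" and k: "- int n \<le> k" "k \<le> int n"
  shows "bind_pmf (interlace_config q n \<nu>) (update_pmf b (q * b) A (s, k)) =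
    bind_pmf (update_pmf (q * b) b A (s, k) \<nu>) (interlace_config q n)"
proof (cases "(s, k) \<in> A")
  case False
  then have "update_pmf p r A (s, k) = return_pmf" for p r
    by (auto simp: update_pmf_def fun_eq_iff)
  then show ?thesis by (simp add: bind_return_pmf bind_return_pmf')
next
  case True
  obtain l where l: "\<nu> = from_window n l" "length l = 2 * n + 2" "zeros l = n + 1"
    using \<nu> by (auto simp: windowed_def)
  let ?i = "nat (k + int n)" and ?f = "from_window n"
  have i: "Suc ?i < length l" using k l(2) by auto
  have c: "interlace_config q n (?f l) = map_pmf ?f (interlace_pmf q (n + 1) l)" if "length l = 2 * n + 2" for l
    using window_from_window[OF that] by (simp add: interlace_config_def)
  have "bind_pmf (interlace_config q n \<nu>) (update_pmf b (q * b) A (s, k)) =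
    bind_pmf (interlace_pmf q (n + 1) l) (\<lambda>x. update_pmf b (q * b) A (s, k) (?f x))"
    by (simp only: l(1) c[OF l(2)] bind_map_pmf)
  also have "\<dots> = bind_pmf (interlace_pmf q (n + 1) l) (\<lambda>x. map_pmf ?f (list_update_pmf b (q * b) ?i x))"
    using length_interlace l(2) k True by (intro bind_pmf_cong refl update_pmf_from_window) auto
  also have "\<dots> = map_pmf ?f (bind_pmf (list_update_pmf (q * b) b ?i l) (interlace_pmf q (n + 1)))"
    using arg_cong[OF list_intertwining[OF q b _ i, of "n + 1"], of "map_pmf ?f"] l(3) by (simp add: map_bind_pmf)
  also have "\<dots> = bind_pmf (list_update_pmf (q * b) b ?i l) (\<lambda>l. interlace_config q n (?f l))"
    unfolding map_bind_pmf using l(2) by (intro bind_pmf_cong refl c[symmetric]) (auto simp: list_update_pmf_def)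
  also have "\<dots> = bind_pmf (update_pmf (q * b) b A (s, k) \<nu>) (interlace_config q n)"
    using update_pmf_from_window[OF l(2) k True] by (simp add: l(1) bind_map_pmf)
  finally show ?thesis .
qed

lemma updates_intertwining:
  assumes q: "0 < q" "q < 1" and b: "0 \<le> b" "b \<le> 1" and "\<nu> \<in> windowed n" "set vs \<subseteq> UNIV \<times> {- int n..int n}"
  shows "bind_pmf (interlace_config q n \<nu>) (updates_pmf b (q * b) A vs) =
    bind_pmf (updates_pmf (q * b) b A vs \<nu>) (interlace_config q n)"
  using assms(5,6)
proof (induction vs arbitrary: \<nu>)
  case Nil
  then show ?case by (simp add: bind_return_pmf bind_return_pmf' cong: bind_pmf_cong)
next
  case (Cons v vs)
  obtain s k where v: "v = (s, k)" "- int n \<le> k" "k \<le> int n" using Cons.prems by (cases v) auto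
  have w: "\<nu>' \<in> windowed n" if "\<nu>' \<in> set_pmf (update_pmf (q * b) b A v \<nu>)" for \<nu>'
    using that Cons.prems v by (auto simp: update_pmf_def site_update_windowed split: if_splits)
  have "bind_pmf (interlace_config q n \<nu>) (updates_pmf b (q * b) A (v # vs)) =
     bind_pmf (bind_pmf (interlace_config q n \<nu>) (update_pmf b (q * b) A v)) (updates_pmf b (q * b) A vs)"
    unfolding bind_assoc_pmf by (intro bind_pmf_cong refl) simp
  also have "\<dots> = bind_pmf (update_pmf (q * b) b A v \<nu>) (\<lambda>\<nu>. bind_pmf (interlace_config q n \<nu>) (updates_pmf b (q * b) A vs))"
    using Cons.prems v by (simp add: config_intertwining[OF q b] bind_assoc_pmf)
  also have "\<dots> = bind_pmf (update_pmf (q * b) b A v \<nu>) (\<lambda>\<nu>. bind_pmf (updates_pmf (q * b) b A vs \<nu>) (interlace_config q n))"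
    using w Cons.prems by (intro bind_pmf_cong refl Cons.IH) auto
  also have "\<dots> = bind_pmf (updates_pmf (q * b) b A (v # vs) \<nu>) (interlace_config q n)"
    by (simp add: bind_assoc_pmf)
  finally show ?case .
qed

lemma interlace_config_step:
  assumes "0 < q" "q < 1"
  shows "interlace_config q n step_config = return_pmf step_config"
proof -
  have "window step_config (- int n) (2 * n + 2) = replicate (n + 1) False @ replicate (n + 1) True"
    by (subst step_config_from_window[of n], rule window_from_window) simp
  then show ?thesis
    using interlace_step[OF assms, of "n + 1" "n + 1"] by (simp only: interlace_config_def map_return_pmf step_config_from_window[symmetric])
qed

text \<open>Each enlargement puts a zero in front of the window and a one behind it, and the kernel
  copies both.\<close>

lemma interlace_config_mono:
  assumes q: "0 < q" "q < 1" and "\<nu> \<in> windowed n" "n \<le> m"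
  shows "interlace_config q m \<nu> = interlace_config q n \<nu>"
  using assms(4)
proof (induction m rule: dec_induct)
  case (step m)
  then have "\<nu> \<in> windowed m" using assms(3) windowed_mono by blast
  then obtain l where l: "\<nu> = from_window m l" "length l = 2 * m + 2" "zeros l = m + 1"
    by (auto simp: windowed_def)
  let ?g = "\<lambda>x. False # x @ [True]"
  have f: "from_window (Suc m) (?g x) = from_window m x" if "length x = 2 * m + 2" for x
  proof
    fix k
    have "nat (k + int (Suc m)) = Suc (nat (k + int m))" if "- int m \<le> k" using that by auto
    moreover have "nat (k + int m) < 2 * m + 2 \<longleftrightarrow> k \<le> int m + 1" if "- int m \<le> k" using that by auto
    ultimately show "from_window (Suc m) (?g x) k = from_window m x k"
      using \<open>length x = 2 * m + 2\<close> by (auto simp: from_window_def nth_append nth_Cons split: nat.splits)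
  qed
  have w: "window \<nu> (- int (Suc m)) (2 * Suc m + 2) = ?g l"
    unfolding l(1) f[OF l(2), symmetric] by (rule window_from_window) (simp add: l)
  have w': "window \<nu> (- int m) (2 * m + 2) = l"
    unfolding l(1) by (rule window_from_window[OF l(2)])
  have "interlace_pmf q (Suc m + 1) (?g l) = map_pmf ?g (interlace_pmf q (m + 1) l)"
    using interlace_False[of q "l @ [True]"] interlace_snoc_True[OF q, of "m + 1" l] l(3)
    by (simp add: pmf.map_comp o_def del: interlace_pmf.simps)
  then have "interlace_config q (Suc m) \<nu> = map_pmf (\<lambda>x. from_window (Suc m) (?g x)) (interlace_pmf q (m + 1) l)"
    unfolding interlace_config_def w by (simp add: pmf.map_comp o_def)
  also have "\<dots> = map_pmf (from_window m) (interlace_pmf q (m + 1) l)"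
    using length_interlace l(2) by (intro map_pmf_cong refl f) auto
  also have "\<dots> = interlace_config q m \<nu>"
    by (simp only: interlace_config_def w')
  finally show ?case using step by simp
qed simp

section \<open>Passage to the infinite line\<close>

definition interlace_limit :: "real \<Rightarrow> (int \<Rightarrow> bool) \<Rightarrow> (int \<Rightarrow> bool) pmf" where
  "interlace_limit q \<nu> = interlace_config q (LEAST n. \<nu> \<in> windowed n) \<nu>"

text \<open>The window that contains \<open>\<nu>\<close> at time \<open>t\<close> is random; by
  consistency any choice of window gives the same law.\<close>

lemma interlace_limit_eq:
  assumes "0 < q" "q < 1" "\<nu> \<in> windowed n"
  shows "interlace_limit q \<nu> = interlace_config q n \<nu>"
  unfolding interlace_limit_def
proof (rule interlace_config_mono[symmetric, OF assms(1,2)])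
  show "\<nu> \<in> windowed (LEAST n. \<nu> \<in> windowed n)" using assms(3) by (rule LeastI)
  show "(LEAST n. \<nu> \<in> windowed n) \<le> n" using assms(3) by (rule Least_le)
qed

lemma interlace_limit_dominated:
  assumes q: "0 < q" "q < 1" and P: "insertion_law q P" and "\<nu> \<in> balanced_configs"
  shows "\<exists>g. dominated_coupling P (interlace_limit q \<nu>) g"
proof -
  obtain n where n: "\<nu> \<in> windowed n" using balanced_windowed[OF assms(4)] .
  then obtain l where l: "\<nu> = from_window n l" "length l = 2 * n + 2" "zeros l = n + 1"
    by (auto simp: windowed_def)
  have "interlace_limit q \<nu> = map_pmf (from_window n) (interlace_pmf q (n + 1) l)"
    using interlace_limit_eq[OF q n] window_from_window[OF l(2)] by (simp add: interlace_config_def l(1))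
  then show ?thesis
    using interlace_dominated[OF q P l(2,3)] by simp
qed

text \<open>Preimages are sets of balanced configurations, hence countable, or complements of such
  sets.\<close>

lemma measurable_countable_support:
  fixes g :: "(int \<Rightarrow> bool) \<Rightarrow> real"
  assumes "\<And>\<eta>. \<eta> \<notin> balanced_configs \<Longrightarrow> g \<eta> = 0"
  shows "g \<in> borel_measurable config_space"
proof (rule measurableI)
  fix B :: "real set" assume "B \<in> sets borel"
  show "g -` B \<inter> space config_space \<in> sets config_space"
  proof (cases "0 \<in> B")
    case True
    have "- (g -` B) \<subseteq> balanced_configs" using True assms by auto
    then have "- (g -` B) \<in> sets config_space"
      using countable_balanced by (intro countable_in_config_space countable_subset[of "- (g -` B)"])
    then have "space config_space - (- (g -` B)) \<in> sets config_space" by (rule sets.compl_sets)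
    moreover have "space config_space - (- (g -` B)) = g -` B \<inter> space config_space" by auto
    ultimately show ?thesis by (simp only:)
  next
    case False
    have "g -` B \<subseteq> balanced_configs" using False assms by (metis subsetI vimageD)
    then show ?thesis
      using countable_subset[OF _ countable_balanced] by (simp add: countable_in_config_space)
  qed
qed simp

lemma AE_right_cuts:
  assumes "p < 1" "r < 1"
  shows "AE u in uniforms. \<forall>s. right_cuts p r (masked A u s)"
proof -
  have "AE u in uniforms. \<exists>i\<in>(\<lambda>k. (s, k)) ` {x..}. max 0 (max p r) \<le> u i" for s :: nat and x :: int
    using assms by (intro AE_uniforms_ge) (auto simp: finite_image_iff inj_on_def infinite_Ici)
  note * = this
  have "AE u in uniforms. \<forall>(s::nat) (x::int). \<exists>i\<in>(\<lambda>k. (s, k)) ` {x..}. max 0 (max p r) \<le> u i"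
    unfolding AE_all_countable by (intro allI, rule *)
  then show ?thesis
  proof eventually_elim
    case (elim u)
    have "\<exists>k\<ge>x. 0 \<le> masked A u s k \<and> p \<le> masked A u s k \<and> r \<le> masked A u s k" for s x
    proof -
      obtain k where "x \<le> k" "max 0 (max p r) \<le> u (s, k)" using elim[rule_format, of s x] by auto
      then show ?thesis using assms by (intro exI[of _ k]) (auto simp: masked_def)
    qed
    then show ?case unfolding right_cuts_def by blast
  qed
qed

text \<open>The law in question is a mixture of the laws \<open>interlace_limit q \<nu>\<close>, all
  of which are dominated by \<open>P\<close>. For truncated dynamics this holds exactly, because the
  kernel fixes the step configuration; dominated convergence carries it to the limit.\<close>

theorem evolve_dominated:
  assumes q: "0 < q" "q < 1" and b: "0 < b" "b < 1" and P: "insertion_law q P"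
  shows "\<exists>R g. distr uniforms config_space (\<lambda>u. evolve b (q * b) (masked A u) t) = distr (measure_pmf R) config_space id
     \<and> dominated_coupling P R g"
proof -
  interpret U: prob_space "uniforms :: (nat \<times> int \<Rightarrow> real) measure" by (rule prob_space_uniforms)
  let ?c = "q * b"
  have c: "0 \<le> ?c" "?c \<le> 1" "?c < 1" "0 \<le> b" "b \<le> 1"
    using q b by (auto intro: mult_le_one) (metis mult_strict_mono' less_imp_le mult_1 mult.commute zero_less_one)
  \<comment> \<open>Needed for both orders of the swap probabilities: \<open>R\<close> becomes the
    law of the dynamics itself and \<open>V\<close> that of \<open>\<nu>\<close>.\<close>
  have law: "\<exists>R. set_pmf R \<subseteq> balanced_configs \<and> distr uniforms config_space (\<lambda>u. evolve p r (masked A u) t) = distr (measure_pmf R) config_space id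
     \<and> (\<forall>\<eta>. (\<lambda>n. pmf (updates_pmf p r A (sweep_sites n t) step_config) \<eta>) \<longlonglongrightarrow> pmf R \<eta>)
     \<and> (AE u in uniforms. eventually (\<lambda>n. sweeps p r (masked A u) n t = evolve p r (masked A u) t) sequentially)
     \<and> (AE u in uniforms. evolve p r (masked A u) t \<in> balanced_configs)"
    if pr: "0 \<le> p" "p < 1" "0 \<le> r" "r < 1" for p r
  proof -
    let ?E = "\<lambda>u. evolve p r (masked A u) t" and ?S = "\<lambda>n u. sweeps p r (masked A u) n t"
    have m: "?E \<in> measurable uniforms config_space" by (intro measurable_evolve measurable_masked)
    have mS: "?S n \<in> measurable uniforms config_space" for n by (intro measurable_sweeps measurable_masked)
    have ev: "AE u in uniforms. eventually (\<lambda>n. ?S n u = ?E u) sequentially"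
      using AE_right_cuts[OF pr(2,4), of A] by eventually_elim (rule evolve_eventually, blast)
    have bal: "AE u in uniforms. ?E u \<in> balanced_configs"
      using AE_right_cuts[OF pr(2,4), of A] by eventually_elim (rule evolve_balanced, blast)
    have "AE \<eta> in distr uniforms config_space ?E. \<eta> \<in> balanced_configs"
      using bal countable_in_config_space[OF countable_balanced] by (subst AE_distr_iff[OF m]) auto
    from pmf_of_countable_config[OF U.prob_space_distr[OF m] _ countable_balanced this]
    obtain R where R: "set_pmf R \<subseteq> balanced_configs" "distr uniforms config_space ?E = distr (measure_pmf R) config_space id"
      "\<And>\<eta>. pmf R \<eta> = measure (distr uniforms config_space ?E) {\<eta>}" by auto
    have "(\<lambda>n. pmf (updates_pmf p r A (sweep_sites n t) step_config) \<eta>) \<longlonglongrightarrow> pmf R \<eta>" for \<eta>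
    proof -
      have sing: "{u. X u = \<eta>} \<in> U.events" if "X \<in> measurable uniforms config_space" for X
      proof -
        have "X -` {\<eta>} \<inter> space uniforms \<in> U.events" using that by (rule measurable_sets) simp
        also have "X -` {\<eta>} \<inter> space uniforms = {u. X u = \<eta>}" by auto
        finally show ?thesis .
      qed
      have "(\<lambda>n. \<integral>u. (indicator {u. ?S n u = \<eta>} u :: real) \<partial>uniforms) \<longlonglongrightarrow> (\<integral>u. indicator {u. ?E u = \<eta>} u \<partial>uniforms)"
      proof (rule integral_dominated_convergence[where w="\<lambda>_. 1"])
        show "AE u in uniforms. (\<lambda>n. indicator {u. ?S n u = \<eta>} u) \<longlonglongrightarrow> (indicator {u. ?E u = \<eta>} u :: real)"
          using ev by eventually_elim (rule tendsto_eventually, erule eventually_mono, auto simp: indicator_def)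
      qed (use sing[OF m] sing[OF mS] in auto)
      then have "(\<lambda>n. U.prob {u. ?S n u = \<eta>}) \<longlonglongrightarrow> U.prob {u. ?E u = \<eta>}" by simp
      moreover have "U.prob {u. ?S n u = \<eta>} = pmf (updates_pmf p r A (sweep_sites n t) step_config) \<eta>" for n
      proof -
        have "ennreal (pmf (updates_pmf p r A (sweep_sites n t) step_config) \<eta>) =
           (\<integral>\<^sup>+\<xi>. indicator {\<eta>} \<xi> \<partial>measure_pmf (updates_pmf p r A (sweep_sites n t) step_config))"
          by (simp add: emeasure_pmf_single)
        also have "\<dots> = (\<integral>\<^sup>+u. indicator {\<eta>} (?S n u) \<partial>uniforms)"
          using fold_masked_law[of p r "sweep_sites n t" "indicator {\<eta>}" A step_config] pr distinct_sweep_sites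
          by (simp add: sweeps_fold)
        also have "\<dots> = (\<integral>\<^sup>+u. indicator {u. ?S n u = \<eta>} u \<partial>uniforms)"
          by (intro nn_integral_cong) (auto simp: indicator_def)
        also have "\<dots> = ennreal (U.prob {u. ?S n u = \<eta>})"
          using sing[OF mS] by (simp add: U.emeasure_eq_measure)
        finally show ?thesis by simp
      qed
      moreover have "U.prob {u. ?E u = \<eta>} = pmf R \<eta>"
        unfolding R(3) by (subst measure_distr[OF m]) (auto intro!: arg_cong[where f="U.prob"])
      ultimately show ?thesis by simp
    qed
    with R ev bal show ?thesis by blast
  qed
  from law[of b ?c] c b obtain R where R: "set_pmf R \<subseteq> balanced_configs"
    "distr uniforms config_space (\<lambda>u. evolve b ?c (masked A u) t) = distr (measure_pmf R) config_space id"
    "\<And>\<eta>. (\<lambda>n. pmf (updates_pmf b ?c A (sweep_sites n t) step_config) \<eta>) \<longlonglongrightarrow> pmf R \<eta>" by auto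
  from law[of ?c b] c b obtain V where V: "set_pmf V \<subseteq> balanced_configs"
    "distr uniforms config_space (\<lambda>u. evolve ?c b (masked A u) t) = distr (measure_pmf V) config_space id"
    "AE u in uniforms. eventually (\<lambda>n. sweeps ?c b (masked A u) n t = evolve ?c b (masked A u) t) sequentially"
    "AE u in uniforms. evolve ?c b (masked A u) t \<in> balanced_configs" by auto
  let ?E = "\<lambda>u. evolve ?c b (masked A u) t" and ?S = "\<lambda>n u. sweeps ?c b (masked A u) n t"
  have m: "?E \<in> measurable uniforms config_space" by (intro measurable_evolve measurable_masked)
  have mS: "?S n \<in> measurable uniforms config_space" for n by (intro measurable_sweeps measurable_masked)
  have "R = bind_pmf V (interlace_limit q)"
  proof (rule pmf_eqI)
    fix \<eta>
    \<comment> \<open>The value 0 off the balanced configurations makes \<open>g\<close> measurable;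
      no mass lies there.\<close>
    define g where "g = (\<lambda>\<nu>. if \<nu> \<in> balanced_configs then pmf (interlace_limit q \<nu>) \<eta> else 0)"
    have g[measurable]: "g \<in> borel_measurable config_space"
      by (rule measurable_countable_support) (simp add: g_def)
    have gb: "\<bar>g \<nu>\<bar> \<le> 1" for \<nu> by (simp add: g_def pmf_le_1)
    have gn: "0 \<le> g \<nu>" for \<nu> by (simp add: g_def)
    have "pmf (updates_pmf b ?c A (sweep_sites n t) step_config) \<eta> = (\<integral>u. g (?S n u) \<partial>uniforms)" for n
    proof -
      let ?W = "updates_pmf ?c b A (sweep_sites n t) step_config"
      have supp: "set_pmf (updates_pmf ?c b A vs \<nu>) \<subseteq> windowed n" if "\<nu> \<in> windowed n" "set vs \<subseteq> UNIV \<times> {- int n..int n}" for vs \<nu>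
        using that
      proof (induction vs arbitrary: \<nu>)
        case (Cons v vs)
        then have "set_pmf (update_pmf ?c b A v \<nu>) \<subseteq> windowed n"
          by (auto simp: update_pmf_def site_update_windowed split: if_splits)
        then show ?case using Cons by fastforce
      qed simp
      have "updates_pmf b ?c A (sweep_sites n t) step_config =
          bind_pmf (interlace_config q n step_config) (updates_pmf b ?c A (sweep_sites n t))"
        by (simp add: interlace_config_step[OF q] bind_return_pmf)
      also have "\<dots> = bind_pmf ?W (interlace_config q n)"
        using c by (intro updates_intertwining q step_config_windowed) (auto simp: set_sweep_sites)
      finally have "pmf (updates_pmf b ?c A (sweep_sites n t) step_config) \<eta> = (\<integral>\<nu>. pmf (interlace_config q n \<nu>) \<eta> \<partial>?W)"
        by (simp add: pmf_bind)
      also have "\<dots> = (\<integral>\<nu>. g \<nu> \<partial>?W)"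
      proof (intro integral_cong_AE; (simp add: AE_measure_pmf_iff)?)
        have "set_pmf ?W \<subseteq> windowed n"
          by (rule supp[OF step_config_windowed]) (auto simp: set_sweep_sites)
        then show "\<forall>\<nu>\<in>set_pmf ?W. pmf (interlace_config q n \<nu>) \<eta> = g \<nu>"
          using windowed_balanced interlace_limit_eq[OF q]
          by (auto simp: set_sweep_sites g_def)
      qed
      also have "\<dots> = enn2real (\<integral>\<^sup>+\<nu>. ennreal (g \<nu>) \<partial>?W)"
        using gn by (intro integral_eq_nn_integral) auto
      also have "(\<integral>\<^sup>+\<nu>. ennreal (g \<nu>) \<partial>?W) = (\<integral>\<^sup>+u. ennreal (g (?S n u)) \<partial>uniforms)"
        using fold_masked_law[of ?c b "sweep_sites n t" "\<lambda>\<nu>. ennreal (g \<nu>)" A step_config] c distinct_sweep_sites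
        by (simp add: sweeps_fold)
      also have "enn2real \<dots> = (\<integral>u. g (?S n u) \<partial>uniforms)"
        using gn measurable_compose[OF mS g] by (intro integral_eq_nn_integral[symmetric]) auto
      finally show ?thesis .
    qed
    moreover have "(\<lambda>n. \<integral>u. g (?S n u) \<partial>uniforms) \<longlonglongrightarrow> (\<integral>u. g (?E u) \<partial>uniforms)"
    proof (rule integral_dominated_convergence[where w="\<lambda>_. 1"])
      show "AE u in uniforms. (\<lambda>n. g (?S n u)) \<longlonglongrightarrow> g (?E u)"
        using V(3) by eventually_elim (rule tendsto_eventually, erule eventually_mono, simp)
    qed (use gb measurable_compose[OF mS g] measurable_compose[OF m g] in auto)
    ultimately have "(\<lambda>n. pmf (updates_pmf b ?c A (sweep_sites n t) step_config) \<eta>) \<longlonglongrightarrow> (\<integral>u. g (?E u) \<partial>uniforms)"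
      by (simp only:)
    then have "(\<integral>u. g (?E u) \<partial>uniforms) = pmf R \<eta>"
      using R(3) by (rule LIMSEQ_unique)
    also have "(\<integral>u. g (?E u) \<partial>uniforms) = (\<integral>\<nu>. g \<nu> \<partial>distr uniforms config_space ?E)"
      by (rule integral_distr[symmetric, OF m g])
    also have "\<dots> = (\<integral>\<nu>. g \<nu> \<partial>measure_pmf V)"
      unfolding V(2) by (subst integral_distr) (auto intro: g)
    also have "\<dots> = (\<integral>\<nu>. pmf (interlace_limit q \<nu>) \<eta> \<partial>measure_pmf V)"
      using V(1) by (intro integral_cong_AE) (auto simp: AE_measure_pmf_iff g_def)
    finally show "pmf R \<eta> = pmf (bind_pmf V (interlace_limit q)) \<eta>"
      by (simp add: pmf_bind)
  qed
  moreover have "\<exists>g. dominated_coupling P (bind_pmf V (interlace_limit q)) g"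
    using V(1) by (intro dominated_coupling_bind interlace_limit_dominated[OF q P]) auto
  ultimately show ?thesis using R(2) by auto
qed

section \<open>Rows of the six-vertex process\<close>

definition coloured :: "label \<Rightarrow> bool" where
  "coloured l \<longleftrightarrow> l = Fin 2 \<or> l = Fin 3"

definition merge :: "label \<Rightarrow> label" where
  "merge l = (if l = Fin 3 then Fin 2 else l)"

lemma merge_eq_2_iff: "merge l = Fin 2 \<longleftrightarrow> coloured l"
  by (auto simp: merge_def coloured_def)

lemma merge_eq_1_iff: "merge l = Fin 1 \<longleftrightarrow> l = Fin 1"
  by (auto simp: merge_def)

text \<open>No class lies strictly between 2 and 3, so that identifying them keeps the order of any
  two classes that stay distinct.\<close>

lemma merge_less: "merge i \<noteq> merge j \<Longrightarrow> merge i < merge j \<longleftrightarrow> i < j"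
  by (cases i; cases j) (auto simp: merge_def split: if_splits)

text \<open>If the merged labels differ, both vertices take the same branch. If they agree, going
  straight and turning look alike after merging.\<close>

lemma vertex_out_merge:
  "map_prod merge merge (vertex_out b1 b2 u i j) = vertex_out b1 b2 u (merge i) (merge j)"
proof (cases "merge i = merge j")
  case True then show ?thesis by (simp add: vertex_out_def)
next
  case False
  then show ?thesis
    using merge_less[of i j] merge_less[of j i] by (auto simp: vertex_out_def)
qed

lemma vertex_out_cases: "vertex_out b1 b2 u i j = (i, j) \<or> vertex_out b1 b2 u i j = (j, i)"
  by (simp add: vertex_out_def)

lemma vertex_out_cut: "b1 \<le> b2 \<Longrightarrow> b2 \<le> u \<Longrightarrow> snd (vertex_out b1 b2 u i j) = i"
  by (auto simp: vertex_out_def)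

section \<open>Cut-vertices and conservation in one row\<close>

locale vertex_row =
  fixes b1 b2 :: real and w :: "int \<Rightarrow> real" and v h up :: "int \<Rightarrow> label"
  assumes le: "b1 \<le> b2"
    and rule: "\<And>x. (up x, h x) = vertex_out b1 b2 (w x) (v x) (h (x - 1))"
    and left_cut: "\<And>x. \<exists>y\<le>x. b2 \<le> w y"
    and right_cut: "\<And>x. \<exists>y\<ge>x. b2 \<le> w y"
begin

lemma out_cases: "up x = v x \<and> h x = h (x - 1) \<or> up x = h (x - 1) \<and> h x = v x"
  using vertex_out_cases[of b1 b2 "w x" "v x" "h (x - 1)"] unfolding rule[of x, symmetric] by blast

lemma h_cut: "b2 \<le> w x \<Longrightarrow> h x = v x"
  using vertex_out_cut[OF le, of "w x" "v x" "h (x - 1)"] unfolding rule[of x, symmetric] by simp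

lemma conservation: "of_bool (up x = a) + of_bool (h x = a) = (of_bool (v x = a) + of_bool (h (x - 1) = a) :: nat)"
  using out_cases[of x]
proof
  assume *: "up x = v x \<and> h x = h (x - 1)"
  show ?thesis unfolding *[THEN conjunct1] *[THEN conjunct2] ..
next
  assume *: "up x = h (x - 1) \<and> h x = v x"
  show ?thesis unfolding *[THEN conjunct1] *[THEN conjunct2] by (rule add.commute)
qed

text \<open>A cut-vertex lets nothing through from its left, so that every label on a horizontal
  edge further right entered from below at the cut or after it.\<close>

lemma h_absent:
  assumes "y \<le> x" "b2 \<le> w y" "\<And>i. y \<le> i \<Longrightarrow> i \<le> x \<Longrightarrow> v i \<noteq> a"
  shows "h x \<noteq> a"
  using assms(1,3)
proof (induction x rule: int_ge_induct)
  case base then show ?case using h_cut[OF assms(2)] by simp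
next
  case (step i)
  then have "h i \<noteq> a" "v (i + 1) \<noteq> a" by auto
  then show ?case using out_cases[of "i + 1"] by auto
qed

lemma absent_left:
  assumes "finite {y. y \<le> x \<and> v y = a}"
  obtains c where "c \<le> x" "\<And>y. y \<le> c \<Longrightarrow> v y \<noteq> a" "\<And>y. y \<le> c \<Longrightarrow> h y \<noteq> a" "\<And>y. y \<le> c \<Longrightarrow> up y \<noteq> a"
proof -
  obtain m where m: "\<And>y. y \<le> x \<Longrightarrow> v y = a \<Longrightarrow> m \<le> y"
    using bdd_below_finite[OF assms] by (auto simp: bdd_below_def)
  define c where "c = min x (m - 1)"
  have v: "v y \<noteq> a" if "y \<le> c" for y using m[of y] that by (auto simp: c_def)
  have h: "h y \<noteq> a" if y: "y \<le> c" for y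
  proof -
    obtain y0 where "y0 \<le> y" "b2 \<le> w y0" using left_cut by blast
    then show ?thesis using v y by (intro h_absent) auto
  qed
  have "up y \<noteq> a" if "y \<le> c" for y
    using out_cases[of y] v[OF that] h[of "y - 1"] that by auto
  with v h show thesis using that[of c] by (simp add: c_def)
qed

text \<open>Here the cuts on the right matter: without them a label could travel along the row
  forever.\<close>

lemma absent_right:
  assumes "finite {y. x < y \<and> v y = a}"
  obtains c where "x \<le> c" "\<And>y. c \<le> y \<Longrightarrow> v y \<noteq> a" "\<And>y. c \<le> y \<Longrightarrow> h y \<noteq> a" "\<And>y. c < y \<Longrightarrow> up y \<noteq> a"
proof -
  obtain m where m: "\<And>y. x < y \<Longrightarrow> v y = a \<Longrightarrow> y \<le> m"
    using bdd_above_finite[OF assms] by (auto simp: bdd_above_def)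
  obtain c where c: "max (x + 1) (m + 1) \<le> c" "b2 \<le> w c" using right_cut by blast
  have v: "v y \<noteq> a" if "c \<le> y" for y using m[of y] that c(1) by auto
  have h: "h y \<noteq> a" if y: "c \<le> y" for y
    using v y c(2) by (intro h_absent[of c]) auto
  have "up y \<noteq> a" if "c < y" for y
    using out_cases[of y] v[of y] h[of "y - 1"] that by auto
  with v h show thesis using that[of c] c(1) by simp
qed

text \<open>Conservation is summed over the vertices up to \<open>x\<close>, beginning where the
  class is absent; the only way out is the edge that leaves \<open>x\<close>.\<close>

lemma count_left:
  assumes "finite {y. y \<le> x \<and> v y = a}"
  shows "finite {y. y \<le> x \<and> up y = a}"
    "card {y. y \<le> x \<and> up y = a} + of_bool (h x = a) = card {y. y \<le> x \<and> v y = a}"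
proof -
  obtain c where c: "c \<le> x" "\<And>y. y \<le> c \<Longrightarrow> v y \<noteq> a" "\<And>y. y \<le> c \<Longrightarrow> h y \<noteq> a" "\<And>y. y \<le> c \<Longrightarrow> up y \<noteq> a"
    by (rule absent_left[OF assms]) (rule that)
  have ins: "{y. y \<le> i + 1 \<and> f y = a} = (if f (i + 1) = a then {i + 1} else {}) \<union> {y. y \<le> i \<and> f y = a}" for i and f :: "int \<Rightarrow> label"
    by (auto simp: order.order_iff_strict)
  have "finite {y. y \<le> x \<and> v y = a} \<and> finite {y. y \<le> x \<and> up y = a} \<and>
    card {y. y \<le> x \<and> up y = a} + of_bool (h x = a) = card {y. y \<le> x \<and> v y = a}"
    using c(1)
  proof (induction x rule: int_ge_induct)
    case base
    have "{y. y \<le> c \<and> v y = a} = {}" "{y. y \<le> c \<and> up y = a} = {}" using c by auto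
    then show ?case using c(3)[of c] by (simp only:) simp
  next
    case (step i)
    have "card {y. y \<le> i + 1 \<and> up y = a} = of_bool (up (i + 1) = a) + card {y. y \<le> i \<and> up y = a}"
      "card {y. y \<le> i + 1 \<and> v y = a} = of_bool (v (i + 1) = a) + card {y. y \<le> i \<and> v y = a}"
      unfolding ins using step by auto
    moreover have "finite {y. y \<le> i + 1 \<and> v y = a}" "finite {y. y \<le> i + 1 \<and> up y = a}"
      unfolding ins using step by auto
    ultimately show ?case using step conservation[of "i + 1" a] by simp
  qed
  then show "finite {y. y \<le> x \<and> up y = a}"
    "card {y. y \<le> x \<and> up y = a} + of_bool (h x = a) = card {y. y \<le> x \<and> v y = a}" by auto
qed

lemma count_right:
  assumes "finite {y. x < y \<and> v y = a}"
  shows "finite {y. x < y \<and> up y = a}"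
    "card {y. x < y \<and> up y = a} = card {y. x < y \<and> v y = a} + of_bool (h x = a)"
proof -
  obtain c where c: "x \<le> c" "\<And>y. c \<le> y \<Longrightarrow> v y \<noteq> a" "\<And>y. c \<le> y \<Longrightarrow> h y \<noteq> a" "\<And>y. c < y \<Longrightarrow> up y \<noteq> a"
    by (rule absent_right[OF assms]) (rule that)
  have ins: "{y. i - 1 < y \<and> f y = a} = (if f i = a then {i} else {}) \<union> {y. i < y \<and> f y = a}" for i and f :: "int \<Rightarrow> label"
    by (auto simp: order.order_iff_strict zle_diff1_eq) (metis order.order_iff_strict zle_diff1_eq not_le)
  have "finite {y. x < y \<and> v y = a} \<and> finite {y. x < y \<and> up y = a} \<and>
    card {y. x < y \<and> up y = a} = card {y. x < y \<and> v y = a} + of_bool (h x = a)"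
    using c(1)
  proof (induction x rule: int_le_induct)
    case base
    have "{y. c < y \<and> v y = a} = {}" "{y. c < y \<and> up y = a} = {}" using c by auto
    then show ?case using c(3)[of c] by (simp only:) simp
  next
    case (step i)
    have "card {y. i - 1 < y \<and> up y = a} = of_bool (up i = a) + card {y. i < y \<and> up y = a}"
      "card {y. i - 1 < y \<and> v y = a} = of_bool (v i = a) + card {y. i < y \<and> v y = a}"
      unfolding ins using step by auto
    moreover have "finite {y. i - 1 < y \<and> v y = a}" "finite {y. i - 1 < y \<and> up y = a}"
      unfolding ins using step by auto
    ultimately show ?case using step conservation[of i a] by simp
  qed
  then show "finite {y. x < y \<and> up y = a}"
    "card {y. x < y \<and> up y = a} = card {y. x < y \<and> v y = a} + of_bool (h x = a)" by auto
qed

end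

section \<open>Trajectories of the particles in one row\<close>

text \<open>
  One row in terms of the particles: \<open>X k\<close> and \<open>Y k\<close> are the places where the \<open>k\<close>-th second- or
  third-class particle enters the row and leaves it, and \<open>Y k = X (k + 1)\<close> means that particles
  \<open>k\<close> and \<open>k + 1\<close> meet.
\<close>

locale particle_row = vertex_row +
  fixes H :: "int \<Rightarrow> int" and X Y :: "int \<Rightarrow> int"
  assumes H_step: "\<And>x. H x = H (x - 1) + of_bool (coloured (v x))"
    and H'_step: "\<And>x. H x - of_bool (coloured (h x)) = H (x - 1) - of_bool (coloured (h (x - 1))) + of_bool (coloured (up x))"
    and X: "\<And>k x. X k = x \<longleftrightarrow> coloured (v x) \<and> H x = k"
    and Y: "\<And>k x. Y k = x \<longleftrightarrow> coloured (up x) \<and> H x - of_bool (coloured (h x)) = k"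
begin

lemma H_mono: "x \<le> y \<Longrightarrow> H x \<le> H y"
proof (induction y rule: int_ge_induct)
  case (step i) then show ?case using H_step[of "i + 1"] by auto
qed simp

text \<open>The height of the next row: \<open>H\<close> less the particle, if any, that is on its
  way to the right of \<open>x\<close>.\<close>

definition H' where "H' x = H x - of_bool (coloured (h x))"

lemma H'_mono: "x \<le> y \<Longrightarrow> H' x \<le> H' y"
proof (induction y rule: int_ge_induct)
  case (step i) then show ?case using H'_step[of "i + 1"] by (auto simp: H'_def)
qed simp

lemma X_props: "coloured (v (X k))" "H (X k) = k" "H (X k - 1) = k - 1"
  using X[of k "X k"] H_step[of "X k"] by auto

lemma Y_props: "coloured (up (Y k))" "H' (Y k) = k" "H' (Y k - 1) = k - 1"
  using Y[of k "Y k"] H'_step[of "Y k"] by (auto simp: H'_def)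

lemma H_between: "X k \<le> x \<Longrightarrow> x < X (k + 1) \<Longrightarrow> H x = k"
  using H_mono[of "X k" x] H_mono[of x "X (k + 1) - 1"] X_props[of k] X_props[of "k + 1"] by simp

lemma X_less: "X k < X (k + 1)"
  using H_mono[of "X (k + 1)" "X k"] X_props[of k] X_props[of "k + 1"] by (cases "X (k + 1) \<le> X k") auto

lemma v_between: "X k < x \<Longrightarrow> x < X (k + 1) \<Longrightarrow> \<not> coloured (v x)"
  using H_between[of k x] X[of k x] by auto

text \<open>The heights of consecutive rows differ by at most the one particle in transit; therefore
  the particles of the two rows interlace.\<close>

lemma Y_bounds: "X k \<le> Y k" "Y k \<le> X (k + 1)"
proof -
  have "H' x \<le> H x" for x by (simp add: H'_def)
  then show "X k \<le> Y k"
    using H_mono[of "Y k" "X k - 1"] X_props[of k] Y_props[of k] by (cases "X k \<le> Y k") (auto, smt (verit))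
  have "H' (X (k + 1)) \<ge> k" using X_props[of "k + 1"] by (auto simp: H'_def)
  then show "Y k \<le> X (k + 1)"
    using H'_mono[of "X (k + 1)" "Y k - 1"] Y_props[of k] by (cases "Y k \<le> X (k + 1)") auto
qed

lemma h_before: "X k \<le> x \<Longrightarrow> x < Y k \<Longrightarrow> coloured (h x)"
  using H_between[of k x] Y_bounds[of k] H'_mono[of x "Y k - 1"] Y_props[of k]
  by (auto simp: H'_def split: if_splits)

lemma h_after: "Y k \<le> x \<Longrightarrow> x < X (k + 1) \<Longrightarrow> \<not> coloured (h x)"
  using H_between[of k x] Y_bounds[of k] H'_mono[of "Y k" x] Y_props[of k]
  by (auto simp: H'_def split: if_splits)

lemma meet_iff: "Y k = X (k + 1) \<longleftrightarrow> coloured (h (X (k + 1) - 1))"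
  using h_before[of k "X (k + 1) - 1"] h_after[of k "X (k + 1) - 1"] Y_bounds[of k] X_less[of k]
  by (cases "Y k = X (k + 1)") auto

text \<open>The class with which particle \<open>k\<close> goes on. Particles are indexed by their
  order: if \<open>k - 1\<close> arrives at \<open>X k\<close>, then whatever leaves upwards is
  \<open>k - 1\<close> and whatever leaves to the right is \<open>k\<close>.\<close>

definition carried :: "int \<Rightarrow> label" where
  "carried k = (if coloured (h (X k - 1)) then h (X k) else v (X k))"

lemma coloured_out: "coloured (v x) \<Longrightarrow> coloured (h (x - 1)) \<Longrightarrow> coloured (up x) \<and> coloured (h x)"
  using out_cases[of x] by auto

lemma h_carried: "X k \<le> x \<Longrightarrow> x < Y k \<Longrightarrow> h x = carried k"
proof (induction x rule: int_ge_induct)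
  case base
  have "coloured (h (X k))" using h_before[of k "X k"] base by simp
  then show ?case using out_cases[of "X k"] by (auto simp: carried_def)
next
  case (step i)
  then have "h i = carried k" "\<not> coloured (v (i + 1))" "coloured (h (i + 1))"
    using v_between[of k "i + 1"] h_before[of k "i + 1"] Y_bounds[of k] by auto
  then show ?case using out_cases[of "i + 1"] by auto
qed

lemma up_carried:
  assumes "Y k \<noteq> X (k + 1)"
  shows "up (Y k) = carried k"
proof -
  have nc: "\<not> coloured (h (Y k))" using h_after[of k "Y k"] assms Y_bounds[of k] by simp
  show ?thesis
  proof (cases "Y k = X k")
    case True
    have "\<not> coloured (h (X k - 1))"
      using coloured_out[of "X k"] X_props(1)[of k] nc True by auto
    then show ?thesis
      using nc True out_cases[of "X k"] X_props(1)[of k] by (auto simp: carried_def)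
  next
    case False
    then have "h (Y k - 1) = carried k" using Y_bounds[of k] by (intro h_carried) auto
    moreover have "\<not> coloured (v (Y k))"
      using v_between[of k "Y k"] False assms Y_bounds[of k] by auto
    ultimately show ?thesis
      using out_cases[of "Y k"] Y_props(1)[of k] by auto
  qed
qed

lemma carried_no_meet: "Y k \<noteq> X (k + 1) \<Longrightarrow> carried (k + 1) = v (X (k + 1))"
  using meet_iff[of k] by (simp add: carried_def)

lemma carried_meet:
  assumes "Y k = X (k + 1)"
  shows "(up (Y k), carried (k + 1)) = vertex_out b1 b2 (w (X (k + 1))) (v (X (k + 1))) (carried k)"
proof -
  have "h (X (k + 1) - 1) = carried k"
    using assms X_less[of k] by (intro h_carried) auto
  moreover have "carried (k + 1) = h (X (k + 1))"
    using assms meet_iff[of k] by (simp add: carried_def)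
  ultimately show ?thesis using rule[of "X (k + 1)"] assms by simp
qed

lemma coloured_carried: "coloured (carried k)"
  using coloured_out[of "X k"] X_props(1)[of k] by (simp add: carried_def)

lemma X_bound: "k \<le> 0 \<Longrightarrow> X k \<le> X 0 + k" "0 \<le> k \<Longrightarrow> X 0 + k \<le> X k"
proof -
  show "k \<le> 0 \<Longrightarrow> X k \<le> X 0 + k"
  proof (induction k rule: int_le_induct)
    case (step i) then show ?case using X_less[of "i - 1"] by simp
  qed simp
  show "0 \<le> k \<Longrightarrow> X 0 + k \<le> X k"
  proof (induction k rule: int_ge_induct)
    case (step i) then show ?case using X_less[of i] by simp
  qed simp
qed

text \<open>Read from left to right, the class in transit either goes up before the next particle or
  meets it, and the meetings are the active bonds of a sweep. Few second-class particles on the left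
  and few third-class ones on the right make the truncation harmless.\<close>

lemma sweep_eq:
  assumes fin: "finite {y. y \<le> 0 \<and> v y = Fin 2}" "finite {y. 0 < y \<and> v y = Fin 3}"
    and b: "b1 \<le> 1" "b2 \<le> 1"
  defines "\<xi> \<equiv> \<lambda>k. v (X k) = Fin 2" and "\<xi>' \<equiv> \<lambda>k. up (Y k) = Fin 2"
    and "w' \<equiv> \<lambda>k. if Y k = X (k + 1) then w (X (k + 1)) else 1"
  shows "eventually (\<lambda>n. sweep b2 b1 w' n \<xi> = \<xi>') sequentially"
proof -
  define R where "R k \<longleftrightarrow> carried k = Fin 2" for k
  \<comment> \<open>The state between two updates: new classes left of \<open>k\<close>, the class
    in transit at \<open>k\<close>, old classes to the right.\<close>
  define c where "c k x = (if x < k then \<xi>' x else if x = k then R k else \<xi> x)" for k x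
  have step: "site_update b2 b1 (w' k) k (c k) = c (k + 1)" for k
  proof -
    have ck: "c k k = R k" "c k (k + 1) = \<xi> (k + 1)" by (simp_all add: c_def)
    have col: "v (X (k + 1)) = Fin 2 \<or> v (X (k + 1)) = Fin 3" "carried k = Fin 2 \<or> carried k = Fin 3"
      using X_props(1)[of "k + 1"] coloured_carried[of k] by (auto simp: coloured_def)
    show ?thesis
    proof (cases "Y k = X (k + 1)")
      case False
      then have "R (k + 1) = \<xi> (k + 1)" "\<xi>' k = R k" "w' k = 1"
        using carried_no_meet[of k] up_carried[of k] by (simp_all add: R_def \<xi>_def \<xi>'_def w'_def)
      then show ?thesis
        using b by (auto simp: site_update_def swap_prob_def c_def fun_eq_iff)
    next
      case True
      let ?u = "w (X (k + 1))"
      \<comment> \<open>Going straight sends the class from below up as particle \<open>k\<close>;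
        hence it is going straight, not turning, that swaps the two classes.\<close>
      have "(\<xi>' k, R (k + 1)) = (if ?u < swap_prob b2 b1 (R k) (\<xi> (k + 1)) then (\<xi> (k + 1), R k) else (R k, \<xi> (k + 1)))"
        using carried_meet[OF True] col
        by (auto simp: \<xi>_def \<xi>'_def R_def swap_prob_def vertex_out_def split: if_splits)
      moreover have "w' k = ?u" using True by (simp add: w'_def)
      ultimately show ?thesis
        unfolding site_update_def ck swap_sites_def fun_eq_iff by (auto simp: c_def split: if_splits)
    qed
  qed
  obtain l where l: "l \<le> 0" "\<And>y. y \<le> l \<Longrightarrow> v y \<noteq> Fin 2" "\<And>y. y \<le> l \<Longrightarrow> h y \<noteq> Fin 2" "\<And>y. y \<le> l \<Longrightarrow> up y \<noteq> Fin 2"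
    by (rule absent_left[OF fin(1)]) (rule that)
  obtain r where r: "0 \<le> r" "\<And>y. r \<le> y \<Longrightarrow> v y \<noteq> Fin 3" "\<And>y. r \<le> y \<Longrightarrow> h y \<noteq> Fin 3" "\<And>y. r < y \<Longrightarrow> up y \<noteq> Fin 3"
    by (rule absent_right[OF fin(2)]) (rule that)
  \<comment> \<open>Positions are at least as spread out as indices, so that the particles of index
    beyond \<open>N\<close> lie where the rare class is absent.\<close>
  define N where "N = nat \<bar>X 0\<bar> + nat \<bar>l\<bar> + nat \<bar>r\<bar> + 1"
  have left: "\<not> \<xi> k \<and> \<not> \<xi>' k \<and> \<not> R k" if "k \<le> - int N" for k
  proof -
    have "k + 1 \<le> 0" using that by (simp add: N_def)
    then have "X (k + 1) \<le> X 0 + (k + 1)" by (rule X_bound)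
    moreover have "X k < X (k + 1)" "Y k \<le> X (k + 1)" using X_less Y_bounds by auto
    moreover have "X 0 + (k + 1) \<le> l" using that by (simp add: N_def)
    ultimately show ?thesis
      using l by (auto simp: \<xi>_def \<xi>'_def R_def carried_def)
  qed
  have right: "\<xi> k \<and> \<xi>' k \<and> R k" if "int N \<le> k" for k
  proof -
    have "0 \<le> k" using that by simp
    then have "X 0 + k \<le> X k" by (rule X_bound)
    moreover have "X k \<le> Y k" using Y_bounds by auto
    moreover have "r < X 0 + k" using that by (simp add: N_def)
    ultimately have "v (X k) \<noteq> Fin 3" "up (Y k) \<noteq> Fin 3" "carried k \<noteq> Fin 3"
      using r by (auto simp: carried_def)
    then show ?thesis
      using X_props(1)[of k] Y_props(1)[of k] coloured_carried[of k] by (auto simp: \<xi>_def \<xi>'_def R_def coloured_def)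
  qed
  have "sweep b2 b1 w' n \<xi> = \<xi>'" if n: "N \<le> n" for n
  proof -
    have f: "fold (\<lambda>k. site_update b2 b1 (w' k) k) [- int n..k] (c (- int n)) = c (k + 1)" if "- int n - 1 \<le> k" for k
      using that
    proof (induction k rule: int_ge_induct)
      case (step i)
      then have "[- int n..i + 1] = [- int n..i] @ [i + 1]" by (simp add: upto_rec2)
      then show ?case using step by (simp add: \<open>\<And>k. site_update b2 b1 (w' k) k (c k) = c (k + 1)\<close>)
    qed simp
    have "c (- int n) = \<xi>"
      using left n by (auto simp: c_def fun_eq_iff)
    moreover have "c (int n + 1) = \<xi>'"
      using right n by (auto simp: c_def fun_eq_iff)
    ultimately show ?thesis using f[of "int n"] by (simp add: sweep_def)
  qed
  then show ?thesis unfolding eventually_sequentially by blast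
qed

end

section \<open>The merged process and its height\<close>

definition cuts :: "real \<Rightarrow> (int \<times> nat \<Rightarrow> real) \<Rightarrow> bool" where
  "cuts b u \<longleftrightarrow> (\<forall>x t. (\<exists>y\<le>x. b \<le> u (y, t)) \<and> (\<exists>y\<ge>x. b \<le> u (y, t)))"

locale s6v_initial =
  fixes b1 b2 :: real and \<eta>\<^sub>0 :: "int \<Rightarrow> label"
  assumes b: "0 < b1" "b1 < b2" "b2 < 1"
    and second: "\<And>x. \<eta>\<^sub>0 x = Fin 2 \<Longrightarrow> x > 0"
    and third: "\<And>x. \<eta>\<^sub>0 x = Fin 3 \<Longrightarrow> x \<le> 0"
begin

abbreviation L :: "(int \<times> nat \<Rightarrow> real) \<Rightarrow> edge \<Rightarrow> label" where
  "L u \<equiv> s6v_label b1 b2 u \<eta>\<^sub>0"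

lemma row:
  assumes "cuts b2 u"
  shows "vertex_row b1 b2 (\<lambda>x. u (x, s)) (\<lambda>x. L u (Vert x s)) (\<lambda>x. L u (Horiz x s)) (\<lambda>x. L u (Vert x (Suc s)))"
proof
  show "b1 \<le> b2" using b by simp
  have "\<And>x t. \<exists>y\<le>x. b2 \<le> u (y, t)" using assms unfolding cuts_def by blast
  from s6v_label_vertex_rule[OF \<open>b1 \<le> b2\<close> this]
  show "(L u (Vert x (Suc s)), L u (Horiz x s)) = vertex_out b1 b2 (u (x, s)) (L u (Vert x s)) (L u (Horiz (x - 1) s))" for x .
qed (use assms in \<open>auto simp: cuts_def\<close>)

text \<open>
  The vertices at which the classes \<open>2\<close> and \<open>3\<close>, when merged, do not depend on the choice made.
\<close>

definition meeting :: "(int \<times> nat \<Rightarrow> real) \<Rightarrow> int \<times> nat \<Rightarrow> bool" where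
  "meeting u v \<longleftrightarrow> coloured (L u (Vert (fst v) (snd v))) \<and> coloured (L u (Horiz (fst v - 1) (snd v)))"

definition common_cuts :: "(int \<times> nat \<Rightarrow> real) \<Rightarrow> (int \<times> nat \<Rightarrow> real) \<Rightarrow> bool" where
  "common_cuts u u' \<longleftrightarrow> (\<forall>x t. (\<exists>y\<le>x. b2 \<le> u (y, t) \<and> b2 \<le> u' (y, t)) \<and> (\<exists>y\<ge>x. b2 \<le> u (y, t) \<and> b2 \<le> u' (y, t)))"

lemma common_cuts_imp: "common_cuts u u' \<Longrightarrow> cuts b2 u" "common_cuts u u' \<Longrightarrow> cuts b2 u'"
  unfolding common_cuts_def cuts_def by meson+

text \<open>Row by row, starting in each row from a vertex that is a cut for both fields, where the
  label from below goes right in both. At an altered vertex both merged inputs are 2, so that both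
  outputs are 2 whatever the variable.\<close>

lemma merged_eq:
  assumes cc: "common_cuts u u'" and eq: "\<And>v. u' v \<noteq> u v \<Longrightarrow> meeting u v"
  shows "merge (L u' e) = merge (L u e)"
proof -
  let ?V = "\<lambda>x s. merge (L u' (Vert x s)) = merge (L u (Vert x s))"
  let ?H = "\<lambda>x s. merge (L u' (Horiz x s)) = merge (L u (Horiz x s))"
  have out: "?V x (Suc s) \<and> ?H x s" if "?V x s" "?H (x - 1) s" for x s
  proof -
    interpret R: vertex_row b1 b2 "\<lambda>x. u (x, s)" "\<lambda>x. L u (Vert x s)" "\<lambda>x. L u (Horiz x s)" "\<lambda>x. L u (Vert x (Suc s))"
      using cc by (intro row common_cuts_imp)
    interpret R': vertex_row b1 b2 "\<lambda>x. u' (x, s)" "\<lambda>x. L u' (Vert x s)" "\<lambda>x. L u' (Horiz x s)" "\<lambda>x. L u' (Vert x (Suc s))"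
      using cc by (intro row common_cuts_imp(2))
    let ?i = "merge (L u (Vert x s))" and ?j = "merge (L u (Horiz (x - 1) s))"
    have "vertex_out b1 b2 (u' (x, s)) ?i ?j = vertex_out b1 b2 (u (x, s)) ?i ?j"
    proof (cases "u' (x, s) = u (x, s)")
      case False
      then have "?i = Fin 2" "?j = Fin 2"
        using eq[of "(x, s)"] by (simp_all add: meeting_def merge_eq_2_iff del: s6v_label.simps)
      then show ?thesis by (simp only: vertex_out_def) simp
    qed simp
    then have "map_prod merge merge (L u' (Vert x (Suc s)), L u' (Horiz x s)) = map_prod merge merge (L u (Vert x (Suc s)), L u (Horiz x s))"
      unfolding R.rule R'.rule vertex_out_merge that .
    then show ?thesis by simp
  qed
  have H: "?H x s" if V: "\<And>x. ?V x s" for x s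
  proof -
    interpret R: vertex_row b1 b2 "\<lambda>x. u (x, s)" "\<lambda>x. L u (Vert x s)" "\<lambda>x. L u (Horiz x s)" "\<lambda>x. L u (Vert x (Suc s))"
      using cc by (intro row common_cuts_imp)
    interpret R': vertex_row b1 b2 "\<lambda>x. u' (x, s)" "\<lambda>x. L u' (Vert x s)" "\<lambda>x. L u' (Horiz x s)" "\<lambda>x. L u' (Vert x (Suc s))"
      using cc by (intro row common_cuts_imp(2))
    obtain y where y: "y \<le> x" "b2 \<le> u (y, s)" "b2 \<le> u' (y, s)"
      using cc unfolding common_cuts_def by blast
    from y(1) show ?thesis
    proof (induction x rule: int_ge_induct)
      case base
      show ?case unfolding R.h_cut[OF y(2)] R'.h_cut[OF y(3)] by (rule V)
    next
      case (step i)
      then show ?case using out[OF V, of "i + 1"] by (simp del: s6v_label.simps)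
    qed
  qed
  have V: "?V x s" for x s
  proof (induction s arbitrary: x)
    case (Suc s)
    show ?case using out[OF Suc H[OF Suc]] by blast
  qed simp
  show ?thesis
    using V H[OF V] by (cases e) (simp_all only:)
qed

text \<open>The difference of the two counts at a later time, computed from the particles that
  cross: the counts themselves depend on how classes 2 and 3 are distributed, this recursion only on
  merged labels.\<close>

primrec merged_height :: "(int \<times> nat \<Rightarrow> real) \<Rightarrow> nat \<Rightarrow> int \<Rightarrow> int" where
  "merged_height u 0 x = int (card {y. y \<le> x \<and> \<eta>\<^sub>0 y = Fin 2}) - int (card {y. x < y \<and> \<eta>\<^sub>0 y = Fin 3})"
| "merged_height u (Suc s) x = merged_height u s x - of_bool (coloured (L u (Horiz x s)))"

lemma merged_height_cong:
  "(\<And>e. merge (L u' e) = merge (L u e)) \<Longrightarrow> merged_height u' s x = merged_height u s x"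
  by (induction s) (simp_all flip: merge_eq_2_iff del: s6v_label.simps)

lemma merged_height_eq:
  assumes "cuts b2 u"
  shows "finite {y. y \<le> x \<and> L u (Vert y s) = Fin 2}" "finite {y. x < y \<and> L u (Vert y s) = Fin 3}"
    "merged_height u s x = int (card {y. y \<le> x \<and> L u (Vert y s) = Fin 2}) - int (card {y. x < y \<and> L u (Vert y s) = Fin 3})"
proof -
  have "finite {y. y \<le> x \<and> L u (Vert y s) = Fin 2} \<and> finite {y. x < y \<and> L u (Vert y s) = Fin 3} \<and>
    merged_height u s x = int (card {y. y \<le> x \<and> L u (Vert y s) = Fin 2}) - int (card {y. x < y \<and> L u (Vert y s) = Fin 3})"
  proof (induction s)
    case 0
    have "{y. y \<le> x \<and> \<eta>\<^sub>0 y = Fin 2} \<subseteq> {0..x}" "{y. x < y \<and> \<eta>\<^sub>0 y = Fin 3} \<subseteq> {x..0}"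
      using second third by force+
    then show ?case by (auto intro: finite_subset)
  next
    case (Suc s)
    interpret R: vertex_row b1 b2 "\<lambda>x. u (x, s)" "\<lambda>x. L u (Vert x s)" "\<lambda>x. L u (Horiz x s)" "\<lambda>x. L u (Vert x (Suc s))"
      by (rule row[OF assms])
    have c: "of_bool (coloured l) = (of_bool (l = Fin 2) + of_bool (l = Fin 3) :: int)" for l
      by (auto simp: coloured_def)
    show ?case
      using R.count_left[of x "Fin 2"] R.count_right[of x "Fin 3"] Suc c[of "L u (Horiz x s)"]
      by (auto simp: of_bool_def simp del: s6v_label.simps split: if_splits)
  qed
  then show "finite {y. y \<le> x \<and> L u (Vert y s) = Fin 2}" "finite {y. x < y \<and> L u (Vert y s) = Fin 3}"
    "merged_height u s x = int (card {y. y \<le> x \<and> L u (Vert y s) = Fin 2}) - int (card {y. x < y \<and> L u (Vert y s) = Fin 3})"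
    by auto
qed

lemma merged_height_step:
  assumes "cuts b2 u"
  shows "merged_height u s x = merged_height u s (x - 1) + of_bool (coloured (L u (Vert x s)))"
proof -
  let ?v = "\<lambda>y. L u (Vert y s)"
  have 1: "{y. y \<le> x \<and> ?v y = Fin 2} = (if ?v x = Fin 2 then {x} else {}) \<union> {y. y \<le> x - 1 \<and> ?v y = Fin 2}"
    by (auto simp: order.order_iff_strict)
  have 2: "{y. x - 1 < y \<and> ?v y = Fin 3} = (if ?v x = Fin 3 then {x} else {}) \<union> {y. x < y \<and> ?v y = Fin 3}"
    by (auto simp: order.order_iff_strict) (metis order.order_iff_strict zle_diff1_eq not_le)
  have "card {y. y \<le> x \<and> ?v y = Fin 2} = of_bool (?v x = Fin 2) + card {y. y \<le> x - 1 \<and> ?v y = Fin 2}"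
    unfolding 1 using merged_height_eq(1)[OF assms, of "x - 1" s] by (simp del: s6v_label.simps)
  moreover have "card {y. x - 1 < y \<and> ?v y = Fin 3} = of_bool (?v x = Fin 3) + card {y. x < y \<and> ?v y = Fin 3}"
    unfolding 2 using merged_height_eq(2)[OF assms, of x s] by (simp del: s6v_label.simps)
  ultimately show ?thesis
    unfolding merged_height_eq(3)[OF assms] by (auto simp: coloured_def simp del: s6v_label.simps)
qed

section \<open>Indexing of the particles\<close>

abbreviation S where "S u \<equiv> s6v b1 b2 u \<eta>\<^sub>0"

text \<open>A condition on merged labels alone that amounts to particle \<open>k\<close> being at
  \<open>x\<close>; this is what lets positions survive the resampling.\<close>

definition particle_at :: "(int \<times> nat \<Rightarrow> real) \<Rightarrow> nat \<Rightarrow> int \<Rightarrow> int \<Rightarrow> bool" where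
  "particle_at u s k x \<longleftrightarrow> coloured (L u (Vert (x + int s) s)) \<and> merged_height u s (x + int s) = k"

lemma shift_card:
  fixes x :: int
  shows "card {y. y \<le> x + int s \<and> L u (Vert y s) = a} = card {y. y \<le> x \<and> S u s y = a}"
  "card {y. x + int s < y \<and> L u (Vert y s) = a} = card {y. x < y \<and> S u s y = a}"
  "finite {y. y \<le> x + int s \<and> L u (Vert y s) = a} = finite {y. y \<le> x \<and> S u s y = a}"
  "finite {y. x + int s < y \<and> L u (Vert y s) = a} = finite {y. x < y \<and> S u s y = a}"
proof -
  have 1: "{y. y \<le> x + int s \<and> L u (Vert y s) = a} = (\<lambda>y. y + int s) ` {y. y \<le> x \<and> S u s y = a}"
    and 2: "{y. x + int s < y \<and> L u (Vert y s) = a} = (\<lambda>y. y + int s) ` {y. x < y \<and> S u s y = a}"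
    unfolding s6v_def by (auto simp del: s6v_label.simps intro!: image_eqI[of _ _ "_ - int s"])
  have inj: "inj_on (\<lambda>y. y + int s) A" for A by simp
  show "card {y. y \<le> x + int s \<and> L u (Vert y s) = a} = card {y. y \<le> x \<and> S u s y = a}"
    "finite {y. y \<le> x + int s \<and> L u (Vert y s) = a} = finite {y. y \<le> x \<and> S u s y = a}"
    unfolding 1 by (simp_all add: card_image finite_image_iff inj)
  show "card {y. x + int s < y \<and> L u (Vert y s) = a} = card {y. x < y \<and> S u s y = a}"
    "finite {y. x + int s < y \<and> L u (Vert y s) = a} = finite {y. x < y \<and> S u s y = a}"
    unfolding 2 by (simp_all add: card_image finite_image_iff inj)
qed

lemma S_height:
  assumes "cuts b2 u"
  shows "finite {y. y \<le> x \<and> S u s y = Fin 2}" "finite {y. x < y \<and> S u s y = Fin 3}"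
    "merged_height u s (x + int s) = int (card {y. y \<le> x \<and> S u s y = Fin 2}) - int (card {y. x < y \<and> S u s y = Fin 3})"
  using merged_height_eq[OF assms, where x="x + int s" and s=s] unfolding shift_card by auto

lemma ordered_positions_images:
  fixes z :: "int \<Rightarrow> int" and \<eta> :: "int \<Rightarrow> label"
  assumes "strict_mono z" and "range z = {x. coloured (\<eta> x)}"
  shows "{y. y \<le> z k \<and> \<eta> y = Fin 2} = z ` {i. i \<le> k \<and> \<eta> (z i) = Fin 2}"
    "{y. z k < y \<and> \<eta> y = Fin 3} = z ` {i. i > k \<and> \<eta> (z i) = Fin 3}"
proof -
  have "\<exists>i. y = z i" if "\<eta> y = Fin 2 \<or> \<eta> y = Fin 3" for y
    using assms(2) that by (auto simp: coloured_def set_eq_iff image_iff)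
  then show "{y. y \<le> z k \<and> \<eta> y = Fin 2} = z ` {i. i \<le> k \<and> \<eta> (z i) = Fin 2}"
    "{y. z k < y \<and> \<eta> y = Fin 3} = z ` {i. i > k \<and> \<eta> (z i) = Fin 3}"
    using strict_mono_less_eq[OF assms(1)] strict_mono_less[OF assms(1)] by (auto simp: image_iff) metis+
qed

lemma ordered_positions_cards:
  fixes z :: "int \<Rightarrow> int" and \<eta> :: "int \<Rightarrow> label"
  assumes "strict_mono z" and "range z = {x. coloured (\<eta> x)}"
  shows "card {y. y \<le> z k \<and> \<eta> y = Fin 2} = card {i. i \<le> k \<and> \<eta> (z i) = Fin 2}"
    "card {y. z k < y \<and> \<eta> y = Fin 3} = card {i. i > k \<and> \<eta> (z i) = Fin 3}"
    "finite {y. y \<le> z k \<and> \<eta> y = Fin 2} = finite {i. i \<le> k \<and> \<eta> (z i) = Fin 2}"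
    "finite {y. z k < y \<and> \<eta> y = Fin 3} = finite {i. i > k \<and> \<eta> (z i) = Fin 3}"
proof -
  have inj: "inj_on z A" for A using strict_mono_imp_inj_on[OF assms(1)] inj_on_subset by blast
  show "card {y. y \<le> z k \<and> \<eta> y = Fin 2} = card {i. i \<le> k \<and> \<eta> (z i) = Fin 2}"
    "finite {y. y \<le> z k \<and> \<eta> y = Fin 2} = finite {i. i \<le> k \<and> \<eta> (z i) = Fin 2}"
    unfolding ordered_positions_images[OF assms] by (simp_all add: card_image finite_image_iff inj)
  show "card {y. z k < y \<and> \<eta> y = Fin 3} = card {i. i > k \<and> \<eta> (z i) = Fin 3}"
    "finite {y. z k < y \<and> \<eta> y = Fin 3} = finite {i. i > k \<and> \<eta> (z i) = Fin 3}"
    unfolding ordered_positions_images[OF assms] by (simp_all add: card_image finite_image_iff inj)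
qed

text \<open>The two counts in the choice of the index 0 are those in the merged height at
  \<open>z 0\<close>, so that their equality says that this height is 0.\<close>

lemma ordered_positions_iff:
  assumes "cuts b2 u"
  shows "ordered_positions (S u s) z \<longleftrightarrow>
    strict_mono z \<and> range z = {x. coloured (S u s x)} \<and> merged_height u s (z 0 + int s) = 0"
proof (cases "strict_mono z \<and> range z = {x. coloured (S u s x)}")
  case True
  then have z: "strict_mono z" "range z = {x. coloured (S u s x)}" by auto
  show ?thesis
    unfolding S_height(3)[OF assms] ordered_positions_cards[OF z, of 0]
    using True S_height(1,2)[OF assms, of "z 0" s] ordered_positions_cards(3,4)[OF z, of 0]
    by (auto simp: ordered_positions_def coloured_def)
next
  case False
  then show ?thesis by (auto simp: ordered_positions_def coloured_def)
qed

text \<open>The merged height grows by 1 at each particle, is constant in between and vanishes at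
  particle 0.\<close>

lemma ordered_positions_height:
  assumes "cuts b2 u" "ordered_positions (S u s) z"
  shows "merged_height u s (z k + int s) = k"
proof -
  have z: "strict_mono z" "range z = {x. coloured (S u s x)}" "merged_height u s (z 0 + int s) = 0"
    using assms ordered_positions_iff by auto
  have step: "merged_height u s (z (i + 1) + int s) = merged_height u s (z i + int s) + 1" for i
  proof -
    have n: "\<not> coloured (L u (Vert (x + int s) s))" if "z i < x" "x < z (i + 1)" for x
    proof
      assume "coloured (L u (Vert (x + int s) s))"
      then have "x \<in> range z" using z(2) by (simp add: s6v_def)
      then obtain j where "x = z j" by auto
      then show False using that strict_mono_less[OF z(1)] by auto
    qed
    have "merged_height u s (x + int s) = merged_height u s (z i + int s)" if "z i \<le> x" "x < z (i + 1)" for x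
      using that
    proof (induction x rule: int_ge_induct)
      case (step x)
      have "merged_height u s (x + 1 + int s) = merged_height u s (x + int s)"
        using merged_height_step[OF assms(1), of s "x + 1 + int s"] n[of "x + 1"] step by (simp add: algebra_simps)
      then show ?case using step by simp
    qed simp
    from this[of "z (i + 1) - 1"] have "merged_height u s (z (i + 1) + int s - 1) = merged_height u s (z i + int s)"
      using strict_monoD[OF z(1), of i "i + 1"] by (simp add: algebra_simps)
    moreover have "coloured (L u (Vert (z (i + 1) + int s) s))"
    proof -
      have "z (i + 1) \<in> {x. coloured (S u s x)}" unfolding z(2)[symmetric] by simp
      then show ?thesis by (simp add: s6v_def)
    qed
    ultimately show ?thesis using merged_height_step[OF assms(1), of s "z (i + 1) + int s"] by simp
  qed
  show ?thesis
  proof (induction k rule: int_induct[of _ 0])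
    case (step1 i) then show ?case using step[of i] by simp
  next
    case (step2 i) then show ?case using step[of "i - 1"] by simp
  qed (use z in simp)
qed

lemma particle_at_iff:
  assumes "cuts b2 u" "ordered_positions (S u s) z"
  shows "particle_at u s k x \<longleftrightarrow> z k = x"
proof
  assume *: "particle_at u s k x"
  then have "x \<in> {x. coloured (S u s x)}" by (simp add: particle_at_def s6v_def)
  then obtain j where "x = z j" using assms ordered_positions_iff by blast
  then show "z k = x" using * ordered_positions_height[OF assms, of j] by (simp add: particle_at_def)
next
  assume *: "z k = x"
  have "z k \<in> {x. coloured (S u s x)}" using assms ordered_positions_iff by blast
  then show "particle_at u s k x"
    using * ordered_positions_height[OF assms, of k] by (simp add: particle_at_def s6v_def)
qed

lemma ordered_positions_cong:
  assumes "\<And>e. merge (L u' e) = merge (L u e)" "cuts b2 u" "cuts b2 u'"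
  shows "ordered_positions (S u' s) z \<longleftrightarrow> ordered_positions (S u s) z"
  unfolding ordered_positions_iff[OF assms(2)] ordered_positions_iff[OF assms(3)]
    merged_height_cong[of u' u, OF assms(1)] s6v_def merge_eq_2_iff[symmetric] assms(1) ..

section \<open>The classes as a dynamics of sweeps\<close>

text \<open>The value \<open>1\<close> stands for a pair of particles that does not meet: it never leads to a swap.\<close>

definition meeting_vars :: "(nat \<Rightarrow> int \<Rightarrow> int) \<Rightarrow> (int \<times> nat \<Rightarrow> real) \<Rightarrow> nat \<Rightarrow> int \<Rightarrow> real" where
  "meeting_vars z u s k = (if z (Suc s) k + 1 = z s (k + 1) then u (z s (k + 1) + int s, s) else 1)"

lemma particle_row_s6v:
  assumes "cuts b2 u" "\<And>s. ordered_positions (S u s) (z s)"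
  shows "particle_row b1 b2 (\<lambda>x. u (x, s)) (\<lambda>x. L u (Vert x s)) (\<lambda>x. L u (Horiz x s)) (\<lambda>x. L u (Vert x (Suc s)))
    (merged_height u s) (\<lambda>k. z s k + int s) (\<lambda>k. z (Suc s) k + int (Suc s))"
proof (intro particle_row.intro row assms particle_row_axioms.intro)
  fix k x
  show "merged_height u s x = merged_height u s (x - 1) + of_bool (coloured (L u (Vert x s)))"
    by (rule merged_height_step[OF assms(1)])
  show "merged_height u s x - of_bool (coloured (L u (Horiz x s))) =
     merged_height u s (x - 1) - of_bool (coloured (L u (Horiz (x - 1) s))) + of_bool (coloured (L u (Vert x (Suc s))))"
    using merged_height_step[OF assms(1), of "Suc s" x] by simp
  show "(z s k + int s = x) = (coloured (L u (Vert x s)) \<and> merged_height u s x = k)"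
    using particle_at_iff[OF assms, of s k "x - int s"] by (auto simp: particle_at_def)
  show "(z (Suc s) k + int (Suc s) = x) = (coloured (L u (Vert x (Suc s))) \<and> merged_height u s x - of_bool (coloured (L u (Horiz x s))) = k)"
    using particle_at_iff[OF assms, of "Suc s" k "x - int (Suc s)"] by (auto simp: particle_at_def)
qed

lemma meeting_at:
  assumes "cuts b2 u" "\<And>s. ordered_positions (S u s) (z s)" "z (Suc s) k + 1 = z s (k + 1)"
  shows "meeting u (z s (k + 1) + int s, s)"
proof -
  interpret P: particle_row b1 b2 "\<lambda>x. u (x, s)" "\<lambda>x. L u (Vert x s)" "\<lambda>x. L u (Horiz x s)" "\<lambda>x. L u (Vert x (Suc s))"
    "merged_height u s" "\<lambda>k. z s k + int s" "\<lambda>k. z (Suc s) k + int (Suc s)"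
    by (rule particle_row_s6v[OF assms(1,2)])
  show ?thesis
    using P.meet_iff[of k] P.X_props(1)[of "k + 1"] assms(3) by (simp add: meeting_def)
qed

text \<open>All third-class particles start to the left of all second-class ones, so that at most
  one of the two equal counts can be positive and both are 0.\<close>

lemma initial_step:
  assumes "cuts b2 u" "ordered_positions (S u 0) z"
  shows "(\<lambda>k. S u 0 (z k) = Fin 2) = step_config"
proof
  fix k
  have z: "strict_mono z" "range z = {x. \<eta>\<^sub>0 x = Fin 2 \<or> \<eta>\<^sub>0 x = Fin 3}"
    "finite {k. k > 0 \<and> \<eta>\<^sub>0 (z k) = Fin 3}" "finite {k. k \<le> 0 \<and> \<eta>\<^sub>0 (z k) = Fin 2}"
    "card {k. k > 0 \<and> \<eta>\<^sub>0 (z k) = Fin 3} = card {k. k \<le> 0 \<and> \<eta>\<^sub>0 (z k) = Fin 2}"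
    using assms(2) by (auto simp: ordered_positions_def s6v_def)
  have c: "\<eta>\<^sub>0 (z i) = Fin 2 \<or> \<eta>\<^sub>0 (z i) = Fin 3" for i using z(2) by auto
  have "\<eta>\<^sub>0 (z k) = Fin 2 \<longleftrightarrow> 0 < k"
  proof
    assume k: "\<eta>\<^sub>0 (z k) = Fin 2"
    show "0 < k"
    proof (rule ccontr)
      assume "\<not> 0 < k"
      have "\<not> \<eta>\<^sub>0 (z i) = Fin 3" if "0 < i" for i
        using third[of "z i"] second[OF k] strict_monoD[OF z(1), of k i] that \<open>\<not> 0 < k\<close> by auto
      then have "{k. k > 0 \<and> \<eta>\<^sub>0 (z k) = Fin 3} = {}" by auto
      with z(4,5) have "{k. k \<le> 0 \<and> \<eta>\<^sub>0 (z k) = Fin 2} = {}" by (metis card.empty card_0_eq)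
      with k \<open>\<not> 0 < k\<close> show False by auto
    qed
  next
    assume "0 < k"
    show "\<eta>\<^sub>0 (z k) = Fin 2"
    proof (rule ccontr)
      assume "\<not> \<eta>\<^sub>0 (z k) = Fin 2"
      then have k: "\<eta>\<^sub>0 (z k) = Fin 3" using c by blast
      have "\<not> \<eta>\<^sub>0 (z i) = Fin 2" if "i \<le> 0" for i
        using third[OF k] second[of "z i"] strict_monoD[OF z(1), of i k] that \<open>0 < k\<close> by auto
      then have "{k. k \<le> 0 \<and> \<eta>\<^sub>0 (z k) = Fin 2} = {}" by auto
      with z(3,5) have "{k. k > 0 \<and> \<eta>\<^sub>0 (z k) = Fin 3} = {}" by (metis card.empty card_0_eq)
      with k \<open>0 < k\<close> show False by auto
    qed
  qed
  then show "(S u 0 (z k) = Fin 2) = step_config k" by (simp add: s6v_def step_config_def)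
qed

lemma sweeps_eq:
  assumes "cuts b2 u" "\<And>s. ordered_positions (S u s) (z s)"
  shows "eventually (\<lambda>n. sweeps b2 b1 (meeting_vars z u) n t = (\<lambda>k. S u t (z t k) = Fin 2)) sequentially"
proof (induction t)
  case 0
  show ?case using initial_step[OF assms] by simp
next
  case (Suc s)
  interpret P: particle_row b1 b2 "\<lambda>x. u (x, s)" "\<lambda>x. L u (Vert x s)" "\<lambda>x. L u (Horiz x s)" "\<lambda>x. L u (Vert x (Suc s))"
    "merged_height u s" "\<lambda>k. z s k + int s" "\<lambda>k. z (Suc s) k + int (Suc s)"
    by (rule particle_row_s6v[OF assms])
  \<comment> \<open>Positions are taken in a frame that moves by one site per row. On the lattice
    the condition for meeting is an equality of sites, and the shift becomes the \<open>+ 1\<close>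
    in \<open>meeting_vars\<close>.\<close>
  have w: "(\<lambda>k. if z (Suc s) k + int (Suc s) = z s (k + 1) + int s then u (z s (k + 1) + int s, s) else 1) = meeting_vars z u s"
    by (auto simp: meeting_vars_def fun_eq_iff)
  have "eventually (\<lambda>n. sweep b2 b1 (meeting_vars z u s) n (\<lambda>k. S u s (z s k) = Fin 2) = (\<lambda>k. S u (Suc s) (z (Suc s) k) = Fin 2)) sequentially"
    using P.sweep_eq merged_height_eq(1,2)[OF assms(1), of 0 s] b unfolding w
    by (simp add: s6v_def del: s6v_label.simps)
  with Suc show ?case
    by eventually_elim simp
qed

lemma evolve_eq:
  assumes "cuts b2 u" "\<And>s. ordered_positions (S u s) (z s)"
  shows "evolve b2 b1 (meeting_vars z u) t = (\<lambda>k. S u t (z t k) = Fin 2)"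
proof
  fix k
  have "eventually (\<lambda>n. sweeps b2 b1 (meeting_vars z u) n t k = (S u t (z t k) = Fin 2)) sequentially"
    using sweeps_eq[OF assms, of t] by eventually_elim simp
  then have "evolve b2 b1 (meeting_vars z u) t k \<longleftrightarrow> eventually (\<lambda>n::nat. S u t (z t k) = Fin 2) sequentially"
    unfolding evolve_def by (rule eventually_cong) simp
  then show "evolve b2 b1 (meeting_vars z u) t k = (S u t (z t k) = Fin 2)" by simp
qed

end

section \<open>Resampling\<close>

lemma countable_label: "countable (UNIV :: label set)"
proof -
  have "(UNIV :: label set) = range Fin \<union> {Pinf, Minf}"
    by (auto intro: extended.exhaust)
  then show ?thesis by (metis countable_Un countable_image countable_insert countable_empty countableI_type)
qed

lemma measurable_label_cases:
  assumes "\<And>i. (\<lambda>x. f i x) \<in> measurable N R" "g \<in> measurable N (count_space (UNIV :: label set))"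
  shows "(\<lambda>x. f (g x) x) \<in> measurable N R"
  by (rule measurable_compose_countable'[OF assms countable_label])

lemma measurable_vertex_out:
  assumes u[measurable]: "u \<in> borel_measurable N"
    and i: "i \<in> measurable N (count_space UNIV)" and j: "j \<in> measurable N (count_space UNIV)"
  shows "(\<lambda>x. vertex_out b1 b2 (u x) (i x) (j x)) \<in> measurable N (count_space UNIV)"
proof -
  have "(\<lambda>x. vertex_out b1 b2 (u x) a c) \<in> measurable N (count_space UNIV)" for a c
    unfolding vertex_out_def by measurable
  then have "(\<lambda>x. vertex_out b1 b2 (u x) a (j x)) \<in> measurable N (count_space UNIV)" for a
    by (rule measurable_label_cases[OF _ j])
  then show ?thesis by (rule measurable_label_cases[OF _ i])
qed

lemma measurable_row_right:
  assumes u[measurable]: "\<And>y. (\<lambda>x. u x y) \<in> borel_measurable N"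
    and v: "\<And>y. (\<lambda>x. v x y) \<in> measurable N (count_space UNIV)"
  shows "(\<lambda>x. row_right b1 b2 (u x) (v x) y) \<in> measurable N (count_space UNIV)"
proof -
  have c: "(\<lambda>x. right_from_cut b1 b2 (u x) (v x) a n) \<in> measurable N (count_space UNIV)" for a n
  proof (induction n)
    case 0
    then show ?case using v by simp
  next
    case (Suc n)
    from measurable_vertex_out[OF u v this, of b1 b2 "a + int (Suc n)" "a + int (Suc n)"] show ?case
      unfolding right_from_cut.simps by (rule measurable_compose) simp
  qed
  have "(\<lambda>x. LEAST n. b2 \<le> u x (y - int n)) \<in> measurable N (count_space UNIV)" by measurable
  then show ?thesis
    unfolding row_right_def Let_def by (rule measurable_compose_countable[OF c])
qed

lemma measurable_s6v_label:
  assumes u: "\<And>v. (\<lambda>x. u x v) \<in> borel_measurable N"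
  shows "(\<lambda>x. s6v_label b1 b2 (u x) \<eta>\<^sub>0 e) \<in> measurable N (count_space UNIV)"
proof -
  have lb: "(\<lambda>x. label_below b1 b2 (u x) \<eta>\<^sub>0 t y) \<in> measurable N (count_space UNIV)" for t y
  proof (induction t arbitrary: y)
    case (Suc t)
    have "(\<lambda>x. row_right b1 b2 (\<lambda>y. u x (y, t)) (label_below b1 b2 (u x) \<eta>\<^sub>0 t) (y - 1)) \<in> measurable N (count_space UNIV)"
      by (rule measurable_row_right[OF u Suc])
    from measurable_vertex_out[OF u[of "(y, t)"] Suc this] show ?case
      unfolding label_below.simps by (rule measurable_compose) simp
  qed simp
  show ?thesis
    by (cases e) (use lb measurable_row_right[OF u lb] in auto)
qed

lemma measurable_uniforms_iff: "f \<in> measurable N uniforms \<longleftrightarrow> (\<forall>i. (\<lambda>x. f x i) \<in> borel_measurable N)"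
proof
  assume f: "f \<in> measurable N uniforms"
  show "\<forall>i. (\<lambda>x. f x i) \<in> borel_measurable N"
    using measurable_compose[OF f measurable_uniforms_component] by simp
next
  assume *: "\<forall>i. (\<lambda>x. f x i) \<in> borel_measurable N"
  have "(\<lambda>x. f x i) \<in> measurable N (uniform_measure lborel {0..1})" for i
    using *[rule_format, of i] by (simp cong: measurable_cong_sets)
  then show "f \<in> measurable N uniforms"
    by (intro measurable_PiM_single') (auto simp: space_PiM PiE_UNIV_domain)
qed

text \<open>Causality inside a row; with \<open>label_below_cong\<close> it shows that a horizontal
  label depends only on earlier rows and on the sites of its row up to its own.\<close>

lemma row_right_cong:
  assumes "\<And>y. y \<le> x \<Longrightarrow> u y = u' y"
  shows "row_right b1 b2 u v x = row_right b1 b2 u' v x"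
proof -
  have "right_from_cut b1 b2 u v y n = right_from_cut b1 b2 u' v y n" if "y + int n \<le> x" for y n
    using that by (induction n) (simp_all add: assms)
  moreover have "(\<lambda>n. b2 \<le> u (x - int n)) = (\<lambda>n. b2 \<le> u' (x - int n))"
    using assms by simp
  ultimately show ?thesis by (simp add: row_right_def Let_def)
qed

lemma label_below_cong:
  assumes "\<And>w. snd w < t \<Longrightarrow> u w = u' w"
  shows "label_below b1 b2 u \<eta>\<^sub>0 t = label_below b1 b2 u' \<eta>\<^sub>0 t"
  using assms
proof (induction t)
  case (Suc t)
  then have "label_below b1 b2 u \<eta>\<^sub>0 t = label_below b1 b2 u' \<eta>\<^sub>0 t"
    "(\<lambda>y. u (y, t)) = (\<lambda>y. u' (y, t))" by auto
  moreover have "u (x, t) = u' (x, t)" for x using Suc.prems by simp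
  ultimately show ?case
    by (intro ext) (simp only: label_below.simps)
qed (simp add: fun_eq_iff)

context s6v_initial
begin

lemma measurable_L: "(\<And>v. (\<lambda>x. u x v) \<in> borel_measurable N) \<Longrightarrow> (\<lambda>x. L (u x) e) \<in> measurable N (count_space UNIV)"
  by (rule measurable_s6v_label)

lemma pred_L:
  assumes "\<And>v. (\<lambda>x. u x v) \<in> borel_measurable N"
  shows "Measurable.pred N (\<lambda>x. P (L (u x) e))"
  by (rule measurable_compose[OF measurable_L[OF assms]]) simp_all

lemma pred_meeting:
  assumes "\<And>v. (\<lambda>x. u x v) \<in> borel_measurable N"
  shows "Measurable.pred N (\<lambda>x. meeting (u x) v)"
  unfolding meeting_def by (intro pred_intros_logic pred_L assms)

lemma measurable_merged_height:
  assumes "\<And>v. (\<lambda>x. u x v) \<in> borel_measurable N"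
  shows "(\<lambda>x. merged_height (u x) s y) \<in> measurable N (count_space UNIV)"
proof (induction s)
  case (Suc s)
  have [measurable]: "Measurable.pred N (\<lambda>x. coloured (L (u x) (Horiz y s)))"
    by (rule pred_L[OF assms])
  note Suc[measurable]
  show ?case unfolding merged_height.simps of_bool_def by measurable
qed simp

lemma pred_particle_at:
  assumes "\<And>v. (\<lambda>x. u x v) \<in> borel_measurable N"
  shows "Measurable.pred N (\<lambda>x. particle_at (u x) s k y)"
proof -
  have [measurable]: "Measurable.pred N (\<lambda>x. coloured (L (u x) (Vert (y + int s) s)))"
    by (rule pred_L[OF assms])
  note measurable_merged_height[OF assms, measurable]
  show ?thesis unfolding particle_at_def by measurable
qed

text \<open>The class sequence as a function of the variables alone, without reference to
  \<open>Z\<close>, so that it can be applied to resampled variables too.\<close>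

definition classes :: "nat \<Rightarrow> (int \<times> nat \<Rightarrow> real) \<Rightarrow> int \<Rightarrow> bool" where
  "classes t u k \<longleftrightarrow> (\<exists>x. particle_at u t k x \<and> L u (Vert (x + int t) t) = Fin 2)"

lemma measurable_classes:
  assumes "\<And>v. (\<lambda>x. u x v) \<in> borel_measurable N"
  shows "(\<lambda>x. classes t (u x)) \<in> measurable N config_space"
  unfolding measurable_config_space_iff
proof
  fix k
  have [measurable]: "Measurable.pred N (\<lambda>x. particle_at (u x) t k y)" for y
    by (rule pred_particle_at[OF assms])
  have [measurable]: "Measurable.pred N (\<lambda>x. L (u x) (Vert (y + int t) t) = Fin 2)" for y
    by (rule pred_L[OF assms])
  show "Measurable.pred N (\<lambda>x. classes t (u x) k)"
    unfolding classes_def by measurable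
qed

lemma classes_eq:
  assumes "cuts b2 u" "ordered_positions (S u t) z"
  shows "classes t u = (\<lambda>k. S u t (z k) = Fin 2)"
  unfolding classes_def particle_at_iff[OF assms] by (simp add: s6v_def)

text \<open>The labels entering a vertex are determined by earlier rows and by the sites strictly to
  the left in its own row.\<close>

lemma meeting_upd: "meeting (u(v := r)) v = meeting u v"
proof -
  obtain x s where v: "v = (x, s)" by (cases v)
  have "label_below b1 b2 (u(v := r)) \<eta>\<^sub>0 s = label_below b1 b2 u \<eta>\<^sub>0 s"
    by (rule label_below_cong) (auto simp: v)
  moreover have "row_right b1 b2 (\<lambda>y. (u(v := r)) (y, s)) f (x - 1) = row_right b1 b2 (\<lambda>y. u (y, s)) f (x - 1)" for f
    by (rule row_right_cong) (auto simp: v)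
  ultimately show ?thesis by (simp add: meeting_def v)
qed

section \<open>Fresh variables at the meetings\<close>

definition resample :: "(int \<times> nat) set \<Rightarrow> (int \<times> nat \<Rightarrow> real) \<Rightarrow> (int \<times> nat \<Rightarrow> real) \<Rightarrow> int \<times> nat \<Rightarrow> real" where
  "resample A u u' v = (if v \<in> A \<and> meeting u v then u' v else u v)"

lemma common_cuts_resample: "common_cuts u u' \<Longrightarrow> common_cuts u (resample A u u')"
proof -
  assume *: "common_cuts u u'"
  have imp: "b2 \<le> u v \<and> b2 \<le> u' v \<Longrightarrow> b2 \<le> u v \<and> b2 \<le> resample A u u' v" for v
    by (simp add: resample_def)
  show ?thesis
    unfolding common_cuts_def
  proof (intro allI conjI)
    fix x t
    show "\<exists>y\<le>x. b2 \<le> u (y, t) \<and> b2 \<le> resample A u u' (y, t)"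
      using * imp unfolding common_cuts_def by blast
    show "\<exists>y\<ge>x. b2 \<le> u (y, t) \<and> b2 \<le> resample A u u' (y, t)"
      using * imp unfolding common_cuts_def by blast
  qed
qed

text \<open>Changes are made only at meetings, so that \<open>merged_eq\<close> applies; being a
  meeting depends on merged labels only.\<close>

lemma meeting_resample:
  assumes "common_cuts u u'"
  shows "meeting (resample A u u') v = meeting u v"
proof -
  have "merge (L (resample A u u') e) = merge (L u e)" for e
    by (rule merged_eq[OF common_cuts_resample[OF assms]]) (auto simp: resample_def split: if_splits)
  then show ?thesis unfolding meeting_def merge_eq_2_iff[symmetric] by (simp only:)
qed

lemma measurable_resample:
  "(\<lambda>(u, u'). resample A u u') \<in> measurable (uniforms \<Otimes>\<^sub>M uniforms) uniforms"
  unfolding measurable_uniforms_iff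
proof
  fix v
  have [measurable]: "Measurable.pred (uniforms \<Otimes>\<^sub>M uniforms) (\<lambda>p. meeting (fst p) v)"
    by (rule pred_meeting) measurable
  have "(\<lambda>p. if v \<in> A \<and> meeting (fst p) v then snd p v else fst p v) \<in> borel_measurable (uniforms \<Otimes>\<^sub>M uniforms)"
    by measurable
  then show "(\<lambda>p. (case p of (u, u') \<Rightarrow> resample A u u') v) \<in> borel_measurable (uniforms \<Otimes>\<^sub>M uniforms)"
    by (simp add: resample_def case_prod_beta')
qed

lemma AE_common_cut:
  fixes I :: "(int \<times> nat) set"
  assumes "infinite I"
  shows "AE p in uniforms \<Otimes>\<^sub>M uniforms. \<exists>v\<in>I. b2 \<le> fst p v \<and> b2 \<le> snd p v"
proof -
  let ?U = "uniforms :: (int \<times> nat \<Rightarrow> real) measure"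
  interpret U: prob_space ?U by (rule prob_space_uniforms)
  interpret UU: pair_prob_space ?U ?U ..
  \<comment> \<open>Leaving out every finite set \<open>J\<close> shows that the first field has
    infinitely many cuts in \<open>I\<close>; the second field then has one among them.\<close>
  have "AE u in ?U. \<forall>J\<in>Collect finite. \<exists>v\<in>I - J. b2 \<le> u v"
    using b(3) assms by (intro AE_ball_countable' AE_uniforms_ge countable_Collect_finite) auto
  then have inf: "AE u in ?U. infinite {v\<in>I. b2 \<le> u v}"
    by eventually_elim (metis (no_types, lifting) Diff_iff mem_Collect_eq)
  have "AE u in ?U. AE u' in ?U. \<exists>v\<in>I. b2 \<le> u v \<and> b2 \<le> u' v"
    using inf
  proof eventually_elim
    case (elim u)
    have "AE u' in ?U. \<exists>v\<in>{v\<in>I. b2 \<le> u v}. b2 \<le> u' v"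
      by (rule AE_uniforms_ge[OF elim b(3)])
    then show ?case by eventually_elim blast
  qed
  moreover have "Measurable.pred (?U \<Otimes>\<^sub>M ?U) (\<lambda>p. \<exists>v\<in>I. b2 \<le> fst p v \<and> b2 \<le> snd p v)"
    by (intro pred_intros_countable_bounded countableI_type) measurable
  ultimately show ?thesis
    by (intro UU.AE_pair_measure) (auto simp: pred_def)
qed

lemma AE_common_cuts: "AE p in uniforms \<Otimes>\<^sub>M uniforms. common_cuts (fst p) (snd p)"
proof -
  have "infinite ((\<lambda>y. (y, t)) ` {..x})" "infinite ((\<lambda>y. (y, t)) ` {x..})" for x :: int and t :: nat
    by (auto simp: finite_image_iff inj_on_def infinite_Iic infinite_Ici)
  then have *: "AE p in uniforms \<Otimes>\<^sub>M uniforms. (\<exists>v\<in>(\<lambda>y. (y, t)) ` {..x}. b2 \<le> fst p v \<and> b2 \<le> snd p v) \<and>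
      (\<exists>v\<in>(\<lambda>y. (y, t)) ` {x..}. b2 \<le> fst p v \<and> b2 \<le> snd p v)" for x :: int and t :: nat
    by (intro AE_conjI AE_common_cut)
  have "AE p in uniforms \<Otimes>\<^sub>M uniforms. \<forall>(x::int) (t::nat). (\<exists>v\<in>(\<lambda>y. (y, t)) ` {..x}. b2 \<le> fst p v \<and> b2 \<le> snd p v) \<and>
      (\<exists>v\<in>(\<lambda>y. (y, t)) ` {x..}. b2 \<le> fst p v \<and> b2 \<le> snd p v)"
    unfolding AE_all_countable by (intro allI, rule *)
  then show ?thesis
    by eventually_elim (auto simp: common_cuts_def)
qed

text \<open>Vertices are added one by one. Given the field resampled on \<open>A\<close>, the new
  vertex receives an independent value exactly if it is a meeting, and whether it is one does not
  depend on the value it had.\<close>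

lemma resample_law_finite:
  assumes "finite A" and F[measurable]: "F \<in> borel_measurable uniforms"
  shows "(\<integral>\<^sup>+u. (\<integral>\<^sup>+u'. F (resample A u u') \<partial>uniforms) \<partial>uniforms) = (\<integral>\<^sup>+u. F u \<partial>uniforms)"
  using assms
proof (induction A arbitrary: F)
  case empty
  interpret U: prob_space "uniforms :: (int \<times> nat \<Rightarrow> real) measure" by (rule prob_space_uniforms)
  have "resample {} u u' = u" for u u' by (simp add: resample_def fun_eq_iff)
  then show ?case by (simp add: U.emeasure_space_1[simplified])
next
  case (insert v A)
  let ?U = "uniforms :: (int \<times> nat \<Rightarrow> real) measure" and ?I = "uniform_measure lborel {0..1::real}"
  interpret U: prob_space ?U by (rule prob_space_uniforms)
  interpret I: prob_space ?I by (rule prob_space_unit)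
  interpret UU: pair_prob_space ?U ?U ..
  interpret UI: pair_prob_space ?U ?I ..
  note F[measurable] = insert.prems
  define G where "G y r = F (if meeting y v then y(v := r) else y)" for y r
  have [measurable]: "Measurable.pred N (\<lambda>x. meeting (f x) v)" if "f \<in> measurable N ?U" for f and N :: "'x measure"
    using that unfolding measurable_uniforms_iff by (intro pred_meeting) auto
  have sets_I: "sets ?I = sets borel" by simp
  have snd_m: "snd \<in> borel_measurable (?U \<Otimes>\<^sub>M ?I)"
    using measurable_snd[of ?U ?I] unfolding measurable_cong_sets[OF refl sets_I] .
  have upd: "(\<lambda>x. (f x)(v := g x)) \<in> measurable N ?U"
    if [measurable]: "f \<in> measurable N ?U" "g \<in> borel_measurable N" for f g and N :: "'x measure"
    unfolding measurable_uniforms_iff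
  proof
    fix i show "(\<lambda>x. ((f x)(v := g x)) i) \<in> borel_measurable N" by (cases "i = v") auto
  qed
  have G: "(\<lambda>x. G (f x) (g x)) \<in> borel_measurable N"
    if [measurable]: "f \<in> measurable N ?U" "g \<in> borel_measurable N" for f g and N :: "'x measure"
  proof -
    note upd[OF that, measurable]
    have "(\<lambda>x. if meeting (f x) v then F ((f x)(v := g x)) else F (f x)) \<in> borel_measurable N" by measurable
    then show ?thesis unfolding G_def by (simp add: if_distrib)
  qed
  have res: "(\<lambda>u'. resample A u u') \<in> measurable ?U ?U" for u
    using measurable_compose[OF measurable_Pair1'[of u ?U ?U] measurable_resample[of A]] by simp
  \<comment> \<open>By \<open>meeting_resample\<close> the decision at \<open>v\<close> can be read
    off the field already resampled on \<open>A\<close>; hence the two resamplings can be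
    composed.\<close>
  have 1: "F (resample (insert v A) u u') = G (resample A u u') (u' v)" if "common_cuts u u'" for u u'
  proof -
    have "resample (insert v A) u u' = (if meeting (resample A u u') v then (resample A u u')(v := u' v) else resample A u u')"
      unfolding meeting_resample[OF that] by (auto simp: resample_def fun_eq_iff)
    then show ?thesis by (simp add: G_def)
  qed
  have 2: "(\<integral>\<^sup>+u'. G (resample A u u') (u' v) \<partial>?U) = (\<integral>\<^sup>+u'. (\<integral>\<^sup>+r. G (resample A u u') r \<partial>?I) \<partial>?U)" for u
  proof -
    have "(\<lambda>u'. G (resample A u u') (u' v)) \<in> borel_measurable ?U"
      by (rule G[OF res]) measurable
    then have "(\<integral>\<^sup>+u'. G (resample A u u') (u' v) \<partial>?U) =
      (\<integral>\<^sup>+u'. (\<integral>\<^sup>+r. G (resample A u (u'(v := r))) ((u'(v := r)) v) \<partial>?I) \<partial>?U)"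
      by (rule uniforms_resample)
    moreover have "resample A u (u'(v := r)) = resample A u u'" for u' r
      using insert.hyps(2) by (auto simp: resample_def fun_eq_iff)
    ultimately show ?thesis by simp
  qed
  have Gr: "(\<lambda>y. \<integral>\<^sup>+r. G y r \<partial>?I) \<in> borel_measurable ?U"
  proof -
    have "(\<lambda>(y, r). G y r) \<in> borel_measurable (?U \<Otimes>\<^sub>M ?I)"
      unfolding split_beta' by (rule G[OF measurable_fst snd_m])
    then show ?thesis by (rule I.borel_measurable_nn_integral)
  qed
  have "(\<integral>\<^sup>+u. (\<integral>\<^sup>+u'. F (resample (insert v A) u u') \<partial>?U) \<partial>?U) = (\<integral>\<^sup>+u. (\<integral>\<^sup>+u'. G (resample A u u') (u' v) \<partial>?U) \<partial>?U)"
    using UU.AE_pair[OF AE_common_cuts]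
    by (intro nn_integral_cong_AE) (auto elim!: eventually_mono intro!: nn_integral_cong_AE 1)
  also have "\<dots> = (\<integral>\<^sup>+u. (\<integral>\<^sup>+u'. (\<integral>\<^sup>+r. G (resample A u u') r \<partial>?I) \<partial>?U) \<partial>?U)"
    by (simp only: 2)
  also have "\<dots> = (\<integral>\<^sup>+y. (\<integral>\<^sup>+r. G y r \<partial>?I) \<partial>?U)"
    by (rule insert.IH[OF Gr])
  also have "\<dots> = (\<integral>\<^sup>+u. F u \<partial>?U)"
  proof -
    have [measurable]: "Measurable.pred ?U (\<lambda>y. meeting y v)" by (rule pred_meeting) measurable
    \<comment> \<open>Split by whether \<open>v\<close> is a meeting: on \<open>F1\<close> the
      coordinate \<open>v\<close> is integrated afresh, on \<open>F0\<close> nothing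
      changes.\<close>
    define F1 where "F1 y = (if meeting y v then F y else 0)" for y
    define F0 where "F0 y = (if meeting y v then 0 else F y)" for y
    have [measurable]: "F1 \<in> borel_measurable ?U" "F0 \<in> borel_measurable ?U"
      unfolding F1_def F0_def by measurable
    have Geq: "G y r = F1 (y(v := r)) + F0 y" for y r
      by (simp add: G_def F1_def F0_def meeting_upd)
    have m1: "(\<lambda>r. F1 (y(v := r))) \<in> borel_measurable ?I" for y
      by (rule measurable_compose[OF upd, of "\<lambda>_. y"]) (auto cong: measurable_cong_sets)
    have m2: "(\<lambda>y. \<integral>\<^sup>+r. F1 (y(v := r)) \<partial>?I) \<in> borel_measurable ?U"
    proof -
      have "(\<lambda>(y, r). F1 (y(v := r))) \<in> borel_measurable (?U \<Otimes>\<^sub>M ?I)"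
        unfolding split_beta' by (rule measurable_compose[OF upd[OF measurable_fst snd_m]]) measurable
      then show ?thesis by (rule I.borel_measurable_nn_integral)
    qed
    have "(\<integral>\<^sup>+y. (\<integral>\<^sup>+r. G y r \<partial>?I) \<partial>?U) = (\<integral>\<^sup>+y. (\<integral>\<^sup>+r. F1 (y(v := r)) \<partial>?I) + F0 y \<partial>?U)"
      unfolding Geq using m1 by (subst nn_integral_add) (auto simp: I.emeasure_space_1[simplified])
    also have "\<dots> = (\<integral>\<^sup>+y. F1 y \<partial>?U) + (\<integral>\<^sup>+y. F0 y \<partial>?U)"
      using m2 by (subst nn_integral_add) (auto simp: uniforms_resample[of F1 v])
    also have "\<dots> = (\<integral>\<^sup>+y. F1 y + F0 y \<partial>?U)"
      by (subst nn_integral_add) auto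
    also have "\<dots> = (\<integral>\<^sup>+y. F y \<partial>?U)"
      by (intro nn_integral_cong) (simp add: F1_def F0_def)
    finally show ?thesis .
  qed
  finally show ?case .
qed

text \<open>A cylinder over \<open>J\<close> cannot distinguish resampling everywhere from
  resampling on \<open>J\<close>, because the meetings are read off the original field.\<close>

lemma resample_law: "distr (uniforms \<Otimes>\<^sub>M uniforms) uniforms (\<lambda>(u, u'). resample UNIV u u') = uniforms"
proof (rule measure_eqI_PiM_infinite[symmetric, OF refl])
  let ?U = "uniforms :: (int \<times> nat \<Rightarrow> real) measure"
  interpret U: prob_space ?U by (rule prob_space_uniforms)
  interpret UU: pair_prob_space ?U ?U ..
  show "finite_measure ?U" by unfold_locales
  fix J :: "(int \<times> nat) set" and A assume J: "finite J" and A: "\<And>i. i \<in> J \<Longrightarrow> A i \<in> sets (uniform_measure lborel {0..1::real})"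
  let ?X = "prod_emb UNIV (\<lambda>_. uniform_measure lborel {0..1::real}) J (Pi\<^sub>E J A)"
  have X[measurable]: "?X \<in> sets ?U" using J A by (intro sets_PiM_I) auto
  have Xiff: "u \<in> ?X \<longleftrightarrow> (\<forall>i\<in>J. u i \<in> A i)" for u
    by (subst prod_emb_PiE) (auto simp: PiE_UNIV_domain Pi_iff split: if_splits)
  have "emeasure ?U ?X = (\<integral>\<^sup>+u. indicator ?X u \<partial>?U)" by simp
  also have "\<dots> = (\<integral>\<^sup>+u. (\<integral>\<^sup>+u'. indicator ?X (resample J u u') \<partial>?U) \<partial>?U)"
    by (rule resample_law_finite[OF J, symmetric]) measurable
  also have "\<dots> = (\<integral>\<^sup>+u. (\<integral>\<^sup>+u'. indicator ?X (resample UNIV u u') \<partial>?U) \<partial>?U)"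
    by (intro nn_integral_cong) (auto simp: indicator_def Xiff resample_def)
  also have "\<dots> = (\<integral>\<^sup>+p. indicator ?X (case p of (u, u') \<Rightarrow> resample UNIV u u') \<partial>(?U \<Otimes>\<^sub>M ?U))"
    using measurable_compose[OF measurable_resample[of UNIV], of "indicator ?X" borel]
    by (subst U.nn_integral_fst[symmetric]) auto
  also have "\<dots> = (\<integral>\<^sup>+u. indicator ?X u \<partial>distr (?U \<Otimes>\<^sub>M ?U) ?U (\<lambda>(u, u'). resample UNIV u u'))"
    by (rule nn_integral_distr[symmetric, OF measurable_resample]) measurable
  also have "\<dots> = emeasure (distr (?U \<Otimes>\<^sub>M ?U) ?U (\<lambda>(u, u'). resample UNIV u u')) ?X"
    by simp
  finally show "emeasure ?U ?X = emeasure (distr (?U \<Otimes>\<^sub>M ?U) ?U (\<lambda>(u, u'). resample UNIV u u')) ?X" .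
qed simp

end

section \<open>The conditional law of the classes\<close>

lemma config_measure_eqI:
  assumes "prob_space \<mu>" "prob_space \<nu>" and sets: "sets \<mu> = sets config_space" "sets \<nu> = sets config_space"
    and AE: "AE \<eta> in \<mu>. \<eta> \<in> balanced_configs"
    and eq: "\<And>\<eta>. \<eta> \<in> balanced_configs \<Longrightarrow> measure \<nu> {\<eta>} = measure \<mu> {\<eta>}"
  shows "\<nu> = \<mu>"
proof -
  interpret m: prob_space \<mu> by fact
  interpret n: prob_space \<nu> by fact
  let ?B = balanced_configs
  have B: "?B \<in> sets config_space" by (rule countable_in_config_space[OF countable_balanced])
  have e: "emeasure \<nu> (C \<inter> ?B) = emeasure \<mu> (C \<inter> ?B)" for C
  proof -
    have c: "countable (C \<inter> ?B)" using countable_balanced by blast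
    have "emeasure \<nu> (C \<inter> ?B) = (\<integral>\<^sup>+\<eta>. emeasure \<nu> {\<eta>} \<partial>count_space (C \<inter> ?B))"
      by (rule emeasure_countable_singleton[OF _ c]) (simp add: sets)
    also have "\<dots> = (\<integral>\<^sup>+\<eta>. emeasure \<mu> {\<eta>} \<partial>count_space (C \<inter> ?B))"
      by (intro nn_integral_cong) (simp add: eq m.emeasure_eq_measure n.emeasure_eq_measure)
    also have "\<dots> = emeasure \<mu> (C \<inter> ?B)"
      by (rule emeasure_countable_singleton[OF _ c, symmetric]) (simp add: sets)
    finally show ?thesis .
  qed
  have "emeasure \<nu> ?B = emeasure \<mu> ?B" using e[of UNIV] by simp
  also have "\<dots> = 1" using AE B by (simp add: m.emeasure_eq_1_AE sets)
  finally have AE': "AE \<eta> in \<nu>. \<eta> \<in> ?B" using B by (intro n.AE_prob_1) (simp add: n.emeasure_eq_measure)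
  show ?thesis
  proof (rule measure_eqI)
    fix C assume C: "C \<in> sets \<nu>"
    have "emeasure \<nu> C = emeasure \<nu> (C \<inter> ?B)"
      using AE' C B by (intro emeasure_eq_AE) (auto simp: sets)
    moreover have "emeasure \<mu> C = emeasure \<mu> (C \<inter> ?B)"
      using AE C B by (intro emeasure_eq_AE) (auto simp: sets)
    ultimately show "emeasure \<nu> C = emeasure \<mu> C" using e by simp
  qed (simp add: sets)
qed

locale s6v_process = s6v_initial b1 b2 \<eta>\<^sub>0 + prob_space M
  for b1 b2 :: real and \<eta>\<^sub>0 :: "int \<Rightarrow> label" and M :: "'w measure" +
  fixes U :: "int \<times> nat \<Rightarrow> 'w \<Rightarrow> real" and Z :: "nat \<Rightarrow> int \<Rightarrow> 'w \<Rightarrow> int" and t :: nat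
  assumes indep: "indep_vars (\<lambda>_. borel) U UNIV"
    and law: "\<And>v. distr M borel (U v) = uniform_measure lborel {0..1}"
    and Z: "\<And>s k. Z s k \<in> measurable M (count_space UNIV)"
    and ordered: "AE \<omega> in M. \<forall>s. ordered_positions (S (\<lambda>v. U v \<omega>) s) (\<lambda>k. Z s k \<omega>)"
begin

definition vars :: "'w \<Rightarrow> int \<times> nat \<Rightarrow> real" where
  "vars \<omega> = (\<lambda>v. U v \<omega>)"

definition history :: "'w measure" where
  "history = history_algebra M Z (\<lambda>e \<omega>. L (vars \<omega>) e) t"

definition particle_classes :: "'w \<Rightarrow> int \<Rightarrow> bool" where
  "particle_classes \<omega> = (\<lambda>k. S (vars \<omega>) t (Z t k \<omega>) = Fin 2)"

definition resampled_classes :: "'w \<Rightarrow> (int \<times> nat \<Rightarrow> real) \<Rightarrow> int \<Rightarrow> bool" where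
  "resampled_classes \<omega> u = evolve b2 b1 (meeting_vars (\<lambda>s k. Z s k \<omega>) u) t"

text \<open>The history fixes the positions up to time \<open>t\<close>, thus which particles meet;
  what is left random is the variables at the meetings, taken fresh.\<close>

definition kernel :: "'w \<Rightarrow> (int \<Rightarrow> bool) measure" where
  "kernel \<omega> = distr uniforms config_space (resampled_classes \<omega>)"

lemma U_measurable [measurable]: "U v \<in> borel_measurable M"
  using indep unfolding indep_vars_def by blast

lemma vars_component [measurable]: "(\<lambda>\<omega>. vars \<omega> v) \<in> borel_measurable M"
  by (simp add: vars_def)

lemma vars_measurable [measurable]: "vars \<in> measurable M uniforms"
  by (simp add: measurable_uniforms_iff)

lemma distr_vars: "distr M uniforms vars = uniforms"
proof -
  have "distr M (\<Pi>\<^sub>M i\<in>UNIV. borel) (\<lambda>\<omega>. \<lambda>v\<in>UNIV. U v \<omega>) = (\<Pi>\<^sub>M v\<in>UNIV. distr M borel (U v))"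
    using indep by (subst (asm) indep_vars_iff_distr_eq_PiM) auto
  moreover have "vars = (\<lambda>\<omega> v. U v \<omega>)" by (simp add: vars_def fun_eq_iff)
  ultimately have "distr M (\<Pi>\<^sub>M i\<in>UNIV. borel) vars = uniforms"
    by (simp add: law restrict_def)
  moreover have "distr M (\<Pi>\<^sub>M i\<in>UNIV. borel) vars = distr M uniforms vars"
    by (intro distr_cong refl sets_PiM_cong) auto
  ultimately show ?thesis by simp
qed

abbreviation P2 where "P2 \<equiv> M \<Otimes>\<^sub>M (uniforms :: (int \<times> nat \<Rightarrow> real) measure)"

lemma distr_vars_pair: "distr P2 (uniforms \<Otimes>\<^sub>M uniforms) (\<lambda>p. (vars (fst p), snd p)) = uniforms \<Otimes>\<^sub>M uniforms"
proof -
  let ?U = "uniforms :: (int \<times> nat \<Rightarrow> real) measure"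
  interpret UU: prob_space ?U by (rule prob_space_uniforms)
  have d: "distr ?U ?U id = ?U" by (simp add: id_def)
  have "distr M ?U vars \<Otimes>\<^sub>M distr ?U ?U id = distr P2 (?U \<Otimes>\<^sub>M ?U) (\<lambda>(x, y). (vars x, id y))"
    by (rule pair_measure_distr) (auto simp: d intro: UU.sigma_finite_measure_axioms)
  then show ?thesis by (simp add: d distr_vars split_beta')
qed

lemma distr_resample: "distr P2 uniforms (\<lambda>p. resample UNIV (vars (fst p)) (snd p)) = uniforms"
proof -
  have m: "(\<lambda>p. (vars (fst p), snd p)) \<in> measurable P2 (uniforms \<Otimes>\<^sub>M uniforms)" by measurable
  have "distr P2 uniforms ((\<lambda>(u, u'). resample UNIV u u') \<circ> (\<lambda>p. (vars (fst p), snd p))) = uniforms"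
    using distr_distr[OF measurable_resample m, of UNIV] by (simp add: distr_vars_pair resample_law)
  then show ?thesis by (simp add: o_def)
qed

lemma resample_measurable [measurable]:
  "(\<lambda>p. resample UNIV (vars (fst p)) (snd p)) \<in> measurable P2 uniforms"
  using measurable_compose[OF _ measurable_resample[of UNIV], of "\<lambda>p. (vars (fst p), snd p)" P2] by simp

lemma AE_fst_P2:
  assumes "AE \<omega> in M. Q \<omega>" shows "AE p in P2. Q (fst p)"
proof -
  interpret UU: prob_space "uniforms :: (int \<times> nat \<Rightarrow> real) measure" by (rule prob_space_uniforms)
  have "distr P2 M fst = M" by (rule UU.distr_pair_fst)
  with assms have "AE \<omega> in distr P2 M fst. Q \<omega>" by (simp only:)
  then show ?thesis by (rule AE_distrD[OF measurable_fst])
qed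

lemma AE_P2: "AE p in P2. common_cuts (vars (fst p)) (snd p) \<and> (\<forall>s. ordered_positions (S (vars (fst p)) s) (\<lambda>k. Z s k (fst p)))"
proof -
  let ?f = "\<lambda>p. (vars (fst p), snd p)"
  have f: "?f \<in> measurable P2 (uniforms \<Otimes>\<^sub>M uniforms)" by measurable
  have "AE p in distr P2 (uniforms \<Otimes>\<^sub>M uniforms) ?f. common_cuts (fst p) (snd p)"
    unfolding distr_vars_pair by (rule AE_common_cuts)
  from AE_distrD[OF f this] have "AE p in P2. common_cuts (vars (fst p)) (snd p)"
    by simp
  moreover have "AE p in P2. \<forall>s. ordered_positions (S (vars (fst p)) s) (\<lambda>k. Z s k (fst p))"
    using AE_fst_P2[OF ordered] by (simp add: vars_def)
  ultimately show ?thesis by eventually_elim blast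
qed

lemma AE_M: "AE \<omega> in M. cuts b2 (vars \<omega>) \<and> (\<forall>s. ordered_positions (S (vars \<omega>) s) (\<lambda>k. Z s k \<omega>))"
proof -
  interpret UU: prob_space "uniforms :: (int \<times> nat \<Rightarrow> real) measure" by (rule prob_space_uniforms)
  interpret MU: pair_sigma_finite M "uniforms :: (int \<times> nat \<Rightarrow> real) measure" ..
  have "AE \<omega> in M. AE u in uniforms. common_cuts (vars \<omega>) u \<and> (\<forall>s. ordered_positions (S (vars \<omega>) s) (\<lambda>k. Z s k \<omega>))"
    using MU.AE_pair[OF AE_P2] by simp
  then show ?thesis
  proof eventually_elim
    case (elim \<omega>)
    \<comment> \<open>One \<open>u\<close> from a set of full measure is enough, as common cuts with
      any \<open>u\<close> are cuts of \<open>vars \<omega>\<close>.\<close>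
    have "\<exists>u. common_cuts (vars \<omega>) u \<and> (\<forall>s. ordered_positions (S (vars \<omega>) s) (\<lambda>k. Z s k \<omega>))"
    proof (rule ccontr)
      assume "\<not> ?thesis"
      with elim have "AE u in (uniforms :: (int \<times> nat \<Rightarrow> real) measure). False"
        by (rule_tac eventually_mono) auto
      then show False by simp
    qed
    then show ?case using common_cuts_imp by blast
  qed
qed

text \<open>Resampling leaves the merged labels alone, and with them all positions. The classes of
  the resampled process are therefore driven by the fresh variables along the old
  trajectories.\<close>

lemma
  assumes cc: "common_cuts (vars \<omega>) u" and z: "\<And>s. ordered_positions (S (vars \<omega>) s) (\<lambda>k. Z s k \<omega>)"
  shows resampled_merge: "merge (L (resample UNIV (vars \<omega>) u) e) = merge (L (vars \<omega>) e)"
    and resampled_particle: "particle_at (resample UNIV (vars \<omega>) u) s k x \<longleftrightarrow> Z s k \<omega> = x"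
    and resampled_classes_eq: "classes t (resample UNIV (vars \<omega>) u) = resampled_classes \<omega> u"
proof -
  let ?r = "resample UNIV (vars \<omega>) u" and ?z = "\<lambda>s k. Z s k \<omega>"
  have cc': "common_cuts (vars \<omega>) ?r" by (rule common_cuts_resample[OF cc])
  note c = common_cuts_imp[OF cc']
  have m: "merge (L ?r e) = merge (L (vars \<omega>) e)" for e
    by (rule merged_eq[OF cc']) (auto simp: resample_def split: if_splits)
  then show "merge (L ?r e) = merge (L (vars \<omega>) e)" .
  have z': "ordered_positions (S ?r s) (?z s)" for s
    using ordered_positions_cong[OF m c] z by simp
  show "particle_at ?r s k x \<longleftrightarrow> Z s k \<omega> = x"
    by (rule particle_at_iff[OF c(2) z'])
  have "classes t ?r = evolve b2 b1 (meeting_vars ?z ?r) t"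
    unfolding classes_eq[OF c(2) z'] evolve_eq[OF c(2) z'] ..
  \<comment> \<open>A variable is read only at a meeting, where the resampled field is
    \<open>u\<close>.\<close>
  moreover have "meeting_vars ?z ?r = meeting_vars ?z u"
    using meeting_at[OF c(1) z] by (auto simp: meeting_vars_def resample_def fun_eq_iff)
  ultimately show "classes t ?r = resampled_classes \<omega> u"
    by (simp add: resampled_classes_def)
qed

lemma particle_classes_eq: "AE \<omega> in M. particle_classes \<omega> = classes t (vars \<omega>)"
  using AE_M
proof eventually_elim
  case (elim \<omega>)
  then show ?case
    using classes_eq[of "vars \<omega>" t "\<lambda>k. Z t k \<omega>"] by (simp add: particle_classes_def)
qed

definition generators :: "'w set set" where
  "generators = {{\<omega> \<in> space M. Z s k \<omega> = z} | s k z. s \<le> t} \<union> {{\<omega> \<in> space M. L (vars \<omega>) e = Fin 1} | e. True}"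

lemma sets_history: "sets history = sigma_sets (space M) generators" and space_history: "space history = space M"
proof -
  have "history = sigma (space M) generators"
    by (simp add: history_def history_algebra_def generators_def)
  moreover have "generators \<subseteq> Pow (space M)" by (auto simp: generators_def)
  ultimately show "sets history = sigma_sets (space M) generators" "space history = space M" by simp_all
qed

lemma Z_history: "s \<le> t \<Longrightarrow> Z s k \<in> measurable history (count_space UNIV)"
  unfolding measurable_count_space_eq2_countable
  by (auto simp: sets_history space_history generators_def vimage_def Int_def conj_commute intro!: sigma_sets.Basic)

text \<open>One event \<open>C'\<close> of fields must represent \<open>C\<close> both for the given
  variables and for the resampled ones. In this form the property passes to complements and
  countable unions.\<close>

definition resampling_invariant :: "'w set \<Rightarrow> bool" where
  "resampling_invariant C \<longleftrightarrow> C \<in> sets M \<and> (\<exists>C'\<in>sets uniforms. (AE \<omega> in M. \<omega> \<in> C \<longleftrightarrow> vars \<omega> \<in> C') \<and>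
     (AE p in P2. fst p \<in> C \<longleftrightarrow> resample UNIV (vars (fst p)) (snd p) \<in> C'))"

lemma resampling_invariantI:
  assumes "C \<in> sets M" "C' \<in> sets uniforms" "AE \<omega> in M. \<omega> \<in> C \<longleftrightarrow> vars \<omega> \<in> C'"
    "AE p in P2. fst p \<in> C \<longleftrightarrow> resample UNIV (vars (fst p)) (snd p) \<in> C'"
  shows "resampling_invariant C"
  unfolding resampling_invariant_def using assms by (intro conjI bexI[of _ C'])

text \<open>The generators are read off merged labels: positions through \<open>particle_at\<close>,
  first-class edges because merging leaves class 1 alone.\<close>

lemma history_invariant:
  assumes "C \<in> sets history"
  shows "resampling_invariant C"
  using assms unfolding sets_history
proof (induction C rule: sigma_sets.induct)
  case (Basic a)
  have comp: "(\<lambda>u. u v) \<in> borel_measurable (uniforms :: (int \<times> nat \<Rightarrow> real) measure)" for v by measurable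
  consider s k z where "a = {\<omega> \<in> space M. Z s k \<omega> = z}" | e where "a = {\<omega> \<in> space M. L (vars \<omega>) e = Fin 1}"
    using Basic by (auto simp: generators_def)
  then show ?case
  proof cases
    case (1 s k z)
    have "a \<in> sets M" using measurable_sets[OF Z, of "{z}" s k] by (simp add: 1 vimage_def Int_def conj_commute)
    moreover have "{u. particle_at u s k z} \<in> sets uniforms"
      using pred_particle_at[of "\<lambda>u. u" uniforms s k z] comp by (simp add: pred_def)
    moreover have "AE \<omega> in M. \<omega> \<in> a \<longleftrightarrow> vars \<omega> \<in> {u. particle_at u s k z}"
      using AE_M AE_space
    proof eventually_elim
      case (elim \<omega>)
      then have "particle_at (vars \<omega>) s k z \<longleftrightarrow> Z s k \<omega> = z" by (intro particle_at_iff) auto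
      then show ?case using elim by (simp add: 1)
    qed
    moreover have "AE p in P2. fst p \<in> a \<longleftrightarrow> resample UNIV (vars (fst p)) (snd p) \<in> {u. particle_at u s k z}"
      using AE_P2 AE_space by eventually_elim (auto simp: 1 resampled_particle space_pair_measure)
    ultimately show ?thesis by (rule resampling_invariantI)
  next
    case (2 e)
    have "Measurable.pred M (\<lambda>\<omega>. L (vars \<omega>) e = Fin 1)" by (rule pred_L) measurable
    then have "a \<in> sets M" by (simp add: 2 pred_def)
    moreover have "{u. L u e = Fin 1} \<in> sets uniforms"
      using pred_L[of "\<lambda>u. u" uniforms "\<lambda>l. l = Fin 1" e] comp by (simp add: pred_def del: s6v_label.simps)
    moreover have "AE \<omega> in M. \<omega> \<in> a \<longleftrightarrow> vars \<omega> \<in> {u. L u e = Fin 1}"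
      by (rule AE_I2) (simp add: 2)
    moreover have "AE p in P2. fst p \<in> a \<longleftrightarrow> resample UNIV (vars (fst p)) (snd p) \<in> {u. L u e = Fin 1}"
      using AE_P2 AE_space
    proof eventually_elim
      case (elim p)
      then have "merge (L (resample UNIV (vars (fst p)) (snd p)) e) = merge (L (vars (fst p)) e)"
        by (intro resampled_merge) auto
      then have "L (resample UNIV (vars (fst p)) (snd p)) e = Fin 1 \<longleftrightarrow> L (vars (fst p)) e = Fin 1"
        by (metis merge_eq_1_iff)
      moreover have "fst p \<in> space M" using elim by (auto simp: space_pair_measure)
      ultimately show ?case unfolding 2 by blast
    qed
    ultimately show ?thesis by (rule resampling_invariantI)
  qed
next
  case Empty
  show ?case by (rule resampling_invariantI[of _ "{}"]) auto
next
  case (Compl a)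
  then obtain C' where C': "a \<in> sets M" "C' \<in> sets uniforms" "AE \<omega> in M. \<omega> \<in> a \<longleftrightarrow> vars \<omega> \<in> C'"
    "AE p in P2. fst p \<in> a \<longleftrightarrow> resample UNIV (vars (fst p)) (snd p) \<in> C'"
    unfolding resampling_invariant_def by blast
  have "space M - a \<in> sets M" using C'(1) by (rule sets.compl_sets)
  moreover have "space uniforms - C' \<in> sets uniforms" using C'(2) by (rule sets.compl_sets)
  moreover have "AE \<omega> in M. \<omega> \<in> space M - a \<longleftrightarrow> vars \<omega> \<in> space uniforms - C'"
    using C'(3) AE_space by eventually_elim auto
  moreover have "AE p in P2. fst p \<in> space M - a \<longleftrightarrow> resample UNIV (vars (fst p)) (snd p) \<in> space uniforms - C'"
    using C'(4) AE_space by eventually_elim (auto simp: space_pair_measure)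
  ultimately show ?case by (rule resampling_invariantI)
next
  case (Union a)
  let ?Q = "\<lambda>i C'. C' \<in> sets uniforms \<and> (AE \<omega> in M. \<omega> \<in> a i \<longleftrightarrow> vars \<omega> \<in> C') \<and>
     (AE p in P2. fst p \<in> a i \<longleftrightarrow> resample UNIV (vars (fst p)) (snd p) \<in> C')"
  have "\<forall>i. \<exists>C'. ?Q i C'"
    using Union unfolding resampling_invariant_def by blast
  from choice[OF this] obtain C' where "\<forall>i. ?Q i (C' i)" ..
  then have C': "\<And>i. a i \<in> sets M" "\<And>i. C' i \<in> sets uniforms" "\<And>i. AE \<omega> in M. \<omega> \<in> a i \<longleftrightarrow> vars \<omega> \<in> C' i"
    "\<And>i. AE p in P2. fst p \<in> a i \<longleftrightarrow> resample UNIV (vars (fst p)) (snd p) \<in> C' i"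
    using Union unfolding resampling_invariant_def by blast+
  have "(\<Union>i. a i) \<in> sets M" "(\<Union>i::nat. C' i) \<in> sets uniforms" using C'(1,2) by auto
  moreover have "AE \<omega> in M. \<forall>i. \<omega> \<in> a i \<longleftrightarrow> vars \<omega> \<in> C' i"
    unfolding AE_all_countable by (intro allI, rule C'(3))
  then have "AE \<omega> in M. \<omega> \<in> (\<Union>i. a i) \<longleftrightarrow> vars \<omega> \<in> (\<Union>i. C' i)"
    by eventually_elim auto
  moreover have "AE p in P2. \<forall>i. fst p \<in> a i \<longleftrightarrow> resample UNIV (vars (fst p)) (snd p) \<in> C' i"
    unfolding AE_all_countable by (intro allI, rule C'(4))
  then have "AE p in P2. fst p \<in> (\<Union>i. a i) \<longleftrightarrow> resample UNIV (vars (fst p)) (snd p) \<in> (\<Union>i. C' i)"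
    by eventually_elim auto
  ultimately show ?case by (rule resampling_invariantI)
qed

lemma subalgebra_history: "subalgebra M history"
  unfolding subalgebra_def space_history
  using history_invariant by (auto simp: resampling_invariant_def)

lemma measurable_meeting_vars:
  assumes "s < t" and Z': "\<And>s k. s \<le> t \<Longrightarrow> (\<lambda>x. Z s k (f x)) \<in> measurable N (count_space UNIV)"
    and g: "\<And>v. (\<lambda>x. g x v) \<in> borel_measurable N"
  shows "(\<lambda>x. meeting_vars (\<lambda>s k. Z s k (f x)) (g x) s k) \<in> borel_measurable N"
proof -
  have [measurable]: "(\<lambda>x. Z (Suc s) k (f x)) \<in> measurable N (count_space UNIV)" "(\<lambda>x. Z s (k + 1) (f x)) \<in> measurable N (count_space UNIV)"
    using assms(1) by (auto intro: Z')
  have [measurable]: "(\<lambda>x. g x (Z s (k + 1) (f x) + int s, s)) \<in> borel_measurable N"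
    by (rule measurable_compose_countable[of "\<lambda>i x. g x (i + int s, s)", OF g]) measurable
  show ?thesis unfolding meeting_vars_def by measurable
qed

text \<open>The sweeps before time \<open>t\<close> use only the positions up to time
  \<open>t\<close>. With \<open>N = history\<close> this makes the kernel measurable with respect to
  the conditioning.\<close>

lemma measurable_resampled_classes:
  assumes "\<And>s k. s \<le> t \<Longrightarrow> Z s k \<in> measurable N (count_space UNIV)"
  shows "(\<lambda>(\<omega>, u). resampled_classes \<omega> u) \<in> measurable (N \<Otimes>\<^sub>M uniforms) config_space"
  unfolding resampled_classes_def split_beta'
  by (intro measurable_evolve measurable_meeting_vars measurable_compose[OF measurable_fst assms]
     measurable_compose[OF measurable_snd measurable_uniforms_component])

lemma kernel_measurable: "kernel \<in> measurable history (prob_algebra config_space)"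
  unfolding kernel_def
proof (rule measurable_distr_prob_space2)
  show "(\<lambda>\<omega>. uniforms :: (int \<times> nat \<Rightarrow> real) measure) \<in> measurable history (prob_algebra uniforms)"
    by (intro measurable_const) (simp add: space_prob_algebra prob_space_uniforms)
  show "(\<lambda>(\<omega>, u). resampled_classes \<omega> u) \<in> measurable (history \<Otimes>\<^sub>M uniforms) config_space"
    by (rule measurable_resampled_classes[OF Z_history])
qed

lemma emeasure_kernel:
  assumes "\<omega> \<in> space M" "B \<in> sets config_space"
  shows "emeasure (kernel \<omega>) B = emeasure uniforms {u. resampled_classes \<omega> u \<in> B}"
proof -
  have "resampled_classes \<omega> \<in> measurable uniforms config_space"
    using measurable_compose[OF measurable_Pair1'[OF assms(1)] measurable_resampled_classes[OF Z]] by simp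
  then show ?thesis
    using assms(2) unfolding kernel_def by (subst emeasure_distr) (auto simp: vimage_def)
qed

lemma particle_classes_measurable: "particle_classes \<in> measurable M config_space"
  unfolding measurable_config_space_iff
proof
  fix k
  have "(\<lambda>\<omega>. L (vars \<omega>) (Vert (Z t k \<omega> + int t) t)) \<in> measurable M (count_space UNIV)"
    by (rule measurable_compose_countable[of "\<lambda>i \<omega>. L (vars \<omega>) (Vert (i + int t) t)", OF measurable_L Z]) measurable
  then show "Measurable.pred M (\<lambda>\<omega>. particle_classes \<omega> k)"
    unfolding particle_classes_def s6v_def by (rule measurable_compose) simp
qed

text \<open>The given and the resampled field have the same law, and resampling respects
  \<open>C\<close>. The event is thus moved to the product space, where the classes are those driven
  by an independent \<open>u\<close>, and Fubini gives the kernel.\<close>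

lemma disintegration:
  assumes C: "C \<in> sets history" and B: "B \<in> sets config_space"
  shows "emeasure M (C \<inter> (particle_classes -` B \<inter> space M)) = (\<integral>\<^sup>+\<omega>. indicator C \<omega> * emeasure (kernel \<omega>) B \<partial>M)"
proof -
  let ?U = "uniforms :: (int \<times> nat \<Rightarrow> real) measure"
  interpret UU: prob_space ?U by (rule prob_space_uniforms)
  interpret MU: pair_sigma_finite M ?U ..
  obtain C' where C': "C \<in> sets M" "C' \<in> sets ?U" "AE \<omega> in M. \<omega> \<in> C \<longleftrightarrow> vars \<omega> \<in> C'"
    "AE p in P2. fst p \<in> C \<longleftrightarrow> resample UNIV (vars (fst p)) (snd p) \<in> C'"
    using history_invariant[OF C] unfolding resampling_invariant_def by blast
  define D where "D = C' \<inter> (classes t -` B \<inter> space ?U)"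
  have cl: "classes t \<in> measurable ?U config_space" by (rule measurable_classes) measurable
  have D: "D \<in> sets ?U" using C'(2) measurable_sets[OF cl B] by (auto simp: D_def)
  define E where "E = {p \<in> space P2. fst p \<in> C \<and> resampled_classes (fst p) (snd p) \<in> B}"
  have E: "E \<in> sets P2"
  proof -
    have "(\<lambda>p. resampled_classes (fst p) (snd p)) \<in> measurable P2 config_space"
      using measurable_resampled_classes[OF Z] by (simp add: split_beta')
    from measurable_sets[OF this B] have "(\<lambda>p. resampled_classes (fst p) (snd p)) -` B \<inter> space P2 \<in> sets P2" .
    moreover have "fst -` C \<inter> space P2 \<in> sets P2" using C'(1) by (intro measurable_sets[OF measurable_fst])
    moreover have "E = (fst -` C \<inter> space P2) \<inter> ((\<lambda>p. resampled_classes (fst p) (snd p)) -` B \<inter> space P2)"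
      by (auto simp: E_def)
    ultimately show ?thesis by (simp only: sets.Int)
  qed
  have "emeasure M (C \<inter> (particle_classes -` B \<inter> space M)) = emeasure M (vars -` D \<inter> space M)"
  proof (rule emeasure_eq_AE)
    show "AE \<omega> in M. \<omega> \<in> C \<inter> (particle_classes -` B \<inter> space M) \<longleftrightarrow> \<omega> \<in> vars -` D \<inter> space M"
      using C'(3) particle_classes_eq by eventually_elim (auto simp: D_def)
    show "C \<inter> (particle_classes -` B \<inter> space M) \<in> sets M"
      using C'(1) measurable_sets[OF particle_classes_measurable B] by auto
    show "vars -` D \<inter> space M \<in> sets M" using D by (rule measurable_sets[OF vars_measurable])
  qed
  also have "\<dots> = emeasure (distr M ?U vars) D" by (rule emeasure_distr[symmetric, OF vars_measurable D])
  also have "\<dots> = emeasure (distr P2 ?U (\<lambda>p. resample UNIV (vars (fst p)) (snd p))) D"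
    by (simp only: distr_vars distr_resample)
  also have "\<dots> = emeasure P2 ((\<lambda>p. resample UNIV (vars (fst p)) (snd p)) -` D \<inter> space P2)"
    by (rule emeasure_distr[OF resample_measurable D])
  also have "\<dots> = emeasure P2 E"
  proof (rule emeasure_eq_AE)
    show "AE p in P2. p \<in> (\<lambda>p. resample UNIV (vars (fst p)) (snd p)) -` D \<inter> space P2 \<longleftrightarrow> p \<in> E"
      using C'(4) AE_P2 AE_space by eventually_elim (auto simp: D_def E_def resampled_classes_eq)
    show "(\<lambda>p. resample UNIV (vars (fst p)) (snd p)) -` D \<inter> space P2 \<in> sets P2"
      using D by (rule measurable_sets[OF resample_measurable])
  qed (rule E)
  also have "\<dots> = (\<integral>\<^sup>+\<omega>. emeasure ?U (Pair \<omega> -` E) \<partial>M)"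
    by (rule UU.emeasure_pair_measure_alt[OF E])
  also have "\<dots> = (\<integral>\<^sup>+\<omega>. indicator C \<omega> * emeasure (kernel \<omega>) B \<partial>M)"
  proof (intro nn_integral_cong)
    fix \<omega> assume \<omega>: "\<omega> \<in> space M"
    have "Pair \<omega> -` E = (if \<omega> \<in> C then {u. resampled_classes \<omega> u \<in> B} else {})"
      using \<omega> by (auto simp: E_def space_pair_measure)
    then show "emeasure ?U (Pair \<omega> -` E) = indicator C \<omega> * emeasure (kernel \<omega>) B"
      by (simp add: emeasure_kernel[OF \<omega> B])
  qed
  finally show ?thesis .
qed

lemma prob_space_kernel: "\<omega> \<in> space M \<Longrightarrow> prob_space (kernel \<omega>)" and sets_kernel: "sets (kernel \<omega>) = sets config_space"
  using measurable_space[OF kernel_measurable, of \<omega>] by (auto simp: space_history space_prob_algebra kernel_def)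

text \<open>A conditional expectation is characterised by its integrals over the events of the
  history, which \<open>disintegration\<close> supplies.\<close>

lemma conditional_law_kernel: "conditional_law M history config_space particle_classes kernel"
  unfolding conditional_law_def
proof (intro conjI kernel_measurable ballI)
  interpret finite_measure_subalgebra M history
    by unfold_locales (rule subalgebra_history)
  fix B assume B: "B \<in> sets config_space"
  let ?X = "particle_classes -` B \<inter> space M"
  have X: "?X \<in> events" by (rule measurable_sets[OF particle_classes_measurable B])
  have g: "(\<lambda>\<omega>. measure (kernel \<omega>) B) \<in> borel_measurable history"
    using measurable_compose[OF kernel_measurable measurable_measure_prob_algebra[OF B]] .
  then have gM: "(\<lambda>\<omega>. measure (kernel \<omega>) B) \<in> borel_measurable M"
    using measurable_from_subalg[OF subalgebra_history] by blast
  have gi: "integrable M (\<lambda>\<omega>. measure (kernel \<omega>) B)"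
    using gM prob_space_kernel by (intro integrable_const_bound[of _ 1]) (auto intro!: AE_I2 prob_space.prob_le_1)
  have "AE \<omega> in M. real_cond_exp M history (indicator ?X) \<omega> = measure (kernel \<omega>) B"
  proof (rule real_cond_exp_charact)
    fix C assume C: "C \<in> sets history"
    then have CM: "C \<in> events" using subalgebra_history by (auto simp: subalgebra_def)
    have "(\<integral>\<omega>\<in>C. indicator ?X \<omega> \<partial>M) = prob (C \<inter> ?X)"
      using CM X by (simp add: set_lebesgue_integral_def indicator_inter_arith[symmetric])
    also have "\<dots> = (\<integral>\<omega>\<in>C. measure (kernel \<omega>) B \<partial>M)"
    proof -
      have "ennreal (prob (C \<inter> ?X)) = (\<integral>\<^sup>+\<omega>. indicator C \<omega> * emeasure (kernel \<omega>) B \<partial>M)"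
        using disintegration[OF C B] by (simp add: emeasure_eq_measure)
      also have "\<dots> = (\<integral>\<^sup>+\<omega>. ennreal (indicator C \<omega> * measure (kernel \<omega>) B) \<partial>M)"
      proof (intro nn_integral_cong)
        fix \<omega> assume "\<omega> \<in> space M"
        then interpret K: prob_space "kernel \<omega>" by (rule prob_space_kernel)
        show "indicator C \<omega> * emeasure (kernel \<omega>) B = ennreal (indicator C \<omega> * measure (kernel \<omega>) B)"
          by (simp add: indicator_def K.emeasure_eq_measure)
      qed
      also have "\<dots> = ennreal (\<integral>\<omega>. indicator C \<omega> * measure (kernel \<omega>) B \<partial>M)"
        using integrable_mult_indicator[OF CM gi] by (intro nn_integral_eq_integral) simp_all
      finally show ?thesis
        by (simp add: set_lebesgue_integral_def integral_nonneg_AE)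
    qed
    finally show "(\<integral>\<omega>\<in>C. indicator ?X \<omega> \<partial>M) = (\<integral>\<omega>\<in>C. measure (kernel \<omega>) B \<partial>M)" .
  next
    show "integrable M (indicator ?X :: 'w \<Rightarrow> real)"
      using X by (intro integrable_real_indicator) (simp_all add: less_top[symmetric])
  qed (use gi g in auto)
  then show "AE \<omega> in M. measure (kernel \<omega>) B = real_cond_exp M history (indicator ?X) \<omega>"
    by eventually_elim simp
qed

section \<open>Domination of the conditional law\<close>

lemma kernel_dominated:
  assumes z: "\<And>s. strict_mono (\<lambda>k. Z s k \<omega>)"
  shows "stoch_dominates (blocking_measure (b1 / b2)) (kernel \<omega>) \<and> (AE \<eta> in kernel \<omega>. \<eta> \<in> balanced_configs)"
proof -
  define q where "q = b1 / b2"
  have q: "0 < q" "q < 1" "q * b2 = b1" using b by (auto simp: q_def)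
  define A where "A = {(s, k). Z (Suc s) k \<omega> + 1 = Z s (k + 1) \<omega>}"
  \<comment> \<open>The vertex at which the particles \<open>k\<close> and \<open>k + 1\<close>
    would meet in row \<open>s\<close>. Strict monotonicity of the positions makes this injective,
    so that the variables read there are again independent and uniform.\<close>
  define \<phi> where "\<phi> = (\<lambda>(s, k). (Z s (k + 1) \<omega> + int s, s))"
  have inj: "inj \<phi>"
    using z[THEN strict_mono_eq] by (auto simp: \<phi>_def inj_def)
  have "distr uniforms uniforms (\<lambda>u. \<lambda>n\<in>UNIV. u (\<phi> n)) = uniforms"
    by (rule distr_PiM_reindex[OF prob_space_unit]) (use inj in auto)
  then have d: "distr uniforms uniforms (\<lambda>u n. u (\<phi> n)) = uniforms"
    by (simp add: restrict_def)
  have \<phi>m: "(\<lambda>u n. u (\<phi> n)) \<in> measurable uniforms uniforms"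
    unfolding measurable_uniforms_iff by (intro allI measurable_uniforms_component)
  have m: "(\<lambda>u. evolve b2 b1 (masked A u) t) \<in> measurable uniforms config_space"
    by (intro measurable_evolve measurable_masked)
  have "meeting_vars (\<lambda>s k. Z s k \<omega>) u = masked A (\<lambda>n. u (\<phi> n))" for u
    by (simp add: fun_eq_iff meeting_vars_def masked_def A_def \<phi>_def)
  then have "kernel \<omega> = distr uniforms config_space ((\<lambda>u. evolve b2 b1 (masked A u) t) \<circ> (\<lambda>u n. u (\<phi> n)))"
    unfolding kernel_def resampled_classes_def by (simp add: o_def)
  also have "\<dots> = distr uniforms config_space (\<lambda>u. evolve b2 b1 (masked A u) t)"
    by (subst distr_distr[OF m \<phi>m, symmetric]) (simp only: d)
  finally have k: "kernel \<omega> = distr uniforms config_space (\<lambda>u. evolve b2 b1 (masked A u) t)" .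
  obtain P where P: "insertion_law q P" "blocking_measure q = distr (measure_pmf P) config_space id"
    using blocking_measure_pmf[OF q(1,2)] .
  obtain R g where R: "kernel \<omega> = distr (measure_pmf R) config_space id" "dominated_coupling P R g"
    using evolve_dominated[OF q(1,2) _ b(3) P(1), of A t] b unfolding q(3) k by auto
  have "set_pmf R \<subseteq> balanced_configs"
    using R(2) by (fastforce simp: dominated_coupling_def)
  then have "AE \<eta> in kernel \<omega>. \<eta> \<in> balanced_configs"
    unfolding R(1) using countable_in_config_space[OF countable_balanced]
    by (subst AE_distr_iff) (auto simp: AE_measure_pmf_iff)
  with stoch_dominates_pmf[OF R(2)] show ?thesis
    by (simp only: R(1) P(2) q_def[symmetric])
qed

text \<open>Two versions agree at each single configuration outside a null set. Countably many
  configurations carry the kernel, so that outside one null set the versions coincide as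
  measures.\<close>

lemma conditional_law_dominated:
  assumes \<kappa>: "conditional_law M history config_space particle_classes \<kappa>"
  shows "AE \<omega> in M. stoch_dominates (blocking_measure (b1 / b2)) (\<kappa> \<omega>)"
proof -
  have "AE \<omega> in M. \<forall>\<eta>\<in>balanced_configs. measure (\<kappa> \<omega>) {\<eta>} = measure (kernel \<omega>) {\<eta>}"
  proof (rule AE_ball_countable'[OF _ countable_balanced])
    fix \<eta>
    have "AE \<omega> in M. measure (\<kappa> \<omega>) {\<eta>} = real_cond_exp M history (indicator (particle_classes -` {\<eta>} \<inter> space M)) \<omega>"
      "AE \<omega> in M. measure (kernel \<omega>) {\<eta>} = real_cond_exp M history (indicator (particle_classes -` {\<eta>} \<inter> space M)) \<omega>"
      using \<kappa> conditional_law_kernel unfolding conditional_law_def by simp_all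
    then show "AE \<omega> in M. measure (\<kappa> \<omega>) {\<eta>} = measure (kernel \<omega>) {\<eta>}"
      by eventually_elim simp
  qed
  moreover note AE_M AE_space
  ultimately show ?thesis
  proof eventually_elim
    case (elim \<omega>)
    have z: "strict_mono (\<lambda>k. Z s k \<omega>)" for s
      using elim by (simp add: ordered_positions_def)
    note k = kernel_dominated[OF z]
    have "\<kappa> \<in> measurable history (prob_algebra config_space)"
      using \<kappa> by (simp add: conditional_law_def)
    then have "\<kappa> \<omega> \<in> space (prob_algebra config_space)"
      by (rule measurable_space) (use elim in \<open>simp add: space_history\<close>)
    then have "\<kappa> \<omega> = kernel \<omega>"
      using k elim prob_space_kernel[of \<omega>] sets_kernel[of \<omega>]
      by (intro config_measure_eqI) (simp_all add: space_prob_algebra)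
    then show ?case using k by simp
  qed
qed

end

text \<open>A conditional law is determined only up to null sets, which is why domination is claimed
  for every version; the existence of one keeps this from being vacuous.\<close>

theorem theorem4p7:
  fixes b1 b2 :: real
    and \<eta>\<^sub>0 :: "int \<Rightarrow> label"
    and M :: "'w measure"
    and U :: "int \<times> nat \<Rightarrow> 'w \<Rightarrow> real"
    and Z :: "nat \<Rightarrow> int \<Rightarrow> 'w \<Rightarrow> int"
    and \<xi> :: "nat \<Rightarrow> 'w \<Rightarrow> int \<Rightarrow> bool"
    and t :: nat
  assumes "0 < b1" and "b1 < b2" and "b2 < 1"
    and "prob_space M"
    and "prob_space.indep_vars M (\<lambda>_. borel) U UNIV"
    and "\<And>v. distr M borel (U v) = uniform_measure lborel {0..1}"
    and first_class: "\<exists>x. \<eta>\<^sub>0 x = Fin 1"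
    and second_class: "infinite {x. \<eta>\<^sub>0 x = Fin 2}" "\<And>x. \<eta>\<^sub>0 x = Fin 2 \<Longrightarrow> x > 0"
    and third_class: "infinite {x. \<eta>\<^sub>0 x = Fin 3}" "\<And>x. \<eta>\<^sub>0 x = Fin 3 \<Longrightarrow> x \<le> 0"
    and other_positions: "\<And>x. \<eta>\<^sub>0 x \<in> {Fin 1, Fin 2, Fin 3, Pinf}"
    and "\<And>s k. Z s k \<in> measurable M (count_space UNIV)"
    and "AE \<omega> in M. \<forall>s. ordered_positions (s6v b1 b2 (\<lambda>v. U v \<omega>) \<eta>\<^sub>0 s) (\<lambda>k. Z s k \<omega>)"
  defines "\<xi> \<equiv> \<lambda>s \<omega> k. s6v b1 b2 (\<lambda>v. U v \<omega>) \<eta>\<^sub>0 s (Z s k \<omega>) = Fin 2"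
    and "G \<equiv> history_algebra M Z (\<lambda>e \<omega>. s6v_label b1 b2 (\<lambda>v. U v \<omega>) \<eta>\<^sub>0 e) t"
  shows "(\<exists>\<kappa>. conditional_law M G config_space (\<xi> t) \<kappa>) \<and>
    (\<forall>\<kappa>. conditional_law M G config_space (\<xi> t) \<kappa> \<longrightarrow>
      (AE \<omega> in M. stoch_dominates (blocking_measure (b1 / b2)) (\<kappa> \<omega>)))"
proof -
  interpret prob_space M by fact
  interpret s6v_process b1 b2 \<eta>\<^sub>0 M U Z t
    by unfold_locales (use assms in auto)
  have "G = history" "\<xi> t = particle_classes"
    by (simp_all add: G_def history_def \<xi>_def particle_classes_def vars_def fun_eq_iff)
  then show ?thesis
    using conditional_law_kernel conditional_law_dominated by (simp only:) blast
qed

end
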